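(* Let $0<p\le1$ be a constant and $0<\varepsilon<(p/4)^{12}$. Then there is a constant $n_0$ such that for every natural number $n\ge n_0$, every graph $G\in\mathcal{Q}(n,p,\varepsilon)$ admits a $9\varepsilon$-near triangular embedding.
   Context: Cut distance: for edge-weighted graphs $G,H$ on the same vertex set $V$, $\mathsf{d}_\square(G,H)=\max_{U,W\subseteq V}|\mathsf{e}_G(U,W)-\mathsf{e}_H(U,W)|/|V|^2$, where $\mathsf{e}_G(U,W)$ is the total weight of edges with one endvertex in $U$ and the other in $W$. $K(n,p)$ is the complete graph on $n$ vertices with all edge weights $p$; $\mathcal{Q}(n,p,\varepsilon)$ is the set of graphs $G$ on $n$ vertices with $\mathsf{d}_\square(G,K(n,p))<\varepsilon$ after identifying $V(G)$ with $V(K(n,p))$ by a bijection. An embedding means a 2-cell embedding of $G$ in an orientable surface (given by a rotation system). For $\delta>0$, an embedding is $\delta$-near triangular if all but at most $2\delta|E(G)|$ edges of $G$ belong to two triangular faces (faces bounded by 3-cycles). *)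

theory Defs
  imports Complex_Main "HOL-Combinatorics.Orbits" "Graph_Theory.Pair_Digraph"
begin

text \<open>
  Finite simple graphs are \<^locale>\<open>pair_graph\<close>s: an undirected edge \<open>{u, v}\<close> is represented by
  the two arcs \<open>(u, v)\<close> and \<open>(v, u)\<close>.
\<close>

definition uedges :: "'a pair_pre_digraph \<Rightarrow> 'a set set" where
  "uedges G = {{u, v} | u v. (u, v) \<in> parcs G}"


subsection \<open>Cut distance\<close>

text \<open>
  An edge-weighted graph on a given vertex set is a function assigning a weight to each edge
  \<open>{u, v}\<close>, with weight 0 for non-edges. In \<open>cut_weight w U W\<close> the sum ranges over a set of
  unordered pairs, so an edge with both endvertices in \<open>U \<inter> W\<close> contributes its weight once.
\<close>

definition cut_weight :: "('a set \<Rightarrow> real) \<Rightarrow> 'a set \<Rightarrow> 'a set \<Rightarrow> real" where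
  "cut_weight w U W = (\<Sum>e \<in> {{u, v} | u v. u \<in> U \<and> v \<in> W \<and> u \<noteq> v}. w e)"

definition cut_dist :: "'a set \<Rightarrow> ('a set \<Rightarrow> real) \<Rightarrow> ('a set \<Rightarrow> real) \<Rightarrow> real" where
  "cut_dist V w w' =
     Max ((\<lambda>(U, W). \<bar>cut_weight w U W - cut_weight w' U W\<bar> / (real (card V))\<^sup>2) ` (Pow V \<times> Pow V))"

definition graph_weight :: "'a pair_pre_digraph \<Rightarrow> 'a set \<Rightarrow> real" where
  "graph_weight G e = (if e \<in> uedges G then 1 else 0)"

definition K_weight :: "nat \<Rightarrow> real \<Rightarrow> nat set \<Rightarrow> real" where
  "K_weight n p e = (if e \<subseteq> {..<n} \<and> card e = 2 then p else 0)"

definition quasirandom_class :: "nat \<Rightarrow> real \<Rightarrow> real \<Rightarrow> 'a pair_pre_digraph set" where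
  "quasirandom_class n p \<epsilon> =
     {G. pair_graph G \<and> card (pverts G) = n \<and>
         (\<exists>\<phi>. bij_betw \<phi> (pverts G) {..<n} \<and>
              cut_dist (pverts G) (graph_weight G) (\<lambda>e. K_weight n p (\<phi> ` e)) < \<epsilon>)}"


subsection \<open>Embeddings in orientable surfaces\<close>

text \<open>
  A rotation system assigns to each vertex a cyclic permutation of its neighbours; only the values
  \<open>rot v u\<close> with \<open>u\<close> a neighbour of \<open>v\<close> are relevant. An isolated vertex has the empty rotation,
  which \<^const>\<open>cyclic_on\<close> excludes.
\<close>

definition rotation_system :: "'a pair_pre_digraph \<Rightarrow> ('a \<Rightarrow> 'a \<Rightarrow> 'a) \<Rightarrow> bool" where
  "rotation_system G rot \<longleftrightarrow>
     (\<forall>v \<in> pverts G. parcs G `` {v} \<noteq> {} \<longrightarrow> cyclic_on (rot v) (parcs G `` {v}))"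

text \<open>
  Face tracing: having traversed the arc from \<open>u\<close> to \<open>v\<close>, continue along the edge that follows
  \<open>{v, u}\<close> in the rotation at \<open>v\<close>. Faces are the orbits of this map, i.e. facial walks as sets of
  arcs; each edge is traversed twice in total, once in each direction.
\<close>

fun face_step :: "('a \<Rightarrow> 'a \<Rightarrow> 'a) \<Rightarrow> 'a \<times> 'a \<Rightarrow> 'a \<times> 'a" where
  "face_step rot (u, v) = (v, rot v u)"

definition faces :: "'a pair_pre_digraph \<Rightarrow> ('a \<Rightarrow> 'a \<Rightarrow> 'a) \<Rightarrow> ('a \<times> 'a) set set" where
  "faces G rot = orbit (face_step rot) ` parcs G"

definition triangular_face :: "('a \<times> 'a) set \<Rightarrow> bool" where
  "triangular_face F \<longleftrightarrow> (\<exists>u v w. distinct [u, v, w] \<and> F = {(u, v), (v, w), (w, u)})"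

definition edge_on_face :: "'a set \<Rightarrow> ('a \<times> 'a) set \<Rightarrow> bool" where
  "edge_on_face e F \<longleftrightarrow> (\<exists>u v. e = {u, v} \<and> (u, v) \<in> F)"

definition in_two_triangular_faces ::
  "'a pair_pre_digraph \<Rightarrow> ('a \<Rightarrow> 'a \<Rightarrow> 'a) \<Rightarrow> 'a set \<Rightarrow> bool" where
  "in_two_triangular_faces G rot e \<longleftrightarrow>
     (\<exists>F \<in> faces G rot. \<exists>F' \<in> faces G rot. F \<noteq> F' \<and>
        triangular_face F \<and> triangular_face F' \<and> edge_on_face e F \<and> edge_on_face e F')"

definition near_triangular ::
  "real \<Rightarrow> 'a pair_pre_digraph \<Rightarrow> ('a \<Rightarrow> 'a \<Rightarrow> 'a) \<Rightarrow> bool" where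
  "near_triangular \<delta> G rot \<longleftrightarrow>
     real (card {e \<in> uedges G. \<not> in_two_triangular_faces G rot e}) \<le> 2 * \<delta> * real (card (uedges G))"

end

theory Submission
  imports Defs "HOL-Library.Disjoint_Sets"
begin

text \<open>
  Write \<open>A = p + R\<close> for the adjacency matrix, where \<open>R\<close> has small cut norm, and fix the rotations
  through a large family of arc-disjoint directed triangles that become faces.

  \<^emph>\<open>Fractional packing.\<close> Giving weight \<open>1/(p\<^sup>2n)\<close> to every triangle almost covers every edge once, but the
  error is of first order in \<open>\<epsilon>\<close> with a bad dependence on \<open>p\<close>. A correction of the weights that is
  linear in the codegree deviations removes the first-order error. The deviations themselves are the
  entries of \<open>R\<^sup>2\<close>; Grothendieck's inequality bounds their square sum by \<open>O(\<epsilon>\<^sup>3\<^sup>/\<^sup>2)\<close>, which the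
  assumption \<open>\<epsilon> < (p/4)\<^sup>1\<^sup>2\<close> turns into a small multiple of \<open>\<epsilon>p\<close>. The few vertices of exceptional
  degree are treated first, through triangles with exactly one exceptional vertex.

  \<^emph>\<open>Integral packing.\<close> The arcs and the directed triangles form a linear 3-uniform hypergraph, in which a
  semi-random greedy argument converts fractional matchings with small weights into integral ones of
  almost the same size.

  \<^emph>\<open>Rotations.\<close> The triangles at a vertex \<open>v\<close> prescribe a partial injection on its neighbours, which
  extends to a cyclic rotation once each of its cycles is cut open. To keep the cycles long, the pairs
  \<open>(v, u)\<close> get random labels modulo \<open>L\<close> beforehand, and only triangles along which the labels increase
  by 1 at all three corners are used; this costs only an error tending to 0, and every cycle has length
  at least \<open>L\<close>.
\<close>

section \<open>Grothendieck's inequality\<close>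

text \<open>An edge lies on two triangular faces as soon as both of its arcs lie in directed
  triangles that become faces. The edges that fail are therefore at most as many as the uncovered
  arcs, and the factor 2 in the definition of near triangular turns the budget into
  \<open>9 * \<epsilon>\<close> times the number of arcs, about
  \<open>9 * \<epsilon> * p * n\<^sup>2\<close>. The factor p in it is the obstacle: under uniform
  weights an arc from u to v is covered \<open>1 + \<rho> u + \<rho> v + \<mu> u v\<close> times,
  with degree deviations \<rho> and codegree deviations \<mu>, and the cut norm bounds the absolute
  sum of \<mu> only by the order of \<open>\<epsilon> / p\<^sup>2 * n\<^sup>2\<close>. So the first
  order has to cancel, and what is left are products of two deviations. The cut norm tests a matrix
  against signs, whereas these products pair it with families of vectors; Grothendieck's inequality
  makes this passage at the price of a constant, and short vectors contribute the extra factor of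
  order \<open>sqrt \<epsilon>\<close>. The fractional cover spends 8 of the 9; the remainder pays
  for the vanishing errors and for a number of arcs slightly below
  \<open>p * n\<^sup>2\<close>.\<close>

definition rademacher :: "(nat \<Rightarrow> real) \<Rightarrow> nat \<Rightarrow> nat set \<Rightarrow> real" where
  "rademacher u m S = (\<Sum>k<m. if k \<in> S then u k else - u k)"

lemma sum_Pow_lessThan_Suc:
  fixes F :: "nat set \<Rightarrow> real"
  shows "(\<Sum>S\<in>Pow {..<Suc m}. F S) = (\<Sum>S\<in>Pow {..<m}. F S + F (insert m S))"
proof -
  have "inj_on (insert m) (Pow {..<m})"
    by (rule inj_onI) (metis Diff_insert_absorb PowD lessThan_iff less_irrefl subsetD)
  moreover have "Pow {..<m} \<inter> insert m ` Pow {..<m} = {}"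
    by auto
  ultimately show ?thesis
    by (simp add: lessThan_Suc Pow_insert sum.union_disjoint sum.reindex sum.distrib)
qed

lemma rademacher_Suc:
  assumes "S \<in> Pow {..<m}"
  shows "rademacher u (Suc m) S = rademacher u m S - u m"
    and "rademacher u (Suc m) (insert m S) = rademacher u m S + u m"
proof -
  have "m \<notin> S" using assms by auto
  then show "rademacher u (Suc m) S = rademacher u m S - u m"
    by (simp add: rademacher_def)
  show "rademacher u (Suc m) (insert m S) = rademacher u m S + u m"
    by (simp add: rademacher_def)
qed

text \<open>The set S records which of m independent signs are positive, so a sum over
  \<open>Pow {..<m}\<close> is \<open>2 ^ m\<close> times an expectation, and mixed terms vanish by
  orthogonality of the signs. This turns an inner product into an average of products of real
  numbers, which can be clipped.\<close>

lemma sum_rademacher_mult: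
  "(\<Sum>S\<in>Pow {..<m}. rademacher u m S * rademacher v m S) = 2 ^ m * (\<Sum>k<m. u k * v k)"
proof (induction m)
  case 0
  show ?case by (simp add: rademacher_def)
next
  case (Suc m)
  have "(\<Sum>S\<in>Pow {..<Suc m}. rademacher u (Suc m) S * rademacher v (Suc m) S) =
      (\<Sum>S\<in>Pow {..<m}. 2 * (rademacher u m S * rademacher v m S) + 2 * (u m * v m))"
    unfolding sum_Pow_lessThan_Suc
    by (intro sum.cong refl) (simp add: rademacher_Suc algebra_simps)
  also have "\<dots> = 2 ^ Suc m * (\<Sum>k<Suc m. u k * v k)"
    using Suc.IH by (simp add: sum.distrib sum_distrib_left[symmetric] card_Pow algebra_simps)
  finally show ?case .
qed

text \<open>Khinchine's inequality for the fourth moment. A further sign with coefficient c adds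
  \<open>6 * c\<^sup>2\<close> times the second moment and \<open>c ^ 4\<close>; relaxing the latter
  to \<open>3 * c ^ 4\<close> completes the square.\<close>

lemma sum_rademacher_power4:
  "(\<Sum>S\<in>Pow {..<m}. rademacher u m S ^ 4) \<le> 3 * 2 ^ m * (\<Sum>k<m. (u k)\<^sup>2)\<^sup>2"
proof (induction m)
  case 0
  show ?case by (simp add: rademacher_def)
next
  case (Suc m)
  let ?s = "\<Sum>k<m. (u k)\<^sup>2"
  have sq: "(\<Sum>S\<in>Pow {..<m}. (rademacher u m S)\<^sup>2) = 2 ^ m * ?s"
    using sum_rademacher_mult[of u m u] by (simp add: power2_eq_square)
  have "(\<Sum>S\<in>Pow {..<Suc m}. rademacher u (Suc m) S ^ 4) =
      (\<Sum>S\<in>Pow {..<m}. 2 * rademacher u m S ^ 4 + 12 * (u m)\<^sup>2 * (rademacher u m S)\<^sup>2 + 2 * u m ^ 4)"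
    unfolding sum_Pow_lessThan_Suc
    by (intro sum.cong refl) (simp add: rademacher_Suc, algebra)
  also have "\<dots> = 2 * (\<Sum>S\<in>Pow {..<m}. rademacher u m S ^ 4) + 12 * (u m)\<^sup>2 * (2 ^ m * ?s)
      + 2 ^ m * (2 * u m ^ 4)"
    by (simp add: sum.distrib sum_distrib_left[symmetric] card_Pow sq)
  also have "\<dots> \<le> 2 * (3 * 2 ^ m * ?s\<^sup>2) + 12 * (u m)\<^sup>2 * (2 ^ m * ?s) + 2 ^ m * (6 * u m ^ 4)"
    using Suc.IH by (intro add_mono mult_left_mono) auto
  also have "\<dots> = 3 * 2 ^ Suc m * (\<Sum>k<Suc m. (u k)\<^sup>2)\<^sup>2"
    by simp algebra
  finally show ?case .
qed

text \<open>Clipping at level M costs a factor \<open>M\<^sup>2\<close> on the bounded part and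
  leaves two remainders of norm at most \<open>sqrt 3 / (4 * M)\<close>, hence the final constant
  \<open>M\<^sup>2 / (1 - sqrt 3 / (2 * M))\<close>. The level chosen here minimises it.\<close>

definition clip :: "real \<Rightarrow> real" where
  "clip x = max (- (3 * sqrt 3 / 4)) (min (3 * sqrt 3 / 4) x)"

lemma abs_clip_le: "\<bar>clip x\<bar> \<le> 3 * sqrt 3 / 4"
  by (auto simp: clip_def max_def min_def abs_if)

lemma clip_square_le: "(clip x)\<^sup>2 \<le> x\<^sup>2"
proof -
  have "\<bar>clip x\<bar> \<le> \<bar>x\<bar>" by (auto simp: clip_def max_def min_def abs_if)
  then show ?thesis by (simp add: abs_le_square_iff)
qed

text \<open>Beyond the level M, the inequality
  \<open>4 * M * (\<bar>x\<bar> - M) \<le> x\<^sup>2\<close> is the square of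
  \<open>\<bar>x\<bar> - 2 * M\<close>; squaring gives the factor
  \<open>1 / (16 * M\<^sup>2) = 1 / 27\<close>. With fourth moment at most 3 the remainder has norm
  at most 1/3.\<close>

lemma clip_error_square_le: "(x - clip x)\<^sup>2 \<le> x ^ 4 / 27"
proof -
  let ?M = "3 * sqrt 3 / 4"
  have M: "?M > 0" "?M\<^sup>2 = 27 / 16" by (auto simp: power2_eq_square)
  have *: "4 * ?M * \<bar>x - clip x\<bar> \<le> x\<^sup>2"
  proof (cases "\<bar>x\<bar> \<le> ?M")
    case True
    then have "clip x = x" by (auto simp: clip_def)
    then show ?thesis by simp
  next
    case False
    with M(1) have "\<bar>x - clip x\<bar> = \<bar>x\<bar> - ?M" unfolding clip_def by linarith
    moreover have "0 \<le> (\<bar>x\<bar> - 2 * ?M)\<^sup>2" by simp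
    then have "4 * ?M * (\<bar>x\<bar> - ?M) \<le> x\<^sup>2"
      by (simp add: power2_eq_square algebra_simps abs_if split: if_splits)
    ultimately show ?thesis by simp
  qed
  have "(4 * ?M * \<bar>x - clip x\<bar>)\<^sup>2 \<le> (x\<^sup>2)\<^sup>2"
    using * M(1) by (intro power_mono) auto
  moreover have "(4 * ?M * \<bar>x - clip x\<bar>)\<^sup>2 = 16 * ?M\<^sup>2 * (x - clip x)\<^sup>2"
    using M(2) by (simp add: power_mult_distrib)
  ultimately show ?thesis unfolding M by simp
qed

text \<open>
  Expanding inner products as averages of products of random sign sums and clipping those sums
  leaves two inner products of norm at most 1/3 each, so that iteration yields the constant
  \<open>27/16 \<cdot> (1 + 2/3 + 4/9 + \<dots>) = 81/16\<close>.
\<close>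

lemma grothendieck_iterate:
  fixes R :: "'i \<Rightarrow> 'j \<Rightarrow> real" and m :: nat
  assumes fin: "finite I" "finite J"
    and bound: "\<And>f g. (\<And>i. \<bar>f i\<bar> \<le> 1) \<Longrightarrow> (\<And>j. \<bar>g j\<bar> \<le> 1) \<Longrightarrow>
      \<bar>\<Sum>i\<in>I. \<Sum>j\<in>J. R i j * f i * g j\<bar> \<le> N"
  shows "(\<And>i. (\<Sum>l<m. (u i l)\<^sup>2) \<le> 1) \<Longrightarrow> (\<And>j. (\<Sum>l<m. (v j l)\<^sup>2) \<le> 1) \<Longrightarrow>
    \<bar>\<Sum>i\<in>I. \<Sum>j\<in>J. R i j * (\<Sum>l<m. u i l * v j l)\<bar>
      \<le> 81 / 16 * N + (2 / 3) ^ k * (\<Sum>i\<in>I. \<Sum>j\<in>J. \<bar>R i j\<bar>)"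
proof (induction k arbitrary: m u v)
  case 0
  have N: "N \<ge> 0" using bound[of "\<lambda>_. 0" "\<lambda>_. 0"] by simp
  have "\<bar>\<Sum>l<m. u i l * v j l\<bar> \<le> 1" for i j
  proof -
    have "\<bar>u i l * v j l\<bar> \<le> ((u i l)\<^sup>2 + (v j l)\<^sup>2) / 2" for l
      using sum_squares_bound[of "\<bar>u i l\<bar>" "\<bar>v j l\<bar>"] by (simp add: abs_mult)
    then have "\<bar>\<Sum>l<m. u i l * v j l\<bar> \<le> (\<Sum>l<m. ((u i l)\<^sup>2 + (v j l)\<^sup>2) / 2)"
      by (intro order_trans[OF sum_abs] sum_mono)
    also have "\<dots> = ((\<Sum>l<m. (u i l)\<^sup>2) + (\<Sum>l<m. (v j l)\<^sup>2)) / 2"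
      by (simp add: sum.distrib sum_divide_distrib[symmetric])
    also have "\<dots> \<le> 1" using 0(1)[of i] 0(2)[of j] by simp
    finally show ?thesis .
  qed
  then have "\<bar>\<Sum>i\<in>I. \<Sum>j\<in>J. R i j * (\<Sum>l<m. u i l * v j l)\<bar> \<le> (\<Sum>i\<in>I. \<Sum>j\<in>J. \<bar>R i j\<bar>)"
    by (intro order_trans[OF sum_abs] sum_mono)
       (auto simp: abs_mult intro!: mult_left_le)
  then show ?case using N by simp
next
  case (Suc k)
  define B where "B = 81 / 16 * N + (2 / 3) ^ k * (\<Sum>i\<in>I. \<Sum>j\<in>J. \<bar>R i j\<bar>)"
  define \<Omega> where "\<Omega> = Pow {..<m}"
  have \<Omega>: "finite \<Omega>" "card \<Omega> = 2 ^ m" by (auto simp: \<Omega>_def card_Pow)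
  \<comment> \<open>Functions on the \<open>2 ^ m\<close> sign patterns are again vectors, of
    dimension \<open>2 ^ m\<close>; this is why the dimension varies in the induction. The scalar c
    is the norm allowed for F.\<close>
  have IH: "\<bar>\<Sum>i\<in>I. \<Sum>j\<in>J. R i j * (\<Sum>S\<in>\<Omega>. F i S * G j S)\<bar> \<le> 2 ^ m * c * B"
    if F: "\<And>i. (\<Sum>S\<in>\<Omega>. (F i S)\<^sup>2) \<le> 2 ^ m * c\<^sup>2" and G: "\<And>j. (\<Sum>S\<in>\<Omega>. (G j S)\<^sup>2) \<le> 2 ^ m"
      and c: "c > 0"
    for F :: "'i \<Rightarrow> nat set \<Rightarrow> real" and G :: "'j \<Rightarrow> nat set \<Rightarrow> real" and c
  proof -
    obtain e where e: "bij_betw e {..<card \<Omega>} \<Omega>"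
      using ex_bij_betw_nat_finite[OF \<Omega>(1)] by (auto simp: atLeast0LessThan)
    have re: "(\<Sum>l<2 ^ m. H (e l)) = (\<Sum>S\<in>\<Omega>. H S)" for H :: "nat set \<Rightarrow> real"
      using sum.reindex_bij_betw[OF e, of H] \<Omega>(2) by simp
    define q where "q = sqrt (2 ^ m)"
    have q: "q > 0" "q * q = 2 ^ m" by (auto simp: q_def)
    define u' where "u' = (\<lambda>i l. F i (e l) / (c * q))"
    define v' where "v' = (\<lambda>j l. G j (e l) / q)"
    have "(\<Sum>l<2 ^ m. (u' i l)\<^sup>2) \<le> 1" for i
    proof -
      have "(\<Sum>l<2 ^ m. (u' i l)\<^sup>2) = (\<Sum>l<2 ^ m. (F i (e l))\<^sup>2) / (c * q)\<^sup>2"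
        by (simp add: u'_def power_divide sum_divide_distrib)
      also have "\<dots> = (\<Sum>S\<in>\<Omega>. (F i S)\<^sup>2) / (2 ^ m * c\<^sup>2)"
        using re[of "\<lambda>S. (F i S)\<^sup>2"] q by (simp add: power2_eq_square mult.commute mult.left_commute)
      also have "\<dots> \<le> 1" using F[of i] c by (simp add: divide_le_eq)
      finally show ?thesis .
    qed
    moreover have "(\<Sum>l<2 ^ m. (v' j l)\<^sup>2) \<le> 1" for j
    proof -
      have "(\<Sum>l<2 ^ m. (v' j l)\<^sup>2) = (\<Sum>l<2 ^ m. (G j (e l))\<^sup>2) / q\<^sup>2"
        by (simp add: v'_def power_divide sum_divide_distrib)
      also have "\<dots> = (\<Sum>S\<in>\<Omega>. (G j S)\<^sup>2) / 2 ^ m"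
        using re[of "\<lambda>S. (G j S)\<^sup>2"] q by (simp add: power2_eq_square)
      also have "\<dots> \<le> 1" using G[of j] by (simp add: divide_le_eq)
      finally show ?thesis .
    qed
    ultimately have "\<bar>\<Sum>i\<in>I. \<Sum>j\<in>J. R i j * (\<Sum>l<2 ^ m. u' i l * v' j l)\<bar> \<le> B"
      unfolding B_def by (rule Suc.IH)
    moreover have "(\<Sum>l<2 ^ m. u' i l * v' j l) = (\<Sum>S\<in>\<Omega>. F i S * G j S) / (2 ^ m * c)" for i j
    proof -
      have "(\<Sum>l<2 ^ m. u' i l * v' j l) = (\<Sum>l<2 ^ m. F i (e l) * G j (e l)) / (c * (q * q))"
        by (simp add: u'_def v'_def sum_divide_distrib mult.assoc)
      then show ?thesis using re[of "\<lambda>S. F i S * G j S"] q by (simp add: mult.commute)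
    qed
    ultimately have "\<bar>\<Sum>i\<in>I. \<Sum>j\<in>J. R i j * (\<Sum>S\<in>\<Omega>. F i S * G j S)\<bar> / (2 ^ m * c) \<le> B"
      using c by (simp add: sum_divide_distrib[symmetric] abs_mult)
    then show ?thesis using c by (simp add: divide_le_eq mult.commute)
  qed
  define a where "a = (\<lambda>i. rademacher (u i) m)"
  define b where "b = (\<lambda>j. rademacher (v j) m)"
  have a2: "(\<Sum>S\<in>\<Omega>. (a i S)\<^sup>2) \<le> 2 ^ m" for i
    using sum_rademacher_mult[of "u i" m "u i"] Suc.prems(1)[of i]
    by (simp add: a_def \<Omega>_def power2_eq_square)
  have b2: "(\<Sum>S\<in>\<Omega>. (b j S)\<^sup>2) \<le> 2 ^ m" for j
    using sum_rademacher_mult[of "v j" m "v j"] Suc.prems(2)[of j]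
    by (simp add: b_def \<Omega>_def power2_eq_square)
  have err: "(\<Sum>S\<in>\<Omega>. (rademacher w m S - clip (rademacher w m S))\<^sup>2) \<le> 2 ^ m * (1 / 3)\<^sup>2"
    if "(\<Sum>l<m. (w l)\<^sup>2) \<le> 1" for w
  proof -
    have "(\<Sum>S\<in>\<Omega>. (rademacher w m S - clip (rademacher w m S))\<^sup>2) \<le> (\<Sum>S\<in>\<Omega>. rademacher w m S ^ 4 / 27)"
      by (intro sum_mono clip_error_square_le)
    also have "\<dots> \<le> 3 * 2 ^ m * (\<Sum>l<m. (w l)\<^sup>2)\<^sup>2 / 27"
      using sum_rademacher_power4[of w m] by (simp add: \<Omega>_def sum_divide_distrib[symmetric])
    also have "\<dots> \<le> 3 * 2 ^ m * 1 / 27"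
      using that by (intro divide_right_mono mult_left_mono power_le_one sum_nonneg) auto
    finally show ?thesis by (simp add: power2_eq_square)
  qed
  let ?c = "\<lambda>i S. clip (a i S)" and ?d = "\<lambda>j S. clip (b j S)"
  \<comment> \<open>For every single sign pattern both clipped sums, divided by the level, are
    bounded test functions.\<close>
  have t1: "\<bar>\<Sum>i\<in>I. \<Sum>j\<in>J. R i j * (\<Sum>S\<in>\<Omega>. ?c i S * ?d j S)\<bar> \<le> 2 ^ m * (27 / 16 * N)"
  proof -
    let ?M = "3 * sqrt 3 / 4"
    have M: "?M > 0" "?M * ?M = 27 / 16" by auto
    have S: "\<bar>\<Sum>i\<in>I. \<Sum>j\<in>J. R i j * ?c i S * ?d j S\<bar> \<le> 27 / 16 * N" for S
    proof -
      have "\<bar>\<Sum>i\<in>I. \<Sum>j\<in>J. R i j * (?c i S / ?M) * (?d j S / ?M)\<bar> \<le> N"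
        using abs_clip_le M(1) by (intro bound) (simp_all add: divide_le_eq abs_mult)
      also have "(\<Sum>i\<in>I. \<Sum>j\<in>J. R i j * (?c i S / ?M) * (?d j S / ?M)) =
          (\<Sum>i\<in>I. \<Sum>j\<in>J. R i j * ?c i S * ?d j S) / (?M * ?M)"
        unfolding sum_divide_distrib by (intro sum.cong refl) simp
      finally show ?thesis unfolding M(2) by simp
    qed
    have "\<bar>\<Sum>S\<in>\<Omega>. \<Sum>i\<in>I. \<Sum>j\<in>J. R i j * ?c i S * ?d j S\<bar> \<le> (\<Sum>S\<in>\<Omega>. 27 / 16 * N)"
      by (rule order_trans[OF sum_abs sum_mono[OF S]])
    moreover have "(\<Sum>i\<in>I. \<Sum>j\<in>J. R i j * (\<Sum>S\<in>\<Omega>. ?c i S * ?d j S)) =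
        (\<Sum>S\<in>\<Omega>. \<Sum>i\<in>I. \<Sum>j\<in>J. R i j * ?c i S * ?d j S)"
    proof -
      have "(\<Sum>i\<in>I. \<Sum>j\<in>J. R i j * (\<Sum>S\<in>\<Omega>. ?c i S * ?d j S)) =
          (\<Sum>i\<in>I. \<Sum>S\<in>\<Omega>. \<Sum>j\<in>J. R i j * ?c i S * ?d j S)"
        by (intro sum.cong refl) (subst sum.swap, simp add: sum_distrib_left mult.assoc)
      also have "\<dots> = (\<Sum>S\<in>\<Omega>. \<Sum>i\<in>I. \<Sum>j\<in>J. R i j * ?c i S * ?d j S)"
        by (rule sum.swap)
      finally show ?thesis .
    qed
    ultimately show ?thesis by (simp add: \<Omega>)
  qed
  have t2: "\<bar>\<Sum>i\<in>I. \<Sum>j\<in>J. R i j * (\<Sum>S\<in>\<Omega>. (a i S - ?c i S) * b j S)\<bar> \<le> 2 ^ m * (1 / 3) * B"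
    using err[OF Suc.prems(1)] b2 by (intro IH) (auto simp: a_def)
  \<comment> \<open>\<open>IH\<close> expects the small vector in the first argument, but here the
    second one is small, so a factor 3 is moved from one to the other.\<close>
  have t3: "\<bar>\<Sum>i\<in>I. \<Sum>j\<in>J. R i j * (\<Sum>S\<in>\<Omega>. ?c i S * (b j S - ?d j S))\<bar> \<le> 2 ^ m * (1 / 3) * B"
  proof -
    have "(\<Sum>S\<in>\<Omega>. (3 * (b j S - ?d j S))\<^sup>2) \<le> 2 ^ m" for j
    proof -
      have "(\<Sum>S\<in>\<Omega>. (3 * (b j S - ?d j S))\<^sup>2) = 9 * (\<Sum>S\<in>\<Omega>. (b j S - ?d j S)\<^sup>2)"
        unfolding power_mult_distrib sum_distrib_left by simp
      then show ?thesis using err[OF Suc.prems(2)[of j]] by (simp add: b_def power_divide)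
    qed
    moreover have "(\<Sum>S\<in>\<Omega>. (?c i S / 3)\<^sup>2) \<le> 2 ^ m * (1 / 3)\<^sup>2" for i
    proof -
      have "(\<Sum>S\<in>\<Omega>. (?c i S)\<^sup>2) \<le> (\<Sum>S\<in>\<Omega>. (a i S)\<^sup>2)" by (intro sum_mono clip_square_le)
      with a2[of i] show ?thesis
        by (simp add: power_divide sum_divide_distrib[symmetric])
    qed
    ultimately have "\<bar>\<Sum>i\<in>I. \<Sum>j\<in>J. R i j * (\<Sum>S\<in>\<Omega>. (?c i S / 3) * (3 * (b j S - ?d j S)))\<bar>
        \<le> 2 ^ m * (1 / 3) * B"
      by (intro IH) auto
    moreover have "(\<Sum>S\<in>\<Omega>. (?c i S / 3) * (3 * (b j S - ?d j S))) = (\<Sum>S\<in>\<Omega>. ?c i S * (b j S - ?d j S))"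
      for i j
      by (intro sum.cong refl) (simp add: algebra_simps)
    ultimately show ?thesis by simp
  qed
  have scale: "2 ^ m * (\<Sum>i\<in>I. \<Sum>j\<in>J. R i j * E i j) = (\<Sum>i\<in>I. \<Sum>j\<in>J. R i j * (2 ^ m * E i j))"
    for E :: "'i \<Rightarrow> 'j \<Rightarrow> real"
    by (simp add: sum_distrib_left mult.left_commute)
  have "2 ^ m * (\<Sum>l<m. u i l * v j l) = (\<Sum>S\<in>\<Omega>. ?c i S * ?d j S) +
      (\<Sum>S\<in>\<Omega>. (a i S - ?c i S) * b j S) + (\<Sum>S\<in>\<Omega>. ?c i S * (b j S - ?d j S))" for i j
    unfolding sum_rademacher_mult[symmetric] \<Omega>_def[symmetric] sum.distrib[symmetric]
    by (intro sum.cong refl) (simp add: a_def b_def algebra_simps)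
  then have "2 ^ m * (\<Sum>i\<in>I. \<Sum>j\<in>J. R i j * (\<Sum>l<m. u i l * v j l)) =
      (\<Sum>i\<in>I. \<Sum>j\<in>J. R i j * ((\<Sum>S\<in>\<Omega>. ?c i S * ?d j S) +
        (\<Sum>S\<in>\<Omega>. (a i S - ?c i S) * b j S) + (\<Sum>S\<in>\<Omega>. ?c i S * (b j S - ?d j S))))"
    by (simp only: scale)
  also have "\<dots> = (\<Sum>i\<in>I. \<Sum>j\<in>J. R i j * (\<Sum>S\<in>\<Omega>. ?c i S * ?d j S)) +
      (\<Sum>i\<in>I. \<Sum>j\<in>J. R i j * (\<Sum>S\<in>\<Omega>. (a i S - ?c i S) * b j S)) +
      (\<Sum>i\<in>I. \<Sum>j\<in>J. R i j * (\<Sum>S\<in>\<Omega>. ?c i S * (b j S - ?d j S)))"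
    by (simp only: distrib_left sum.distrib)
  finally have "\<bar>2 ^ m * (\<Sum>i\<in>I. \<Sum>j\<in>J. R i j * (\<Sum>l<m. u i l * v j l))\<bar>
      \<le> 2 ^ m * (27 / 16 * N) + 2 ^ m * (1 / 3) * B + 2 ^ m * (1 / 3) * B"
    using t1 t2 t3 by linarith
  then have "2 ^ m * \<bar>\<Sum>i\<in>I. \<Sum>j\<in>J. R i j * (\<Sum>l<m. u i l * v j l)\<bar>
      \<le> 2 ^ m * (27 / 16 * N + 2 / 3 * B)"
    by (simp add: abs_mult algebra_simps)
  then have "\<bar>\<Sum>i\<in>I. \<Sum>j\<in>J. R i j * (\<Sum>l<m. u i l * v j l)\<bar> \<le> 27 / 16 * N + 2 / 3 * B"
    by simp
  then show ?case by (simp add: B_def algebra_simps)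
qed

text \<open>The trivial term of the iterated bound decays geometrically and disappears in the limit.
  The vectors are scaled to norm at most 1 and extended by 0 outside I and J, since the iteration
  asks for a norm bound at every index.\<close>

theorem grothendieck_inequality:
  fixes R :: "'i \<Rightarrow> 'j \<Rightarrow> real"
  assumes fin: "finite I" "finite J" "finite L"
    and bound: "\<And>f g. (\<And>i. \<bar>f i\<bar> \<le> 1) \<Longrightarrow> (\<And>j. \<bar>g j\<bar> \<le> 1) \<Longrightarrow>
      \<bar>\<Sum>i\<in>I. \<Sum>j\<in>J. R i j * f i * g j\<bar> \<le> N"
    and a: "\<And>i. i \<in> I \<Longrightarrow> (\<Sum>l\<in>L. (u i l)\<^sup>2) \<le> a\<^sup>2" "a > 0"
    and b: "\<And>j. j \<in> J \<Longrightarrow> (\<Sum>l\<in>L. (v j l)\<^sup>2) \<le> b\<^sup>2" "b > 0"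
  shows "\<bar>\<Sum>i\<in>I. \<Sum>j\<in>J. R i j * (\<Sum>l\<in>L. u i l * v j l)\<bar> \<le> 81 / 16 * N * a * b"
proof -
  obtain e where e: "bij_betw e {..<card L} L"
    using ex_bij_betw_nat_finite[OF fin(3)] by (auto simp: atLeast0LessThan)
  have re: "(\<Sum>l<card L. H (e l)) = (\<Sum>l\<in>L. H l)" for H :: "_ \<Rightarrow> real"
    using sum.reindex_bij_betw[OF e, of H] by simp
  define u' where "u' = (\<lambda>i l. if i \<in> I then u i (e l) / a else 0)"
  define v' where "v' = (\<lambda>j l. if j \<in> J then v j (e l) / b else 0)"
  have u': "(\<Sum>l<card L. (u' i l)\<^sup>2) \<le> 1" for i
    using a(1)[of i] a(2) re[of "\<lambda>l. (u i l)\<^sup>2"]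
    by (cases "i \<in> I") (simp_all add: u'_def power_divide sum_divide_distrib[symmetric])
  have v': "(\<Sum>l<card L. (v' j l)\<^sup>2) \<le> 1" for j
    using b(1)[of j] b(2) re[of "\<lambda>l. (v j l)\<^sup>2"]
    by (cases "j \<in> J") (simp_all add: v'_def power_divide sum_divide_distrib[symmetric])
  let ?S = "\<Sum>i\<in>I. \<Sum>j\<in>J. R i j * (\<Sum>l<card L. u' i l * v' j l)"
  have "(\<lambda>k. 81 / 16 * N + (2 / 3) ^ k * (\<Sum>i\<in>I. \<Sum>j\<in>J. \<bar>R i j\<bar>))
      \<longlonglongrightarrow> 81 / 16 * N + 0 * (\<Sum>i\<in>I. \<Sum>j\<in>J. \<bar>R i j\<bar>)"
    by (intro tendsto_intros LIMSEQ_realpow_zero) auto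
  then have "\<bar>?S\<bar> \<le> 81 / 16 * N"
    using grothendieck_iterate[OF fin(1,2) bound u' v']
    by (intro LIMSEQ_le_const[of _ "81 / 16 * N"]) auto
  moreover have "?S = (\<Sum>i\<in>I. \<Sum>j\<in>J. R i j * (\<Sum>l\<in>L. u i l * v j l)) / (a * b)"
    unfolding sum_divide_distrib
    by (intro sum.cong refl)
       (simp add: u'_def v'_def re[of "\<lambda>l. u _ l * v _ l"] sum_divide_distrib[symmetric])
  ultimately show ?thesis using a b by (simp add: abs_mult divide_le_eq mult.assoc)
qed

section \<open>Fractional triangle covers of quasirandom matrices\<close>

text \<open>
  The number of points lost per point that a family of weighted triples covers \<open>t\<close> times: a deficit is
  lost as it is, while removing an excess \<open>t - 1\<close> by shrinking triples also uncovers two further points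
  of each triple.
\<close>

definition cover_cost :: "real \<Rightarrow> real" where
  "cover_cost t = max (1 - t) (2 * (t - 1))"

lemma cover_cost_le: "0 \<le> l \<Longrightarrow> cover_cost (1 - l + e) \<le> l + 2 * \<bar>e\<bar>"
  by (auto simp: cover_cost_def abs_if)

text \<open>For a fixed right factor the best left factor is the sign of the row sum, so the
  absolute row sums add up to a value of the form itself.\<close>

lemma sum_abs_row_le:
  fixes R :: "'a \<Rightarrow> 'a \<Rightarrow> real"
  assumes bound: "\<And>f g. (\<And>u. \<bar>f u\<bar> \<le> 1) \<Longrightarrow> (\<And>v. \<bar>g v\<bar> \<le> 1) \<Longrightarrow>
      \<bar>\<Sum>u\<in>V. \<Sum>v\<in>V. R u v * f u * g v\<bar> \<le> K"
    and g: "\<And>v. v \<in> V \<Longrightarrow> \<bar>g v\<bar> \<le> c" and c: "c > 0"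
  shows "(\<Sum>u\<in>V. \<bar>\<Sum>v\<in>V. R u v * g v\<bar>) \<le> c * K"
proof -
  define g' where "g' v = (if v \<in> V then g v / c else 0)" for v
  define f where "f u = sgn (\<Sum>v\<in>V. R u v * g' v)" for u
  have g': "\<bar>g' v\<bar> \<le> 1" for v using g[of v] c by (auto simp: g'_def)
  have "(\<Sum>u\<in>V. \<bar>\<Sum>v\<in>V. R u v * g v\<bar>) = c * (\<Sum>u\<in>V. \<bar>\<Sum>v\<in>V. R u v * g' v\<bar>)"
  proof -
    have "(\<Sum>v\<in>V. R u v * g v) = c * (\<Sum>v\<in>V. R u v * g' v)" for u
      using c by (simp add: g'_def sum_distrib_left)
    then have "\<bar>\<Sum>v\<in>V. R u v * g v\<bar> = c * \<bar>\<Sum>v\<in>V. R u v * g' v\<bar>" for u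
      using c by (simp add: abs_mult)
    then show ?thesis by (simp only: sum_distrib_left)
  qed
  also have "(\<Sum>u\<in>V. \<bar>\<Sum>v\<in>V. R u v * g' v\<bar>) = (\<Sum>u\<in>V. \<Sum>v\<in>V. R u v * f u * g' v)"
  proof (rule sum.cong[OF refl])
    fix u
    have "\<bar>\<Sum>v\<in>V. R u v * g' v\<bar> = f u * (\<Sum>v\<in>V. R u v * g' v)"
      unfolding f_def by (simp add: abs_sgn mult.commute)
    then show "\<bar>\<Sum>v\<in>V. R u v * g' v\<bar> = (\<Sum>v\<in>V. R u v * f u * g' v)"
      by (simp add: sum_distrib_left mult_ac)
  qed
  also have "\<dots> \<le> K"
    using bound[of f g'] g' by (simp add: f_def abs_sgn_eq)
  finally show ?thesis using c by simp
qed

section \<open>Degree and codegree deviations of a quasirandom matrix\<close>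

text \<open>The parameter k is the square root of the cut norm density, because its cube will occur.
  It becomes \<open>3 * sqrt \<epsilon>\<close>, and its upper bound is the square root of the
  assumption on \<epsilon>. The degree condition holds after the exceptional vertices have been
  removed.\<close>

locale quasirandom_matrix =
  fixes V :: "'a set" and A :: "'a \<Rightarrow> 'a \<Rightarrow> real" and p k :: real
  assumes finV: "finite V" "V \<noteq> {}"
    and A01: "A u v = 0 \<or> A u v = 1"
    and A_sym: "A u v = A v u"
    and p: "0 < p" "p \<le> 1"
    and k: "0 < k" "k \<le> 3 * p ^ 6 / 4096"
    and bound: "(\<And>u. \<bar>f u\<bar> \<le> 1) \<Longrightarrow> (\<And>v. \<bar>g v\<bar> \<le> 1) \<Longrightarrow>
      \<bar>\<Sum>u\<in>V. \<Sum>v\<in>V. (A u v - p) * f u * g v\<bar> \<le> k\<^sup>2 * (real (card V))\<^sup>2"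
    and degree: "u \<in> V \<Longrightarrow> \<bar>\<Sum>v\<in>V. A u v - p\<bar> \<le> p ^ 3 / 150 * p * real (card V)"
begin

definition "N = real (card V)"
definition "R u v = A u v - p"
definition "D = p\<^sup>2 * N"
definition "\<rho>0 = p ^ 3 / 150"
text \<open>Relative to its expected value D, the codegree of u and v is
  \<open>1 + \<rho> u + \<rho> v + \<mu> u v\<close>: two degree deviations, and an entry of the
  squared matrix for what the degrees do not explain.\<close>

definition "\<rho> u = (\<Sum>v\<in>V. R u v) / (p * N)"
definition "P u v = (\<Sum>z\<in>V. R u z * R z v)"
definition "\<mu> u v = P u v / D"

lemma N: "N > 0" using finV by (simp add: N_def card_gt_0_iff)
lemma D: "D > 0" using N p by (simp add: D_def)
lemma \<rho>0: "0 < \<rho>0" "\<rho>0 \<le> 1 / 150"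
  using p power_le_one[of p 3] by (auto simp: \<rho>0_def)
lemma R_sym: "R u v = R v u" by (simp add: R_def A_sym[of u v])
lemma P_sym: "P u v = P v u" unfolding P_def by (simp add: R_sym mult.commute)
lemma \<mu>_sym: "\<mu> u v = \<mu> v u" by (simp add: \<mu>_def P_sym)
lemma A_ge: "0 \<le> A u v" "A u v \<le> 1" using A01[of u v] by auto
lemma R_le: "\<bar>R u v\<bar> \<le> 1" using A01[of u v] p by (auto simp: R_def)
lemma k2: "k\<^sup>2 \<le> 9 * p ^ 12 / 16777216"
proof -
  have "k\<^sup>2 \<le> (3 * p ^ 6 / 4096)\<^sup>2" using k by (intro power_mono) auto
  then show ?thesis by (simp add: power_divide power_mult_distrib power_mult[symmetric])
qed

lemma cut_bound:
  assumes "\<And>u. \<bar>f u\<bar> \<le> 1" "\<And>v. \<bar>g v\<bar> \<le> 1"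
  shows "\<bar>\<Sum>u\<in>V. \<Sum>v\<in>V. R u v * f u * g v\<bar> \<le> k\<^sup>2 * N\<^sup>2"
  using bound[OF assms] by (simp add: R_def N_def)

lemma row_bound:
  assumes "\<And>v. v \<in> V \<Longrightarrow> \<bar>g v\<bar> \<le> c" "c > 0"
  shows "(\<Sum>u\<in>V. \<bar>\<Sum>v\<in>V. R u v * g v\<bar>) \<le> c * (k\<^sup>2 * N\<^sup>2)"
  using cut_bound assms by (rule sum_abs_row_le)

lemma \<rho>_le: "u \<in> V \<Longrightarrow> \<bar>\<rho> u\<bar> \<le> \<rho>0"
  using degree[of u] p N by (simp add: \<rho>_def R_def \<rho>0_def N_def field_simps abs_mult)

lemma sum_\<rho>_le: "(\<Sum>u\<in>V. \<bar>\<rho> u\<bar>) \<le> k\<^sup>2 * N / p"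
proof -
  have "(\<Sum>u\<in>V. \<bar>\<rho> u\<bar>) = (\<Sum>u\<in>V. \<bar>\<Sum>v\<in>V. R u v * 1\<bar>) / (p * N)"
  proof -
    have "\<bar>\<rho> u\<bar> = \<bar>\<Sum>v\<in>V. R u v * 1\<bar> / (p * N)" for u using p N by (simp add: \<rho>_def abs_mult)
    then show ?thesis by (simp only: sum_divide_distrib)
  qed
  also have "\<dots> \<le> (1 * (k\<^sup>2 * N\<^sup>2)) / (p * N)"
    using p N by (intro divide_right_mono row_bound) auto
  also have "\<dots> = k\<^sup>2 * N / p" using N p by (simp add: power2_eq_square)
  finally show ?thesis .
qed

text \<open>Row u of the square is R applied to the bounded function \<open>R u\<close>.\<close>

lemma sum_row_P_le: "(\<Sum>v\<in>V. \<bar>P u v\<bar>) \<le> k\<^sup>2 * N\<^sup>2"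
proof -
  have "P u v = (\<Sum>z\<in>V. R v z * R u z)" for v
    by (simp add: P_def R_sym[of v] mult.commute)
  then show ?thesis using row_bound[of "R u" 1] R_le by simp
qed

lemma sum_row_\<mu>_le: "(\<Sum>v\<in>V. \<bar>\<mu> u v\<bar>) \<le> k\<^sup>2 * N / p\<^sup>2"
proof -
  have "(\<Sum>v\<in>V. \<bar>\<mu> u v\<bar>) = (\<Sum>v\<in>V. \<bar>P u v\<bar>) / D"
    using D by (simp add: \<mu>_def sum_divide_distrib)
  also have "\<dots> \<le> k\<^sup>2 * N\<^sup>2 / D" using D sum_row_P_le by (intro divide_right_mono) auto
  also have "\<dots> = k\<^sup>2 * N / p\<^sup>2" using N p by (simp add: D_def power2_eq_square)
  finally show ?thesis .
qed

definition "\<sigma> = 1 - p + \<rho>0"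

lemma \<sigma>: "0 < \<sigma>" using p \<rho>0 by (simp add: \<sigma>_def)

text \<open>Entries of A equal their squares, so \<open>(R u v)\<^sup>2\<close> is linear in
  \<open>R u v\<close> and its row sum is governed by the degree: the variance
  \<open>p * (1 - p)\<close> plus the degree error, which \<sigma> collects.\<close>

lemma sum_row_R2: assumes "u \<in> V" shows "(\<Sum>v\<in>V. (R u v)\<^sup>2) \<le> p * \<sigma> * N"
proof -
  have "(R u v)\<^sup>2 = (1 - 2 * p) * R u v + p * (1 - p)" for v
    using A01[of u v] by (auto simp: R_def power2_eq_square algebra_simps)
  then have "(\<Sum>v\<in>V. (R u v)\<^sup>2) = (1 - 2 * p) * (\<Sum>v\<in>V. R u v) + N * (p * (1 - p))"
    by (simp add: sum.distrib sum_distrib_left N_def)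
  also have "\<dots> \<le> \<rho>0 * p * N + N * (p * (1 - p))"
  proof -
    have "(1 - 2 * p) * (\<Sum>v\<in>V. R u v) \<le> \<bar>1 - 2 * p\<bar> * \<bar>\<Sum>v\<in>V. R u v\<bar>"
      by (simp add: abs_mult[symmetric])
    also have "\<dots> \<le> 1 * (\<rho>0 * p * N)"
      using degree[OF assms] p \<rho>0 N by (intro mult_mono) (auto simp: R_def \<rho>0_def N_def)
    finally show ?thesis by simp
  qed
  finally show ?thesis by (simp add: \<sigma>_def algebra_simps)
qed

lemma P_le: assumes "u \<in> V" "v \<in> V" shows "\<bar>P u v\<bar> \<le> p * \<sigma> * N"
proof -
  have "\<bar>R u z * R z v\<bar> \<le> ((R u z)\<^sup>2 + (R v z)\<^sup>2) / 2" for z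
    using sum_squares_bound[of "\<bar>R u z\<bar>" "\<bar>R v z\<bar>"] by (simp add: abs_mult R_sym[of z v])
  then have "\<bar>P u v\<bar> \<le> (\<Sum>z\<in>V. ((R u z)\<^sup>2 + (R v z)\<^sup>2) / 2)"
    unfolding P_def by (rule order_trans[OF sum_abs sum_mono])
  also have "\<dots> = ((\<Sum>z\<in>V. (R u z)\<^sup>2) + (\<Sum>z\<in>V. (R v z)\<^sup>2)) / 2"
    by (simp add: sum.distrib sum_divide_distrib[symmetric])
  also have "\<dots> \<le> p * \<sigma> * N" using sum_row_R2[OF assms(1)] sum_row_R2[OF assms(2)] by simp
  finally show ?thesis .
qed

text \<open>Expanding one of the two factors P presents the square sum as the form R evaluated at
  inner products of rows of P with rows of R. Grothendieck's inequality contributes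
  \<open>k\<^sup>2\<close> from the cut norm. A third factor k comes from the norm of the rows of P,
  whose square sum is at most the largest entry times the absolute row sum.\<close>

lemma sum_P2_le: "(\<Sum>u\<in>V. \<Sum>v\<in>V. (P u v)\<^sup>2) \<le> 81 / 16 * k ^ 3 * p * \<sigma> * N ^ 4"
proof -
  let ?a = "sqrt (p * \<sigma> * N) * (k * N)" and ?b = "sqrt (p * \<sigma> * N)"
  have pos: "0 < p * \<sigma> * N" using p \<sigma> N by simp
  have "(\<Sum>u\<in>V. \<Sum>v\<in>V. (P u v)\<^sup>2) = (\<Sum>u\<in>V. \<Sum>z\<in>V. R u z * (\<Sum>v\<in>V. P u v * R z v))"
  proof (rule sum.cong[OF refl])
    fix u
    have "(\<Sum>v\<in>V. (P u v)\<^sup>2) = (\<Sum>v\<in>V. \<Sum>z\<in>V. R u z * (P u v * R z v))"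
      by (intro sum.cong refl) (simp add: power2_eq_square P_def[of u] sum_distrib_left mult_ac)
    also have "\<dots> = (\<Sum>z\<in>V. R u z * (\<Sum>v\<in>V. P u v * R z v))"
      by (subst sum.swap) (simp add: sum_distrib_left)
    finally show "(\<Sum>v\<in>V. (P u v)\<^sup>2) = (\<Sum>z\<in>V. R u z * (\<Sum>v\<in>V. P u v * R z v))" .
  qed
  also have "\<dots> \<le> \<bar>\<Sum>u\<in>V. \<Sum>z\<in>V. R u z * (\<Sum>v\<in>V. P u v * R z v)\<bar>" by simp
  also have "\<dots> \<le> 81 / 16 * (k\<^sup>2 * N\<^sup>2) * ?a * ?b"
  proof (rule grothendieck_inequality[OF finV(1) finV(1) finV(1) cut_bound])
    fix u assume u: "u \<in> V"
    have "(\<Sum>v\<in>V. (P u v)\<^sup>2) \<le> (\<Sum>v\<in>V. (p * \<sigma> * N) * \<bar>P u v\<bar>)"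
    proof (rule sum_mono)
      fix v assume "v \<in> V"
      then have "\<bar>P u v\<bar> * \<bar>P u v\<bar> \<le> (p * \<sigma> * N) * \<bar>P u v\<bar>"
        using u P_le by (intro mult_right_mono) auto
      then show "(P u v)\<^sup>2 \<le> (p * \<sigma> * N) * \<bar>P u v\<bar>" by (simp add: power2_eq_square)
    qed
    also have "\<dots> \<le> (p * \<sigma> * N) * (k\<^sup>2 * N\<^sup>2)"
      unfolding sum_distrib_left[symmetric] using pos sum_row_P_le by (intro mult_left_mono) auto
    also have "\<dots> = ?a\<^sup>2" using pos by (simp add: power_mult_distrib)
    finally show "(\<Sum>v\<in>V. (P u v)\<^sup>2) \<le> ?a\<^sup>2" .
  next
    fix z assume "z \<in> V"
    then show "(\<Sum>v\<in>V. (R z v)\<^sup>2) \<le> ?b\<^sup>2" using sum_row_R2[of z] pos by simp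
  qed (use pos k N in auto)
  also have "\<dots> = 81 / 16 * k ^ 3 * p * \<sigma> * N ^ 4"
  proof -
    have "?a * ?b = (p * \<sigma> * N) * (k * N)" using pos by simp
    then have "81 / 16 * (k\<^sup>2 * N\<^sup>2) * ?a * ?b = 81 / 16 * (k\<^sup>2 * N\<^sup>2) * ((p * \<sigma> * N) * (k * N))"
      by (simp only: mult.assoc)
    also have "\<dots> = 81 / 16 * k ^ 3 * p * \<sigma> * N ^ 4" by (simp add: eval_nat_numeral mult_ac)
    finally show ?thesis .
  qed
  finally show ?thesis .
qed

text \<open>The square sum of \<mu> per pair, after one of the three factors k is replaced by its
  upper bound: \<open>81 / 16 * 3 / 4096 = 243 / 65536\<close> is rounded up to
  \<open>1 / 268\<close>. The surviving \<open>p ^ 3\<close> keeps the cost below a small multiple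
  of \<open>p * k\<^sup>2\<close>.\<close>

definition "E2 = k\<^sup>2 * \<sigma> * p ^ 3 / 268"

lemma sum_\<mu>2_le: "(\<Sum>u\<in>V. \<Sum>v\<in>V. (\<mu> u v)\<^sup>2) \<le> E2 * N\<^sup>2"
proof -
  have "(\<Sum>u\<in>V. \<Sum>v\<in>V. (\<mu> u v)\<^sup>2) = (\<Sum>u\<in>V. \<Sum>v\<in>V. (P u v)\<^sup>2) / D\<^sup>2"
    by (simp add: \<mu>_def power_divide sum_divide_distrib)
  also have "\<dots> \<le> 81 / 16 * k ^ 3 * p * \<sigma> * N ^ 4 / D\<^sup>2"
    using sum_P2_le D by (intro divide_right_mono) auto
  also have "\<dots> = 81 / 16 * k\<^sup>2 * \<sigma> * N\<^sup>2 * (k / p ^ 3)"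
    using N p by (simp add: D_def field_simps eval_nat_numeral)
  also have "\<dots> \<le> 81 / 16 * k\<^sup>2 * \<sigma> * N\<^sup>2 * (3 * p ^ 3 / 4096)"
  proof (intro mult_left_mono)
    show "k / p ^ 3 \<le> 3 * p ^ 3 / 4096"
      using k p by (simp add: field_simps power_add[symmetric])
  qed (use \<sigma> in auto)
  also have "\<dots> = k\<^sup>2 * \<sigma> * p ^ 3 * N\<^sup>2 * (243 / 65536)" by simp
  also have "\<dots> \<le> k\<^sup>2 * \<sigma> * p ^ 3 * N\<^sup>2 * (1 / 268)"
    using \<sigma> p by (intro mult_left_mono) auto
  finally show ?thesis by (simp add: E2_def)
qed

lemma codegree:
  assumes "u \<in> V" "v \<in> V"
  shows "(\<Sum>w\<in>V. A u w * A v w) = D * (1 + \<rho> u + \<rho> v + \<mu> u v)"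
proof -
  have "(\<Sum>w\<in>V. A u w * A v w) = (\<Sum>w\<in>V. p\<^sup>2 + p * R u w + p * R v w + R u w * R w v)"
    by (intro sum.cong refl) (simp add: R_sym[of _ v], simp add: R_def algebra_simps power2_eq_square)
  also have "\<dots> = p\<^sup>2 * N + p * (\<Sum>w\<in>V. R u w) + p * (\<Sum>w\<in>V. R v w) + P u v"
    by (simp add: sum.distrib sum_distrib_left P_def N_def)
  also have "\<dots> = D * (1 + \<rho> u + \<rho> v + \<mu> u v)"
    using p N by (simp add: D_def \<rho>_def \<mu>_def field_simps power2_eq_square)
  finally show ?thesis .
qed

lemma deg_eq: "(\<Sum>v\<in>V. A u v) = p * N * (1 + \<rho> u)"
  using p N by (simp add: \<rho>_def R_def sum_subtractf N_def field_simps)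

lemma deg_le: "u \<in> V \<Longrightarrow> (\<Sum>v\<in>V. A u v) \<le> 151 / 150 * (p * N)"
  using \<rho>_le[of u] \<rho>0 p N unfolding deg_eq by (subst mult.commute, intro mult_right_mono) auto

end

section \<open>Triangle weights with a first-order correction\<close>

locale triangle_weights = quasirandom_matrix V A p k
  for V :: "'a set" and A :: "'a \<Rightarrow> 'a \<Rightarrow> real" and p k :: real +
  fixes U :: "'a \<Rightarrow> 'a \<Rightarrow> real"
  assumes U_sym: "U u v = U v u"
    and U: "0 \<le> U u v" "U u v \<le> p ^ 5 / 750"
begin

text \<open>
  The weight \<open>U u v\<close> is already used up on the pair \<open>u v\<close>. To first order, the triangle weights
  \<open>(1 + \<alpha> u v + \<alpha> v w + \<alpha> u w) / D\<close> fill the remaining \<open>1 - U u v\<close> iff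
  \<open>\<alpha> u v + a u + a v = h u v\<close>, where \<open>a u\<close> is the average of \<open>\<alpha> u\<close> over the neighbours of \<open>u\<close>;
  averaging this equation once and twice gives the formula for \<open>a\<close>. The pairs in \<open>B\<close> are given up.
\<close>

definition "B u v = (if \<bar>\<mu> u v\<bar> > 1 / 4 then A u v else 0)"
definition "G u v = A u v - B u v"
definition "h u v = - (U u v + \<rho> u + \<rho> v + \<mu> u v)"
definition "hb u = (\<Sum>v\<in>V. G u v * h u v) / (p * N)"
definition "Hm = (\<Sum>u\<in>V. hb u) / N"
definition "a u = hb u / 2 - Hm / 6"
definition "\<alpha> u v = G u v * (h u v - a u - a v)"
definition "X u v w = G u v * G v w * G u w * (1 + \<alpha> u v + \<alpha> v w + \<alpha> u w) / D"
text \<open>While \<open>a u\<close> is what the average of \<alpha> over the neighbours of u should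
  be, \<open>ah u\<close> is what it is; their difference is an error of second order.\<close>

definition "ah u = (\<Sum>w\<in>V. \<alpha> u w) / (p * N)"
text \<open>The part of the sum of \<open>\<alpha> u\<close> over the neighbours of v that the
  density p does not predict.\<close>

definition "Q u v = (\<Sum>w\<in>V. R v w * \<alpha> u w)"

lemma B_sym: "B u v = B v u" using A_sym[of u v] \<mu>_sym[of u v] by (simp add: B_def)
lemma G_sym: "G u v = G v u" using A_sym[of u v] B_sym[of u v] by (simp add: G_def)
lemma h_sym: "h u v = h v u" using U_sym[of u v] \<mu>_sym[of u v] by (simp add: h_def)
lemma \<alpha>_sym: "\<alpha> u v = \<alpha> v u" using G_sym[of u v] h_sym[of u v] by (simp add: \<alpha>_def)

lemma G_cases: "(G u v = 0 \<and> (A u v = 0 \<or> B u v = 1 \<and> A u v = 1)) \<or> (G u v = 1 \<and> A u v = 1 \<and> B u v = 0 \<and> \<bar>\<mu> u v\<bar> \<le> 1 / 4)"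
  using A01[of u v] by (auto simp: G_def B_def)

lemma G_ge: "0 \<le> G u v" "G u v \<le> A u v" "G u v \<le> 1"
  using G_cases[of u v] A_ge[of u v] by auto

lemma B_ge: "0 \<le> B u v" "B u v \<le> A u v" "B u v \<le> 1"
  using A_ge[of u v] by (auto simp: B_def)

text \<open>Markov's argument: where \<mu> exceeds 1/4 in absolute value,
  \<open>16 * (\<mu> u v)\<^sup>2\<close> exceeds 1. The pairs given up are thereby charged to the
  square sum of \<mu>.\<close>

lemma B_le: "B u v \<le> 16 * (\<mu> u v)\<^sup>2" "B u v * \<bar>\<mu> u v\<bar> \<le> 4 * (\<mu> u v)\<^sup>2"
proof -
  show "B u v \<le> 16 * (\<mu> u v)\<^sup>2"
  proof (cases "\<bar>\<mu> u v\<bar> > 1 / 4")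
    case True
    then have "(1 / 4)\<^sup>2 \<le> \<bar>\<mu> u v\<bar>\<^sup>2" by (intro power_mono) auto
    then have "1 \<le> 16 * (\<mu> u v)\<^sup>2" by (simp add: power2_eq_square)
    then show ?thesis using B_ge(3)[of u v] by linarith
  qed (simp add: B_def)
  show "B u v * \<bar>\<mu> u v\<bar> \<le> 4 * (\<mu> u v)\<^sup>2"
  proof (cases "\<bar>\<mu> u v\<bar> > 1 / 4")
    case True
    have "B u v * \<bar>\<mu> u v\<bar> \<le> 1 * \<bar>\<mu> u v\<bar>" using B_ge by (intro mult_right_mono) auto
    also have "\<dots> \<le> (4 * \<bar>\<mu> u v\<bar>) * \<bar>\<mu> u v\<bar>" using True by (intro mult_right_mono) auto
    finally show ?thesis by (simp add: power2_eq_square)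
  qed (simp add: B_def)
qed

lemma U_le: "U u v \<le> \<rho>0 / 5"
proof -
  have "p ^ 5 \<le> p ^ 3" using p by (intro power_decreasing) auto
  then show ?thesis using U(2)[of u v] by (simp add: \<rho>0_def)
qed

text \<open>On a single pair of G the deviation \<mu> may be as large as 1/4. Averaged over a row it
  contributes only \<open>k\<^sup>2 / p ^ 3\<close>, less than a thousandth of
  \<open>\<rho>0\<close>, so averages of h have the size of the degree deviations.\<close>

lemma hb_le: assumes "u \<in> V" shows "\<bar>hb u\<bar> \<le> 9 / 4 * \<rho>0"
proof -
  have "\<bar>\<Sum>v\<in>V. G u v * h u v\<bar> \<le> (\<Sum>v\<in>V. A u v * (11 / 5 * \<rho>0) + \<bar>\<mu> u v\<bar>)"
  proof (rule order_trans[OF sum_abs sum_mono])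
    fix v assume v: "v \<in> V"
    have "\<bar>h u v\<bar> \<le> 11 / 5 * \<rho>0 + \<bar>\<mu> u v\<bar>"
      unfolding h_def using U(1)[of u v] U_le[of u v] \<rho>_le[OF v] \<rho>_le[OF assms] by linarith
    then have "\<bar>G u v * h u v\<bar> \<le> G u v * (11 / 5 * \<rho>0 + \<bar>\<mu> u v\<bar>)"
      using G_ge(1)[of u v] by (simp add: abs_mult mult_left_mono)
    also have "\<dots> = G u v * (11 / 5 * \<rho>0) + G u v * \<bar>\<mu> u v\<bar>" by (simp add: distrib_left)
    also have "\<dots> \<le> A u v * (11 / 5 * \<rho>0) + 1 * \<bar>\<mu> u v\<bar>"
      using G_ge[of u v] \<rho>0 by (intro add_mono mult_right_mono) auto
    finally show "\<bar>G u v * h u v\<bar> \<le> A u v * (11 / 5 * \<rho>0) + \<bar>\<mu> u v\<bar>" by simp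
  qed
  also have "\<dots> = (\<Sum>v\<in>V. A u v) * (11 / 5 * \<rho>0) + (\<Sum>v\<in>V. \<bar>\<mu> u v\<bar>)"
    by (simp only: sum.distrib sum_distrib_right)
  also have "\<dots> \<le> 151 / 150 * (p * N) * (11 / 5 * \<rho>0) + k\<^sup>2 * N / p\<^sup>2"
    using deg_le[OF assms] sum_row_\<mu>_le[of u] \<rho>0 by (intro add_mono mult_right_mono) auto
  also have "k\<^sup>2 * N / p\<^sup>2 \<le> p * N * (\<rho>0 / 1000)"
  proof -
    have "k\<^sup>2 * N / p\<^sup>2 \<le> (9 * p ^ 12 / 16777216) * N / p\<^sup>2"
      using k2 N p by (intro divide_right_mono mult_right_mono) auto
    also have "\<dots> = p * N * (p ^ 9 * 9 / 16777216)" using p by (simp add: field_simps eval_nat_numeral)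
    also have "\<dots> \<le> p * N * (\<rho>0 / 1000)"
    proof (intro mult_left_mono)
      have "p ^ 9 \<le> p ^ 3" using p by (intro power_decreasing) auto
      moreover have "0 \<le> p ^ 3" using p by simp
      ultimately show "p ^ 9 * 9 / 16777216 \<le> \<rho>0 / 1000" unfolding \<rho>0_def by linarith
    qed (use p N in auto)
    finally show ?thesis .
  qed
  finally have "\<bar>\<Sum>v\<in>V. G u v * h u v\<bar> \<le> 151 / 150 * (p * N) * (11 / 5 * \<rho>0) + p * N * (\<rho>0 / 1000)"
    by simp
  also have "\<dots> = (151 / 150 * (11 / 5) + 1 / 1000) * \<rho>0 * (p * N)" by (simp add: algebra_simps)
  also have "\<dots> \<le> (9 / 4) * \<rho>0 * (p * N)" using p N \<rho>0 by (intro mult_right_mono) auto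
  finally show ?thesis using p N by (simp add: hb_def divide_le_eq abs_mult)
qed

lemma Hm_le: "\<bar>Hm\<bar> \<le> 9 / 4 * \<rho>0"
proof -
  have "\<bar>\<Sum>u\<in>V. hb u\<bar> \<le> (\<Sum>u\<in>V. 9 / 4 * \<rho>0)"
    by (rule order_trans[OF sum_abs sum_mono]) (rule hb_le)
  then show ?thesis using N by (simp add: Hm_def N_def divide_le_eq mult.commute)
qed

lemma a_le: "u \<in> V \<Longrightarrow> \<bar>a u\<bar> \<le> 3 / 2 * \<rho>0"
  using hb_le[of u] Hm_le unfolding a_def by linarith

text \<open>Up to degree-sized errors, \<alpha> is the negative of \<mu> on G. The constant
  \<open>26 / 5\<close> adds 1/5 for U, 1 for each of two degree deviations and 3/2 for each of two
  values of a.\<close>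

lemma \<alpha>_\<mu>_le: assumes "u \<in> V" "v \<in> V"
  shows "\<bar>\<alpha> u v + G u v * \<mu> u v\<bar> \<le> G u v * (26 / 5 * \<rho>0)"
proof -
  have "\<bar>h u v - a u - a v + \<mu> u v\<bar> \<le> 26 / 5 * \<rho>0"
    unfolding h_def
    using U(1)[of u v] U_le[of u v] \<rho>_le[OF assms(1)] \<rho>_le[OF assms(2)] a_le[OF assms(1)] a_le[OF assms(2)]
    by linarith
  moreover have "\<alpha> u v + G u v * \<mu> u v = G u v * (h u v - a u - a v + \<mu> u v)"
    by (simp add: \<alpha>_def algebra_simps)
  moreover have "\<bar>G u v * (h u v - a u - a v + \<mu> u v)\<bar> = G u v * \<bar>h u v - a u - a v + \<mu> u v\<bar>"
    using G_ge(1)[of u v] by (simp add: abs_mult)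
  ultimately show ?thesis using G_ge(1)[of u v] mult_left_mono by metis
qed

text \<open>The threshold 1/4 in the definition of B leaves room for \<open>26 / 5 * \<rho>0\<close>
  below 1/3; then three values of \<alpha> cannot make a triangle weight negative.\<close>

lemma \<alpha>_le: assumes "u \<in> V" "v \<in> V"
  shows "\<bar>\<alpha> u v\<bar> \<le> G u v * (\<bar>\<mu> u v\<bar> + 26 / 5 * \<rho>0)" "\<bar>\<alpha> u v\<bar> \<le> 1 / 3"
proof -
  have "\<bar>\<alpha> u v\<bar> \<le> \<bar>G u v * \<mu> u v\<bar> + G u v * (26 / 5 * \<rho>0)" using \<alpha>_\<mu>_le[OF assms] by linarith
  then show "\<bar>\<alpha> u v\<bar> \<le> G u v * (\<bar>\<mu> u v\<bar> + 26 / 5 * \<rho>0)"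
    using G_ge(1)[of u v] by (simp add: abs_mult distrib_left)
  then show "\<bar>\<alpha> u v\<bar> \<le> 1 / 3" using G_cases[of u v] \<rho>0 by auto
qed

lemma factor_bounds: assumes "u \<in> V" "v \<in> V" "w \<in> V"
  shows "0 \<le> 1 + \<alpha> u v + \<alpha> v w + \<alpha> u w" "1 + \<alpha> u v + \<alpha> v w + \<alpha> u w \<le> 2"
  using \<alpha>_le(2)[of u v] \<alpha>_le(2)[of v w] \<alpha>_le(2)[of u w] assms by linarith+

lemma X_bounds: assumes "u \<in> V" "v \<in> V" "w \<in> V"
  shows "0 \<le> X u v w" "X u v w \<le> 2 / D"
proof -
  have G3: "0 \<le> G u v * G v w * G u w" "G u v * G v w * G u w \<le> 1"
    using G_cases[of u v] G_cases[of v w] G_cases[of u w] by auto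
  show "0 \<le> X u v w" unfolding X_def using G3 factor_bounds[OF assms] D by simp
  have "G u v * G v w * G u w * (1 + \<alpha> u v + \<alpha> v w + \<alpha> u w) \<le> 1 * 2"
    using G3 factor_bounds[OF assms] by (intro mult_mono) auto
  then show "X u v w \<le> 2 / D" unfolding X_def using D by (intro divide_right_mono) auto
qed

lemma X_cyclic: "X u v w = X v w u"
  by (simp add: X_def G_sym[of w u] G_sym[of w v] G_sym[of v u] \<alpha>_sym[of w u] \<alpha>_sym[of w v] \<alpha>_sym[of v u] algebra_simps)

text \<open>The formula for a averages as if every vertex had exactly \<open>p * N\<close>
  neighbours, evenly spread, and as if no pair had been given up. The three terms on the right are
  the exact prices of these simplifications, each a product of two small quantities.\<close>

lemma ah_eq: assumes "u \<in> V"
  shows "ah u - a u = - \<rho> u * a u - (\<Sum>w\<in>V. R u w * a w) / (p * N) + (\<Sum>w\<in>V. B u w * (a u + a w)) / (p * N)"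
proof -
  have pN: "p * N > 0" using p N by simp
  have "\<alpha> u w = G u w * h u w - a u * A u w - p * a w - R u w * a w + B u w * (a u + a w)" for w
    by (simp add: \<alpha>_def G_def R_def algebra_simps)
  then have "(\<Sum>w\<in>V. \<alpha> u w) = (\<Sum>w\<in>V. G u w * h u w) - a u * (\<Sum>w\<in>V. A u w) - p * (\<Sum>w\<in>V. a w)
      - (\<Sum>w\<in>V. R u w * a w) + (\<Sum>w\<in>V. B u w * (a u + a w))"
    by (simp add: sum.distrib sum_subtractf sum_distrib_left)
  moreover have "(\<Sum>w\<in>V. a w) = N * (Hm / 3)"
  proof -
    have "(\<Sum>w\<in>V. a w) = (\<Sum>w\<in>V. hb w) / 2 - N * (Hm / 6)"
      by (simp add: a_def sum_subtractf sum_divide_distrib N_def)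
    also have "(\<Sum>w\<in>V. hb w) = N * Hm" using N by (simp add: Hm_def)
    finally show ?thesis by (simp add: algebra_simps)
  qed
  moreover have "p * N * (S / (p * N)) = S" for S using p N by simp
  then have "(\<Sum>w\<in>V. G u w * h u w) = p * N * hb u" unfolding hb_def by metis
  ultimately have "(\<Sum>w\<in>V. \<alpha> u w) = p * N * (hb u - a u * (1 + \<rho> u) - Hm / 3)
      - (\<Sum>w\<in>V. R u w * a w) + (\<Sum>w\<in>V. B u w * (a u + a w))"
    unfolding deg_eq by (simp add: algebra_simps)
  then have "ah u = (hb u - a u * (1 + \<rho> u) - Hm / 3) - (\<Sum>w\<in>V. R u w * a w) / (p * N)
      + (\<Sum>w\<in>V. B u w * (a u + a w)) / (p * N)"
    using p N by (simp add: ah_def add_divide_distrib diff_divide_distrib)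
  moreover have "hb u - Hm / 3 = 2 * a u" by (simp add: a_def)
  moreover have "a u * (1 + \<rho> u) = a u - - \<rho> u * a u" by (simp add: algebra_simps)
  ultimately show ?thesis by linarith
qed

text \<open>The cover that a pair of G loses because both other sides of its triangles have to lie
  in G. It is kept apart from the other errors because a pure deficit costs the factor 1 instead of
  2.\<close>

definition "lo u v = G u v * (\<Sum>w\<in>V. (A v w * A u w - G v w * G u w) * (1 + \<alpha> u v + \<alpha> v w + \<alpha> u w)) / D"

lemma lo_ge: assumes "u \<in> V" "v \<in> V" shows "0 \<le> lo u v"
proof -
  have "0 \<le> A v w * A u w - G v w * G u w" for w
    using G_cases[of v w] G_cases[of u w] A_ge[of v w] A_ge[of u w] by auto
  then show ?thesis unfolding lo_def using factor_bounds[OF assms] D G_ge(1)[of u v]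
    by (intro divide_nonneg_pos mult_nonneg_nonneg sum_nonneg) auto
qed

text \<open>The first-order terms U, \<rho> and \<mu> cancel against
  \<open>\<alpha> u v + a u + a v\<close>. Apart from \<open>lo\<close> there remain the codegree
  deviation times \<alpha>, the errors of the neighbourhood averages and the correlations Q.\<close>

lemma cover_eq:
  assumes V: "u \<in> V" "v \<in> V" and G: "G u v = 1"
  shows "(\<Sum>w\<in>V. X u v w) + U u v = 1 - lo u v +
    ((\<rho> u + \<rho> v + \<mu> u v) * \<alpha> u v + (ah u - a u) + (ah v - a v) + (Q u v + Q v u) / D)"
proof -
  have A\<alpha>: "A x y * \<alpha> x y = \<alpha> x y" for x y using G_cases[of x y] by (auto simp: \<alpha>_def)
  have one: "(\<Sum>w\<in>V. A v w * \<alpha> u w) = D * ah u + Q u v" for u v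
  proof -
    have "(\<Sum>w\<in>V. A v w * \<alpha> u w) = (\<Sum>w\<in>V. p * \<alpha> u w + R v w * \<alpha> u w)"
      by (intro sum.cong refl) (simp add: R_def algebra_simps)
    also have "\<dots> = p * (\<Sum>w\<in>V. \<alpha> u w) + Q u v" by (simp add: sum.distrib sum_distrib_left Q_def)
    finally show ?thesis using p N by (simp add: ah_def D_def power2_eq_square)
  qed
  have "(\<Sum>w\<in>V. A v w * A u w * (1 + \<alpha> u v + \<alpha> v w + \<alpha> u w)) =
      (\<Sum>w\<in>V. (1 + \<alpha> u v) * (A u w * A v w) + A u w * \<alpha> v w + A v w * \<alpha> u w)"
  proof (intro sum.cong refl)
    fix w
    have "A v w * A u w * (1 + \<alpha> u v + \<alpha> v w + \<alpha> u w) =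
        (1 + \<alpha> u v) * (A u w * A v w) + A u w * (A v w * \<alpha> v w) + A v w * (A u w * \<alpha> u w)"
      by (simp add: algebra_simps)
    then show "A v w * A u w * (1 + \<alpha> u v + \<alpha> v w + \<alpha> u w) =
        (1 + \<alpha> u v) * (A u w * A v w) + A u w * \<alpha> v w + A v w * \<alpha> u w" by (simp only: A\<alpha>)
  qed
  also have "\<dots> = (1 + \<alpha> u v) * (D * (1 + \<rho> u + \<rho> v + \<mu> u v)) + (D * ah v + Q v u) + (D * ah u + Q u v)"
    by (simp only: sum.distrib sum_distrib_left[symmetric] one codegree[OF V])
  finally have full: "(\<Sum>w\<in>V. A v w * A u w * (1 + \<alpha> u v + \<alpha> v w + \<alpha> u w)) / D =
      (1 + \<alpha> u v) * (1 + \<rho> u + \<rho> v + \<mu> u v) + ah v + ah u + (Q u v + Q v u) / D"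
    using D by (simp add: field_simps)
  have "(\<Sum>w\<in>V. X u v w) = (\<Sum>w\<in>V. A v w * A u w * (1 + \<alpha> u v + \<alpha> v w + \<alpha> u w)) / D - lo u v"
    unfolding lo_def X_def G sum_divide_distrib[symmetric] diff_divide_distrib[symmetric]
    by (simp add: sum_subtractf[symmetric] algebra_simps)
  moreover have "\<alpha> u v = - (U u v + \<rho> u + \<rho> v + \<mu> u v) - a u - a v"
    using G by (simp add: \<alpha>_def h_def)
  moreover have "(1 + \<alpha> u v) * (1 + \<rho> u + \<rho> v + \<mu> u v) =
      1 + \<alpha> u v + (\<rho> u + \<rho> v + \<mu> u v) + (\<rho> u + \<rho> v + \<mu> u v) * \<alpha> u v"
    by (simp add: algebra_simps)
  ultimately show ?thesis using full by linarith
qed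


lemma sum_B_le: "(\<Sum>u\<in>V. \<Sum>v\<in>V. B u v) \<le> 16 * (E2 * N\<^sup>2)"
proof -
  have "(\<Sum>u\<in>V. \<Sum>v\<in>V. B u v) \<le> (\<Sum>u\<in>V. \<Sum>v\<in>V. 16 * (\<mu> u v)\<^sup>2)"
    by (intro sum_mono B_le)
  also have "\<dots> = 16 * (\<Sum>u\<in>V. \<Sum>v\<in>V. (\<mu> u v)\<^sup>2)" by (simp only: sum_distrib_left)
  finally show ?thesis using sum_\<mu>2_le by linarith
qed

text \<open>A triangle is lost through one of its two other sides, and by symmetry both cases count
  triangles over a pair in B, that is, codegrees weighted by B. Two cases and weights of at most
  \<open>2 / D\<close> give the factor 4, and \<open>76 / 75 * 16 + 4\<close> is rounded up to
  \<open>41 / 2\<close>.\<close>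

lemma sum_lo_le: "(\<Sum>u\<in>V. \<Sum>v\<in>V. lo u v) \<le> 82 * (E2 * N\<^sup>2)"
proof -
  let ?T = "\<Sum>u\<in>V. \<Sum>v\<in>V. \<Sum>w\<in>V. A u v * (B v w * A u w)"
  have "lo u v \<le> (\<Sum>w\<in>V. A u v * (B v w * A u w) + A u v * (A v w * B u w)) * 2 / D"
    if "u \<in> V" "v \<in> V" for u v
  proof -
    have "G u v * ((A v w * A u w - G v w * G u w) * (1 + \<alpha> u v + \<alpha> v w + \<alpha> u w))
        \<le> (A u v * (B v w * A u w) + A u v * (A v w * B u w)) * 2" if w: "w \<in> V" for w
    proof -
      have "0 \<le> A v w * A u w - G v w * G u w" "A v w * A u w - G v w * G u w \<le> B v w * A u w + A v w * B u w"
        using G_cases[of v w] G_cases[of u w] A_ge[of v w] A_ge[of u w] B_ge[of v w] B_ge[of u w] by auto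
      then have "(A v w * A u w - G v w * G u w) * (1 + \<alpha> u v + \<alpha> v w + \<alpha> u w)
          \<le> (B v w * A u w + A v w * B u w) * 2"
        using factor_bounds[OF \<open>u \<in> V\<close> \<open>v \<in> V\<close> w] by (intro mult_mono) auto
      moreover have "0 \<le> (A v w * A u w - G v w * G u w) * (1 + \<alpha> u v + \<alpha> v w + \<alpha> u w)"
        using \<open>0 \<le> A v w * A u w - G v w * G u w\<close> factor_bounds[OF \<open>u \<in> V\<close> \<open>v \<in> V\<close> w] by simp
      ultimately have "G u v * ((A v w * A u w - G v w * G u w) * (1 + \<alpha> u v + \<alpha> v w + \<alpha> u w))
          \<le> A u v * ((B v w * A u w + A v w * B u w) * 2)"
        using mult_mono[OF G_ge(2)[of u v] _ A_ge(1)] by blast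
      then show ?thesis by (simp add: algebra_simps)
    qed
    then have "(\<Sum>w\<in>V. G u v * ((A v w * A u w - G v w * G u w) * (1 + \<alpha> u v + \<alpha> v w + \<alpha> u w)))
        \<le> (\<Sum>w\<in>V. (A u v * (B v w * A u w) + A u v * (A v w * B u w)) * 2)"
      by (rule sum_mono)
    then show ?thesis unfolding lo_def using D
      by (intro divide_right_mono) (simp_all only: sum_distrib_left sum_distrib_right less_imp_le)
  qed
  then have "(\<Sum>u\<in>V. \<Sum>v\<in>V. lo u v)
      \<le> (\<Sum>u\<in>V. \<Sum>v\<in>V. (\<Sum>w\<in>V. A u v * (B v w * A u w) + A u v * (A v w * B u w)) * 2 / D)"
    by (intro sum_mono)
  also have "\<dots> = (?T + (\<Sum>u\<in>V. \<Sum>v\<in>V. \<Sum>w\<in>V. A u v * (A v w * B u w))) * 2 / D"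
    by (simp only: sum.distrib sum_divide_distrib[symmetric] sum_distrib_right[symmetric])
  also have "(\<Sum>u\<in>V. \<Sum>v\<in>V. \<Sum>w\<in>V. A u v * (A v w * B u w)) = ?T"
    by (subst sum.swap) (simp add: A_sym mult_ac)
  also have "?T = (\<Sum>v\<in>V. \<Sum>w\<in>V. B v w * (D * (1 + \<rho> v + \<rho> w + \<mu> v w)))"
  proof -
    have "?T = (\<Sum>v\<in>V. \<Sum>u\<in>V. \<Sum>w\<in>V. A u v * (B v w * A u w))" by (rule sum.swap)
    also have "\<dots> = (\<Sum>v\<in>V. \<Sum>w\<in>V. \<Sum>u\<in>V. A u v * (B v w * A u w))"
      by (intro sum.cong refl sum.swap)
    also have "\<dots> = (\<Sum>v\<in>V. \<Sum>w\<in>V. B v w * (\<Sum>u\<in>V. A v u * A w u))"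
      by (intro sum.cong refl) (simp add: sum_distrib_left A_sym mult_ac)
    also have "\<dots> = (\<Sum>v\<in>V. \<Sum>w\<in>V. B v w * (D * (1 + \<rho> v + \<rho> w + \<mu> v w)))"
      by (intro sum.cong refl) (simp only: codegree)
    finally show ?thesis .
  qed
  also have "(\<Sum>v\<in>V. \<Sum>w\<in>V. B v w * (D * (1 + \<rho> v + \<rho> w + \<mu> v w)))
      \<le> (\<Sum>v\<in>V. \<Sum>w\<in>V. D * (41 / 2 * (\<mu> v w)\<^sup>2))"
  proof (intro sum_mono)
    fix v w assume V: "v \<in> V" "w \<in> V"
    have "B v w * (1 + \<rho> v + \<rho> w + \<mu> v w) \<le> B v w * (76 / 75 + \<bar>\<mu> v w\<bar>)"
      using \<rho>_le[OF V(1)] \<rho>_le[OF V(2)] \<rho>0 B_ge(1) by (intro mult_left_mono) auto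
    also have "\<dots> = 76 / 75 * B v w + B v w * \<bar>\<mu> v w\<bar>" by (simp add: algebra_simps)
    also have "\<dots> \<le> 76 / 75 * (16 * (\<mu> v w)\<^sup>2) + 4 * (\<mu> v w)\<^sup>2"
      by (intro add_mono mult_left_mono B_le) auto
    also have "\<dots> \<le> 41 / 2 * (\<mu> v w)\<^sup>2" by simp
    finally have "D * (B v w * (1 + \<rho> v + \<rho> w + \<mu> v w)) \<le> D * (41 / 2 * (\<mu> v w)\<^sup>2)"
      using D by (intro mult_left_mono) auto
    then show "B v w * (D * (1 + \<rho> v + \<rho> w + \<mu> v w)) \<le> D * (41 / 2 * (\<mu> v w)\<^sup>2)"
      by (simp add: mult_ac)
  qed
  also have "\<dots> = D * (41 / 2 * (\<Sum>v\<in>V. \<Sum>w\<in>V. (\<mu> v w)\<^sup>2))" by (simp only: sum_distrib_left)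
  finally have "(\<Sum>u\<in>V. \<Sum>v\<in>V. lo u v)
      \<le> (D * (41 / 2 * (\<Sum>v\<in>V. \<Sum>w\<in>V. (\<mu> v w)\<^sup>2)) + D * (41 / 2 * (\<Sum>v\<in>V. \<Sum>w\<in>V. (\<mu> v w)\<^sup>2))) * 2 / D"
    using D by (simp add: divide_right_mono)
  also have "\<dots> = 82 * (\<Sum>v\<in>V. \<Sum>w\<in>V. (\<mu> v w)\<^sup>2)" using D by (simp add: field_simps)
  finally show ?thesis using sum_\<mu>2_le by linarith
qed

lemma sum_abs_\<mu>_le: "(\<Sum>u\<in>V. \<Sum>v\<in>V. \<bar>\<mu> u v\<bar>) \<le> k\<^sup>2 / p\<^sup>2 * N\<^sup>2"
proof -
  have "(\<Sum>u\<in>V. \<Sum>v\<in>V. \<bar>\<mu> u v\<bar>) \<le> (\<Sum>u\<in>V. k\<^sup>2 * N / p\<^sup>2)"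
    by (intro sum_mono sum_row_\<mu>_le)
  then show ?thesis by (simp add: N_def power2_eq_square mult_ac)
qed

lemma sum_arcs_vertex_le:
  assumes "\<And>u. 0 \<le> f u"
  shows "(\<Sum>u\<in>V. \<Sum>v\<in>V. A u v * (f u + f v)) \<le> 151 / 75 * (p * N) * (\<Sum>u\<in>V. f u)"
proof -
  have "(\<Sum>u\<in>V. \<Sum>v\<in>V. A u v * (f u + f v)) = (\<Sum>u\<in>V. \<Sum>v\<in>V. A u v * f u) + (\<Sum>u\<in>V. \<Sum>v\<in>V. A u v * f v)"
    by (simp only: distrib_left sum.distrib)
  also have "(\<Sum>u\<in>V. \<Sum>v\<in>V. A u v * f v) = (\<Sum>u\<in>V. \<Sum>v\<in>V. A u v * f u)"
    by (subst sum.swap) (simp add: A_sym)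
  also have "(\<Sum>u\<in>V. \<Sum>v\<in>V. A u v * f u) = (\<Sum>u\<in>V. (\<Sum>v\<in>V. A u v) * f u)"
    by (simp only: sum_distrib_right)
  also have "\<dots> \<le> (\<Sum>u\<in>V. 151 / 150 * (p * N) * f u)"
    using deg_le assms by (intro sum_mono mult_right_mono) auto
  also have "\<dots> = 151 / 150 * (p * N) * (\<Sum>u\<in>V. f u)" by (simp only: sum_distrib_left)
  finally show ?thesis by (simp add: algebra_simps)
qed

text \<open>Multiplying \<mu> by \<mu> gives the square sum. Every other product has one factor
  bounded pointwise by a multiple of \<open>\<rho>0\<close> and another whose absolute sum is
  controlled by the cut norm.\<close>

lemma sum_\<tau>\<alpha>_le: "(\<Sum>u\<in>V. \<Sum>v\<in>V. \<bar>(\<rho> u + \<rho> v + \<mu> u v) * \<alpha> u v\<bar>)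
  \<le> (E2 + 36 / 5 * \<rho>0 * k\<^sup>2 / p\<^sup>2 + 11 * \<rho>0 * k\<^sup>2) * N\<^sup>2"
proof -
  have "\<bar>(\<rho> u + \<rho> v + \<mu> u v) * \<alpha> u v\<bar>
      \<le> (\<mu> u v)\<^sup>2 + 36 / 5 * \<rho>0 * \<bar>\<mu> u v\<bar> + 26 / 5 * \<rho>0 * (A u v * (\<bar>\<rho> u\<bar> + \<bar>\<rho> v\<bar>))"
    if V: "u \<in> V" "v \<in> V" for u v
  proof -
    let ?r = "\<bar>\<rho> u\<bar> + \<bar>\<rho> v\<bar>" and ?m = "\<bar>\<mu> u v\<bar>" and ?g = "26 / 5 * \<rho>0"
    have "\<bar>(\<rho> u + \<rho> v + \<mu> u v) * \<alpha> u v\<bar> \<le> (?r + ?m) * (G u v * (?m + ?g))"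
      unfolding abs_mult using \<alpha>_le(1)[OF V] by (intro mult_mono) auto
    also have "\<dots> = G u v * (?m * ?m + ?m * (?g + ?r)) + ?g * (G u v * ?r)" by (simp add: algebra_simps)
    also have "\<dots> \<le> 1 * (?m * ?m + ?m * (36 / 5 * \<rho>0)) + ?g * (A u v * ?r)"
    proof (intro add_mono mult_mono order_refl)
      show "?g + ?r \<le> 36 / 5 * \<rho>0" using \<rho>_le[OF V(1)] \<rho>_le[OF V(2)] by linarith
    qed (use G_ge[of u v] \<rho>0 in auto)
    finally show ?thesis by (simp add: power2_eq_square mult_ac)
  qed
  then have "(\<Sum>u\<in>V. \<Sum>v\<in>V. \<bar>(\<rho> u + \<rho> v + \<mu> u v) * \<alpha> u v\<bar>) \<le> (\<Sum>u\<in>V. \<Sum>v\<in>V. (\<mu> u v)\<^sup>2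
      + 36 / 5 * \<rho>0 * \<bar>\<mu> u v\<bar> + 26 / 5 * \<rho>0 * (A u v * (\<bar>\<rho> u\<bar> + \<bar>\<rho> v\<bar>)))"
    by (intro sum_mono)
  also have "\<dots> = (\<Sum>u\<in>V. \<Sum>v\<in>V. (\<mu> u v)\<^sup>2) + 36 / 5 * \<rho>0 * (\<Sum>u\<in>V. \<Sum>v\<in>V. \<bar>\<mu> u v\<bar>)
      + 26 / 5 * \<rho>0 * (\<Sum>u\<in>V. \<Sum>v\<in>V. A u v * (\<bar>\<rho> u\<bar> + \<bar>\<rho> v\<bar>))"
    by (simp only: sum.distrib sum_distrib_left)
  also have "\<dots> \<le> E2 * N\<^sup>2 + 36 / 5 * \<rho>0 * (k\<^sup>2 / p\<^sup>2 * N\<^sup>2) + 26 / 5 * \<rho>0 * (151 / 75 * (p * N) * (k\<^sup>2 * N / p))"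
  proof (intro add_mono mult_left_mono sum_\<mu>2_le sum_abs_\<mu>_le)
    have "(\<Sum>u\<in>V. \<Sum>v\<in>V. A u v * (\<bar>\<rho> u\<bar> + \<bar>\<rho> v\<bar>)) \<le> 151 / 75 * (p * N) * (\<Sum>u\<in>V. \<bar>\<rho> u\<bar>)"
      by (rule sum_arcs_vertex_le) simp
    also have "\<dots> \<le> 151 / 75 * (p * N) * (k\<^sup>2 * N / p)"
      using sum_\<rho>_le p N by (intro mult_left_mono) auto
    finally show "(\<Sum>u\<in>V. \<Sum>v\<in>V. A u v * (\<bar>\<rho> u\<bar> + \<bar>\<rho> v\<bar>)) \<le> 151 / 75 * (p * N) * (k\<^sup>2 * N / p)" .
  qed (use \<rho>0 in auto)
  also have "\<dots> = (E2 + 36 / 5 * \<rho>0 * k\<^sup>2 / p\<^sup>2 + 26 / 5 * 151 / 75 * (\<rho>0 * k\<^sup>2)) * N\<^sup>2"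
    using p by (simp add: algebra_simps power2_eq_square)
  also have "\<dots> \<le> (E2 + 36 / 5 * \<rho>0 * k\<^sup>2 / p\<^sup>2 + 11 * (\<rho>0 * k\<^sup>2)) * N\<^sup>2"
    using \<rho>0 by (intro mult_right_mono add_left_mono) auto
  finally show ?thesis by (simp add: mult.assoc)
qed

lemma sum_ah_le: "(\<Sum>u\<in>V. \<bar>ah u - a u\<bar>) \<le> (3 * \<rho>0 * k\<^sup>2 + 48 * \<rho>0 * E2) * N / p"
proof -
  have pN: "p * N > 0" using p N by simp
  have "\<bar>ah u - a u\<bar> \<le> 3 / 2 * \<rho>0 * \<bar>\<rho> u\<bar> + \<bar>\<Sum>w\<in>V. R u w * a w\<bar> / (p * N) + 3 * \<rho>0 * (\<Sum>w\<in>V. B u w) / (p * N)"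
    if u: "u \<in> V" for u
  proof -
    have "\<bar>a u\<bar> * \<bar>\<rho> u\<bar> \<le> 3 / 2 * \<rho>0 * \<bar>\<rho> u\<bar>"
      using a_le[OF u] by (intro mult_right_mono) auto
    then have "\<bar>- \<rho> u * a u\<bar> \<le> 3 / 2 * \<rho>0 * \<bar>\<rho> u\<bar>" by (simp add: abs_mult mult.commute)
    moreover have "\<bar>\<Sum>w\<in>V. B u w * (a u + a w)\<bar> \<le> 3 * \<rho>0 * (\<Sum>w\<in>V. B u w)"
      unfolding sum_distrib_left
    proof (rule order_trans[OF sum_abs sum_mono])
      fix w assume w: "w \<in> V"
      have "\<bar>a u + a w\<bar> \<le> 3 * \<rho>0" using a_le[OF u] a_le[OF w] by linarith
      then have "B u w * \<bar>a u + a w\<bar> \<le> B u w * (3 * \<rho>0)" using B_ge(1) by (intro mult_left_mono)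
      then show "\<bar>B u w * (a u + a w)\<bar> \<le> 3 * \<rho>0 * B u w" using B_ge(1)[of u w] by (simp add: abs_mult mult_ac)
    qed
    then have "\<bar>(\<Sum>w\<in>V. B u w * (a u + a w)) / (p * N)\<bar> \<le> 3 * \<rho>0 * (\<Sum>w\<in>V. B u w) / (p * N)"
      using pN by (simp add: divide_right_mono)
    moreover have "\<bar>(\<Sum>w\<in>V. R u w * a w) / (p * N)\<bar> = \<bar>\<Sum>w\<in>V. R u w * a w\<bar> / (p * N)"
      using pN by simp
    moreover have "\<bar>x - y + z\<bar> \<le> \<bar>x\<bar> + \<bar>y\<bar> + \<bar>z\<bar>" for x y z :: real by linarith
    ultimately show ?thesis unfolding ah_eq[OF u] by (smt (verit))
  qed
  then have "(\<Sum>u\<in>V. \<bar>ah u - a u\<bar>) \<le> (\<Sum>u\<in>V. 3 / 2 * \<rho>0 * \<bar>\<rho> u\<bar> + \<bar>\<Sum>w\<in>V. R u w * a w\<bar> / (p * N)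
      + 3 * \<rho>0 * (\<Sum>w\<in>V. B u w) / (p * N))"
    by (rule sum_mono)
  also have "\<dots> = 3 / 2 * \<rho>0 * (\<Sum>u\<in>V. \<bar>\<rho> u\<bar>) + (\<Sum>u\<in>V. \<bar>\<Sum>w\<in>V. R u w * a w\<bar>) / (p * N)
      + 3 * \<rho>0 * (\<Sum>u\<in>V. \<Sum>w\<in>V. B u w) / (p * N)"
    by (simp only: sum.distrib sum_distrib_left sum_divide_distrib)
  also have "\<dots> \<le> 3 / 2 * \<rho>0 * (k\<^sup>2 * N / p) + (3 / 2 * \<rho>0 * (k\<^sup>2 * N\<^sup>2)) / (p * N)
      + 3 * \<rho>0 * (16 * (E2 * N\<^sup>2)) / (p * N)"
    using pN \<rho>0 a_le
    by (intro add_mono mult_left_mono divide_right_mono sum_\<rho>_le row_bound sum_B_le) auto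
  also have "\<dots> = (3 * \<rho>0 * k\<^sup>2 + 48 * \<rho>0 * E2) * N / p"
    using p N by (simp add: field_simps power2_eq_square)
  finally show ?thesis .
qed

text \<open>Here \<alpha> is split into \<open>- m\<close>, with m the restriction of \<mu> to G,
  and a remainder of size \<open>\<rho>0\<close>. For the remainder the row-wise cut norm bound
  suffices. For m it would gain only the constant 1/4; summing over u first produces inner products,
  and Grothendieck's inequality gains a factor of order \<open>k / p\<close> from the small square
  sums of the columns of m.\<close>

lemma sum_Q_le: "(\<Sum>u\<in>V. \<Sum>v\<in>V. \<bar>Q u v\<bar>) \<le> (26 / 5 * \<rho>0 * k\<^sup>2 + 81 / 32 * k ^ 3 / p) * N ^ 3"
proof -
  define m where "m u w = G u w * \<mu> u w" for u w
  define s where "s v u = sgn (\<Sum>w\<in>V. R v w * m u w)" for u v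
  have m_le: "\<bar>m u w\<bar> \<le> 1 / 4" "\<bar>m u w\<bar> \<le> \<bar>\<mu> u w\<bar>" for u w
    using G_cases[of u w] by (auto simp: m_def)
  have "\<bar>Q u v\<bar> \<le> \<bar>\<Sum>w\<in>V. R v w * (\<alpha> u w + m u w)\<bar> + \<bar>\<Sum>w\<in>V. R v w * m u w\<bar>" for u v
  proof -
    have "Q u v = (\<Sum>w\<in>V. R v w * (\<alpha> u w + m u w)) - (\<Sum>w\<in>V. R v w * m u w)"
      by (simp add: Q_def sum_subtractf[symmetric] algebra_simps)
    then show ?thesis by linarith
  qed
  then have "(\<Sum>u\<in>V. \<Sum>v\<in>V. \<bar>Q u v\<bar>) \<le> (\<Sum>u\<in>V. \<Sum>v\<in>V. \<bar>\<Sum>w\<in>V. R v w * (\<alpha> u w + m u w)\<bar> + \<bar>\<Sum>w\<in>V. R v w * m u w\<bar>)"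
    by (intro sum_mono)
  also have "\<dots> = (\<Sum>u\<in>V. \<Sum>v\<in>V. \<bar>\<Sum>w\<in>V. R v w * (\<alpha> u w + m u w)\<bar>) + (\<Sum>u\<in>V. \<Sum>v\<in>V. \<bar>\<Sum>w\<in>V. R v w * m u w\<bar>)"
    by (simp only: sum.distrib)
  also have "(\<Sum>u\<in>V. \<Sum>v\<in>V. \<bar>\<Sum>w\<in>V. R v w * (\<alpha> u w + m u w)\<bar>) \<le> (\<Sum>u\<in>V. 26 / 5 * \<rho>0 * (k\<^sup>2 * N\<^sup>2))"
  proof (intro sum_mono row_bound)
    fix u w assume V: "u \<in> V" "w \<in> V"
    have "G u w * (26 / 5 * \<rho>0) \<le> 1 * (26 / 5 * \<rho>0)" using G_ge(3) \<rho>0 by (intro mult_right_mono) auto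
    then show "\<bar>\<alpha> u w + m u w\<bar> \<le> 26 / 5 * \<rho>0" using \<alpha>_\<mu>_le[OF V] unfolding m_def by linarith
  qed (use \<rho>0 in auto)
  also have "(\<Sum>u\<in>V. \<Sum>v\<in>V. \<bar>\<Sum>w\<in>V. R v w * m u w\<bar>) = (\<Sum>v\<in>V. \<Sum>w\<in>V. R v w * (\<Sum>u\<in>V. s v u * m u w))"
  proof -
    have "(\<Sum>u\<in>V. \<Sum>v\<in>V. \<bar>\<Sum>w\<in>V. R v w * m u w\<bar>) = (\<Sum>v\<in>V. \<Sum>u\<in>V. \<bar>\<Sum>w\<in>V. R v w * m u w\<bar>)"
      by (rule sum.swap)
    also have "\<dots> = (\<Sum>v\<in>V. \<Sum>u\<in>V. \<Sum>w\<in>V. R v w * (s v u * m u w))"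
    proof (intro sum.cong refl)
      fix v u
      have "\<bar>\<Sum>w\<in>V. R v w * m u w\<bar> = s v u * (\<Sum>w\<in>V. R v w * m u w)"
        unfolding s_def by (simp add: abs_sgn mult.commute)
      then show "\<bar>\<Sum>w\<in>V. R v w * m u w\<bar> = (\<Sum>w\<in>V. R v w * (s v u * m u w))"
        by (simp add: sum_distrib_left mult_ac)
    qed
    also have "\<dots> = (\<Sum>v\<in>V. \<Sum>w\<in>V. R v w * (\<Sum>u\<in>V. s v u * m u w))"
      by (rule sum.cong[OF refl], subst sum.swap) (simp add: sum_distrib_left)
    finally show ?thesis .
  qed
  also have "\<dots> \<le> \<bar>\<Sum>v\<in>V. \<Sum>w\<in>V. R v w * (\<Sum>u\<in>V. s v u * m u w)\<bar>" by simp
  also have "\<dots> \<le> 81 / 16 * (k\<^sup>2 * N\<^sup>2) * sqrt N * (k * sqrt N / (2 * p))"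
  proof (rule grothendieck_inequality[OF finV(1) finV(1) finV(1) cut_bound])
    fix v
    have "(\<Sum>u\<in>V. (s v u)\<^sup>2) \<le> (\<Sum>u\<in>V. 1)"
      by (intro sum_mono) (auto simp: s_def sgn_if)
    then show "(\<Sum>u\<in>V. (s v u)\<^sup>2) \<le> (sqrt N)\<^sup>2" using N by (simp add: N_def)
  next
    fix w
    have "(\<Sum>u\<in>V. (m u w)\<^sup>2) \<le> (\<Sum>u\<in>V. 1 / 4 * \<bar>\<mu> w u\<bar>)"
    proof (rule sum_mono)
      fix u
      have "\<bar>m u w\<bar> * \<bar>m u w\<bar> \<le> 1 / 4 * \<bar>\<mu> u w\<bar>" using m_le by (intro mult_mono) auto
      then show "(m u w)\<^sup>2 \<le> 1 / 4 * \<bar>\<mu> w u\<bar>" by (simp add: power2_eq_square \<mu>_sym[of w u])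
    qed
    also have "\<dots> \<le> 1 / 4 * (k\<^sup>2 * N / p\<^sup>2)"
      unfolding sum_distrib_left[symmetric] by (intro mult_left_mono sum_row_\<mu>_le) auto
    also have "\<dots> = (k * sqrt N / (2 * p))\<^sup>2" using N by (simp add: power_divide power_mult_distrib)
    finally show "(\<Sum>u\<in>V. (m u w)\<^sup>2) \<le> (k * sqrt N / (2 * p))\<^sup>2" .
  qed (use N k p in auto)
  also have "\<dots> = 81 / 32 * k ^ 3 / p * N ^ 3"
  proof -
    have "sqrt N * (k * sqrt N / (2 * p)) = k * N / (2 * p)" using N by simp
    then have "81 / 16 * (k\<^sup>2 * N\<^sup>2) * sqrt N * (k * sqrt N / (2 * p)) = 81 / 16 * (k\<^sup>2 * N\<^sup>2) * (k * N / (2 * p))"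
      by (simp only: mult.assoc)
    then show ?thesis by (simp add: eval_nat_numeral mult_ac)
  qed
  also have "(\<Sum>u\<in>V. 26 / 5 * \<rho>0 * (k\<^sup>2 * N\<^sup>2)) = 26 / 5 * \<rho>0 * k\<^sup>2 * N ^ 3"
    by (simp add: N_def[symmetric] eval_nat_numeral mult_ac)
  finally show ?thesis by (simp add: distrib_right)
qed


text \<open>The pairs given up, \<open>lo\<close> and the squares of \<mu> together cost about
  \<open>100 * E2\<close>. The terms with \<open>\<rho>0 * k\<^sup>2 / p\<^sup>2\<close> explain the
  cube in the degree tolerance: after division by \<open>p\<^sup>2\<close> exactly the required
  factor p is left.\<close>

lemma sum_cover_cost_le:
  "(\<Sum>u\<in>V. \<Sum>v\<in>V. A u v * cover_cost ((\<Sum>w\<in>V. X u v w) + U u v)) \<le> 11 / 20 * p * k\<^sup>2 * N\<^sup>2"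
proof -
  let ?d = "\<lambda>u. \<bar>ah u - a u\<bar>" and ?t = "\<lambda>u v. \<bar>(\<rho> u + \<rho> v + \<mu> u v) * \<alpha> u v\<bar>"
  have "A u v * cover_cost ((\<Sum>w\<in>V. X u v w) + U u v) \<le> B u v + lo u v + 2 * ?t u v
      + 2 * (A u v * (?d u + ?d v)) + 2 / D * \<bar>Q u v\<bar> + 2 / D * \<bar>Q v u\<bar>" if V: "u \<in> V" "v \<in> V" for u v
  proof -
    have QD: "0 \<le> 2 / D * \<bar>Q u v\<bar>" "0 \<le> 2 / D * \<bar>Q v u\<bar>" using D by auto
    have dA: "0 \<le> A u v * (?d u + ?d v)" using A_ge by simp
    consider "A u v = 0" | "A u v = 1" "B u v = 1" "G u v = 0" | "A u v = 1" "B u v = 0" "G u v = 1"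
      using G_cases[of u v] by auto
    then show ?thesis
    proof cases
      case 1
      \<comment> \<open>Off the arcs the left side is 0, so only nonnegativity of the error terms is
        needed.\<close>
      then show ?thesis using lo_ge[OF V] B_ge(1)[of u v] QD by simp
    next
      case 2
      have X0: "(\<Sum>w\<in>V. X u v w) = 0" using 2(3) by (simp add: X_def)
      have "cover_cost (U u v) \<le> 1"
        using U(1)[of u v] U_le[of u v] \<rho>0 by (simp add: cover_cost_def)
      moreover have "c \<le> 1 + l + 2 * t + 2 * x + y + z"
        if "c \<le> 1" "0 \<le> l" "0 \<le> t" "0 \<le> x" "0 \<le> y" "0 \<le> z" for c l t x y z :: real
        using that by linarith
      ultimately show ?thesis using lo_ge[OF V] QD dA unfolding X0 2(1,2)
        by (simp only: mult_1_left add_0_left abs_ge_zero)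
    next
      case 3
      have "cover_cost ((\<Sum>w\<in>V. X u v w) + U u v) \<le> lo u v +
          2 * \<bar>(\<rho> u + \<rho> v + \<mu> u v) * \<alpha> u v + (ah u - a u) + (ah v - a v) + (Q u v + Q v u) / D\<bar>"
        unfolding cover_eq[OF V 3(3)] using lo_ge[OF V] by (rule cover_cost_le)
      also have "\<dots> \<le> lo u v + 2 * (?t u v + ?d u + ?d v + (\<bar>Q u v\<bar> + \<bar>Q v u\<bar>) / D)"
      proof -
        have "\<bar>(Q u v + Q v u) / D\<bar> \<le> (\<bar>Q u v\<bar> + \<bar>Q v u\<bar>) / D"
          using D by (simp add: divide_right_mono)
        moreover have "\<bar>x + y + z + t\<bar> \<le> \<bar>x\<bar> + \<bar>y\<bar> + \<bar>z\<bar> + t'" if "\<bar>t\<bar> \<le> t'" for x y z t t' :: real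
          using that by linarith
        ultimately show ?thesis by (intro add_left_mono mult_left_mono) auto
      qed
      also have "\<dots> = B u v + lo u v + 2 * ?t u v
          + 2 * (A u v * (?d u + ?d v)) + 2 / D * \<bar>Q u v\<bar> + 2 / D * \<bar>Q v u\<bar>"
        using 3 by (simp add: add_divide_distrib)
      finally show ?thesis using 3 by simp
    qed
  qed
  then have "(\<Sum>u\<in>V. \<Sum>v\<in>V. A u v * cover_cost ((\<Sum>w\<in>V. X u v w) + U u v)) \<le> (\<Sum>u\<in>V. \<Sum>v\<in>V.
      B u v + lo u v + 2 * ?t u v + 2 * (A u v * (?d u + ?d v)) + 2 / D * \<bar>Q u v\<bar> + 2 / D * \<bar>Q v u\<bar>)"
    by (intro sum_mono)
  also have "\<dots> = (\<Sum>u\<in>V. \<Sum>v\<in>V. B u v) + (\<Sum>u\<in>V. \<Sum>v\<in>V. lo u v) + 2 * (\<Sum>u\<in>V. \<Sum>v\<in>V. ?t u v)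
      + 2 * (\<Sum>u\<in>V. \<Sum>v\<in>V. A u v * (?d u + ?d v)) + 2 / D * (\<Sum>u\<in>V. \<Sum>v\<in>V. \<bar>Q u v\<bar>)
      + 2 / D * (\<Sum>u\<in>V. \<Sum>v\<in>V. \<bar>Q v u\<bar>)"
    by (simp only: sum.distrib sum_distrib_left)
  also have "(\<Sum>u\<in>V. \<Sum>v\<in>V. \<bar>Q v u\<bar>) = (\<Sum>u\<in>V. \<Sum>v\<in>V. \<bar>Q u v\<bar>)" by (rule sum.swap)
  also have "(\<Sum>u\<in>V. \<Sum>v\<in>V. B u v) + (\<Sum>u\<in>V. \<Sum>v\<in>V. lo u v) + 2 * (\<Sum>u\<in>V. \<Sum>v\<in>V. ?t u v)
      + 2 * (\<Sum>u\<in>V. \<Sum>v\<in>V. A u v * (?d u + ?d v)) + 2 / D * (\<Sum>u\<in>V. \<Sum>v\<in>V. \<bar>Q u v\<bar>)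
      + 2 / D * (\<Sum>u\<in>V. \<Sum>v\<in>V. \<bar>Q u v\<bar>)
    \<le> 16 * (E2 * N\<^sup>2) + 82 * (E2 * N\<^sup>2)
      + 2 * ((E2 + 36 / 5 * \<rho>0 * k\<^sup>2 / p\<^sup>2 + 11 * \<rho>0 * k\<^sup>2) * N\<^sup>2)
      + 2 * (151 / 75 * (p * N) * ((3 * \<rho>0 * k\<^sup>2 + 48 * \<rho>0 * E2) * N / p))
      + 2 / D * ((26 / 5 * \<rho>0 * k\<^sup>2 + 81 / 32 * k ^ 3 / p) * N ^ 3)
      + 2 / D * ((26 / 5 * \<rho>0 * k\<^sup>2 + 81 / 32 * k ^ 3 / p) * N ^ 3)"
  proof (intro add_mono mult_left_mono sum_B_le sum_lo_le sum_\<tau>\<alpha>_le sum_Q_le)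
    have "(\<Sum>u\<in>V. \<Sum>v\<in>V. A u v * (?d u + ?d v)) \<le> 151 / 75 * (p * N) * (\<Sum>u\<in>V. ?d u)"
      by (rule sum_arcs_vertex_le) simp
    also have "\<dots> \<le> 151 / 75 * (p * N) * ((3 * \<rho>0 * k\<^sup>2 + 48 * \<rho>0 * E2) * N / p)"
      using p N by (intro mult_left_mono sum_ah_le) auto
    finally show "(\<Sum>u\<in>V. \<Sum>v\<in>V. A u v * (?d u + ?d v))
      \<le> 151 / 75 * (p * N) * ((3 * \<rho>0 * k\<^sup>2 + 48 * \<rho>0 * E2) * N / p)" .
  qed (use D in auto)
  also have "\<dots> = ((100 + 14496 / 75 * \<rho>0) * E2 + (72 / 5 + 104 / 5) * (\<rho>0 / p\<^sup>2) * k\<^sup>2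
      + (22 + 906 / 75) * \<rho>0 * k\<^sup>2 + 81 / 8 * (k / p ^ 3) * k\<^sup>2) * N\<^sup>2"
    using p N by (simp add: D_def field_simps eval_nat_numeral)
  also have "\<dots> \<le> (11 / 20 * p * k\<^sup>2) * N\<^sup>2"
  proof (rule mult_right_mono)
    have p3: "p ^ 3 \<le> p" using p power_decreasing[of 1 3 p] by simp
    have "(100 + 14496 / 75 * \<rho>0) * E2 \<le> 102 * E2"
      using \<rho>0 \<sigma> p by (intro mult_right_mono) (auto simp: E2_def)
    also have "\<dots> = 102 / 268 * (\<sigma> * p\<^sup>2) * (p * k\<^sup>2)" by (simp add: E2_def eval_nat_numeral)
    also have "\<dots> \<le> 102 / 268 * (4 / 27 + 1 / 150) * (p * k\<^sup>2)"
    proof (intro mult_right_mono mult_left_mono)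
      \<comment> \<open>The maximum of \<open>(1 - p) * p\<^sup>2\<close> is 4/27, attained at
        \<open>p = 2 / 3\<close>; the polynomial is the difference in factored form.\<close>
      have "0 \<le> (p - 2 / 3)\<^sup>2 * (p + 1 / 3)" using p by simp
      moreover have "(p - 2 / 3)\<^sup>2 * (p + 1 / 3) = 4 / 27 - (1 - p) * p\<^sup>2"
        by (simp add: power2_eq_square field_simps)
      ultimately have "(1 - p) * p\<^sup>2 \<le> 4 / 27" by simp
      moreover have "\<rho>0 * p\<^sup>2 \<le> 1 / 150 * 1" using \<rho>0 p by (intro mult_mono) (auto simp: power_le_one)
      ultimately show "\<sigma> * p\<^sup>2 \<le> 4 / 27 + 1 / 150" by (simp add: \<sigma>_def algebra_simps)
    qed (use p in auto)
    finally have e1: "(100 + 14496 / 75 * \<rho>0) * E2 \<le> 102 / 268 * (4 / 27 + 1 / 150) * (p * k\<^sup>2)" .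
    have \<rho>p: "\<rho>0 / p\<^sup>2 = p / 150" using p by (simp add: \<rho>0_def eval_nat_numeral)
    have e2: "(72 / 5 + 104 / 5) * (\<rho>0 / p\<^sup>2) * k\<^sup>2 = (176 / 5) / 150 * (p * k\<^sup>2)" unfolding \<rho>p by simp
    have "(22 + 906 / 75) * \<rho>0 * k\<^sup>2 = (22 + 906 / 75) / 150 * (p ^ 3 * k\<^sup>2)" by (simp add: \<rho>0_def)
    also have "\<dots> \<le> (22 + 906 / 75) / 150 * (p * k\<^sup>2)" using p3 by (intro mult_left_mono mult_right_mono) auto
    finally have e3: "(22 + 906 / 75) * \<rho>0 * k\<^sup>2 \<le> (22 + 906 / 75) / 150 * (p * k\<^sup>2)" .
    have "k / p ^ 3 \<le> 3 * p ^ 3 / 4096" using k p by (simp add: field_simps power_add[symmetric])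
    also have "\<dots> \<le> 3 / 4096 * p" using p3 by simp
    finally have "81 / 8 * (k / p ^ 3) * k\<^sup>2 \<le> 81 / 8 * (3 / 4096 * p) * k\<^sup>2"
      by (intro mult_left_mono mult_right_mono) auto
    then have e4: "81 / 8 * (k / p ^ 3) * k\<^sup>2 \<le> 243 / 32768 * (p * k\<^sup>2)" by simp
    have "0 \<le> p * k\<^sup>2" using p by simp
    moreover have key: "x1 + x2 + x3 + x4 \<le> 11 / 20 * t"
      if "x1 \<le> 102 / 268 * (4 / 27 + 1 / 150) * t" "x2 = 176 / 5 / 150 * t"
        "x3 \<le> (22 + 906 / 75) / 150 * t" "x4 \<le> 243 / 32768 * t" "0 \<le> t" for x1 x2 x3 x4 t :: real
      using that by argo
    ultimately show "(100 + 14496 / 75 * \<rho>0) * E2 + (72 / 5 + 104 / 5) * (\<rho>0 / p\<^sup>2) * k\<^sup>2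
      + (22 + 906 / 75) * \<rho>0 * k\<^sup>2 + 81 / 8 * (k / p ^ 3) * k\<^sup>2 \<le> 11 / 20 * p * k\<^sup>2"
      using key[OF e1 e2 e3 e4] by (simp only: mult.assoc)
  qed simp
  finally show ?thesis by (simp add: mult_ac)
qed

end

section \<open>Vertices of exceptional degree and the complete fractional cover\<close>

lemma sum_if_subset:
  fixes f :: "'a \<Rightarrow> real"
  assumes "finite V" "S \<subseteq> V"
  shows "(\<Sum>u\<in>V. if u \<in> S then f u else 0) = (\<Sum>u\<in>S. f u)"
  using assms by (intro sum.mono_neutral_cong_right) auto

text \<open>An arc between an exceptional vertex x and an ordinary one lies in about
  \<open>p * d x\<close> triangles whose third vertex is ordinary, so each triangle with x as its
  only exceptional vertex gets weight \<open>1 / (p * d x)\<close>. On pairs of ordinary vertices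
  these triangles use up U, and the corrected weights fill the rest. The bound 20 on the weights is
  16 for the first kind plus 4 for the second.\<close>

lemma fractional_triangle_cover:
  fixes V :: "'a set" and A :: "'a \<Rightarrow> 'a \<Rightarrow> real" and p \<epsilon> :: real
  assumes finV: "finite V" "V \<noteq> {}"
    and A01: "\<And>u v. A u v = 0 \<or> A u v = 1"
    and A_sym: "\<And>u v. A u v = A v u"
    and p: "0 < p" "p \<le> 1"
    and \<epsilon>: "0 < \<epsilon>" "\<epsilon> < (p / 4) ^ 12"
    and bound: "\<And>f g. (\<And>u. \<bar>f u\<bar> \<le> 1) \<Longrightarrow> (\<And>v. \<bar>g v\<bar> \<le> 1) \<Longrightarrow>
      \<bar>\<Sum>u\<in>V. \<Sum>v\<in>V. (A u v - p) * f u * g v\<bar> \<le> 17 / 2 * \<epsilon> * (real (card V))\<^sup>2"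
  shows "\<exists>X. (\<forall>u v w. 0 \<le> X u v w \<and> X u v w \<le> 20 / (p ^ 3 * real (card V))) \<and>
    (\<forall>u v w. X u v w = X v w u) \<and>
    (\<forall>u v w. X u v w \<noteq> 0 \<longrightarrow> u \<in> V \<and> v \<in> V \<and> w \<in> V \<and> A u v = 1 \<and> A v w = 1 \<and> A w u = 1) \<and>
    (\<Sum>u\<in>V. \<Sum>v\<in>V. A u v * cover_cost (\<Sum>w\<in>V. X u v w)) \<le> 8 * \<epsilon> * p * (real (card V))\<^sup>2"
proof -
  define n where "n = real (card V)"
  define R where "R u v = A u v - p" for u v
  define K where "K = 17 / 2 * \<epsilon> * n\<^sup>2"
  define r where "r x = (\<Sum>y\<in>V. R x y)" for x
  define d where "d x = (\<Sum>y\<in>V. A x y)" for x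
  have n: "n > 0" using finV by (simp add: n_def card_gt_0_iff)
  have bR: "\<bar>\<Sum>u\<in>V. \<Sum>v\<in>V. R u v * f u * g v\<bar> \<le> K" if "\<And>u. \<bar>f u\<bar> \<le> 1" "\<And>v. \<bar>g v\<bar> \<le> 1" for f g
    using bound[OF that] by (simp add: R_def K_def n_def)
  have A_ge: "0 \<le> A u v" "A u v \<le> 1" for u v using A01[of u v] by auto
  have d_r: "d x = p * n + r x" for x by (simp add: d_def r_def R_def sum_subtractf n_def)
  have \<epsilon>p: "\<epsilon> \<le> p ^ 12 / 16777216" using \<epsilon>(2) by (simp add: power_divide)
  have row: "(\<Sum>u\<in>V. \<bar>\<Sum>v\<in>V. R u v * g v\<bar>) \<le> K" if "\<And>v. v \<in> V \<Longrightarrow> \<bar>g v\<bar> \<le> 1" for g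
    using sum_abs_row_le[where V = V and R = R and K = K and g = g and c = 1, OF bR that] by simp
  have sum_r: "(\<Sum>x\<in>V. \<bar>r x\<bar>) \<le> K" using row[of "\<lambda>_. 1"] by (simp add: r_def)
  \<comment> \<open>The vertices of exceptional degree; the edges at those in \<open>Lo\<close> are so few that they are given up.\<close>
  define Z where "Z = {x \<in> V. \<bar>r x\<bar> > p ^ 4 * n / 160}"
  define Lo where "Lo = {x \<in> V. d x < p\<^sup>2 * n / 16}"
  define Z' where "Z' = Z - Lo"
  define V' where "V' = V - Z"
  have sub: "Z \<subseteq> V" "Lo \<subseteq> V" "Z' \<subseteq> V" "V' \<subseteq> V" by (auto simp: Z_def Lo_def Z'_def V'_def)
  have fin: "finite Z" "finite Lo" "finite Z'" "finite V'" using sub finV finite_subset by blast+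
  have pw: "p ^ i \<le> 1" for i using p by (simp add: power_le_one)
  have Lo_r: "15 / 16 * p * n \<le> \<bar>r x\<bar>" if "x \<in> Lo" for x
  proof -
    have "p\<^sup>2 * n \<le> p * n" using p n by (simp add: power2_eq_square mult_left_le)
    then show ?thesis using that unfolding Lo_def d_r by auto
  qed
  have Lo_Z: "Lo \<subseteq> Z"
  proof
    fix x assume x: "x \<in> Lo"
    have "p ^ 4 * n \<le> p * n" using p n power_decreasing[of 1 4 p] by (intro mult_right_mono) auto
    moreover have "0 < p * n" using p n by simp
    ultimately show "x \<in> Z" using Lo_r[OF x] x unfolding Z_def Lo_def by auto
  qed
  have count: "real (card S) * c \<le> K" if "S \<subseteq> V" "\<And>x. x \<in> S \<Longrightarrow> c \<le> \<bar>r x\<bar>" for S c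
  proof -
    have "real (card S) * c = (\<Sum>x\<in>S. c)" by simp
    also have "\<dots> \<le> (\<Sum>x\<in>S. \<bar>r x\<bar>)" by (intro sum_mono that)
    also have "\<dots> \<le> (\<Sum>x\<in>V. \<bar>r x\<bar>)" using finV that by (intro sum_mono2) auto
    finally show ?thesis using sum_r by simp
  qed
  define z where "z = real (card Z)"
  have z: "0 \<le> z" "z \<le> 1360 * \<epsilon> / p ^ 4 * n"
  proof -
    have "z * (p ^ 4 * n / 160) \<le> K" unfolding z_def by (rule count) (auto simp: Z_def)
    then show "z \<le> 1360 * \<epsilon> / p ^ 4 * n"
      using p n by (simp add: K_def field_simps power2_eq_square)
  qed (simp add: z_def)
  have z_small: "z \<le> p ^ 8 * n / 12000"
  proof -
    have "1360 * \<epsilon> / p ^ 4 * n \<le> 1360 * (p ^ 12 / 16777216) / p ^ 4 * n"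
      using \<epsilon>p p n by (intro mult_right_mono divide_right_mono mult_left_mono) auto
    also have "\<dots> = p ^ 8 * n * (1360 / 16777216)" using p by (simp add: field_simps power_add[symmetric])
    also have "\<dots> \<le> p ^ 8 * n * (1 / 12000)" using p n by (intro mult_left_mono) auto
    finally show ?thesis using z(2) by simp
  qed
  have lo: "real (card Lo) * (15 / 16 * p * n) \<le> K" by (rule count[OF sub(2) Lo_r])
  define N where "N = real (card V')"
  have N_eq: "N = n - z"
    using card_Diff_subset[OF fin(1) sub(1)] card_mono[OF finV(1) sub(1)]
    by (simp add: N_def V'_def n_def z_def of_nat_diff)
  have N_ge: "(1 - 1 / 12000) * n \<le> N"
  proof -
    have "p ^ 8 * n \<le> 1 * n" using pw n by (intro mult_right_mono) auto
    then show ?thesis using z_small unfolding N_eq by (simp add: field_simps)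
  qed
  have N: "0 < N" "N \<le> n" using N_ge n z by (auto simp: N_eq)
  have V'_ne: "V' \<noteq> {}" using N(1) by (auto simp: N_def)
  have d_ge: "p\<^sup>2 * n / 16 \<le> d x" if "x \<in> Z'" for x
    using that by (auto simp: Z'_def Z_def Lo_def)
  have d_pos: "0 < d x" if "x \<in> Z'" for x
  proof -
    have "0 < p\<^sup>2 * n / 16" using p n by simp
    then show ?thesis using d_ge[OF that] by linarith
  qed
  have inv_d: "1 / (p * d x) \<le> 16 / (p ^ 3 * n)" if "x \<in> Z'" for x
  proof -
    have "p * (p\<^sup>2 * n / 16) \<le> p * d x" using d_ge[OF that] p by (intro mult_left_mono) auto
    then have "1 / (p * d x) \<le> 1 / (p * (p\<^sup>2 * n / 16))" using p n d_pos[OF that] by (intro divide_left_mono) auto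
    then show ?thesis by (simp add: power3_eq_cube power2_eq_square mult.assoc)
  qed
  define y where "y x b c = (if x \<in> Z' \<and> b \<in> V' \<and> c \<in> V' then 1 / (p * d x) else 0)" for x b c
  have y_ge: "0 \<le> y x b c" for x b c using d_pos p by (auto simp: y_def intro!: less_imp_le)
  have Z'_V': "x \<notin> V'" if "x \<in> Z'" for x using that by (auto simp: Z'_def V'_def)
  define U where "U u v = (\<Sum>x\<in>Z'. A x u * A x v / (p * d x))" for u v
  have U0: "0 \<le> A x u * A x v / (p * d x)" "A x u * A x v / (p * d x) \<le> 16 / (p ^ 3 * n)" if "x \<in> Z'" for x u v
  proof -
    show "0 \<le> A x u * A x v / (p * d x)" using d_pos[OF that] p A_ge by auto
    have "A x u * A x v \<le> 1 * 1" using A_ge by (intro mult_mono) auto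
    then have "A x u * A x v / (p * d x) \<le> 1 / (p * d x)"
      using d_pos[OF that] p by (intro divide_right_mono) auto
    then show "A x u * A x v / (p * d x) \<le> 16 / (p ^ 3 * n)" using inv_d[OF that] by linarith
  qed
  have U_le: "U u v \<le> p ^ 5 / 750" for u v
  proof -
    have "U u v \<le> (\<Sum>x\<in>Z'. 16 / (p ^ 3 * n))" unfolding U_def by (intro sum_mono U0)
    also have "\<dots> \<le> z * (16 / (p ^ 3 * n))"
      using card_mono[OF fin(1), of Z'] p n by (simp add: z_def Z'_def mult_right_mono divide_right_mono)
    also have "\<dots> \<le> (p ^ 8 * n / 12000) * (16 / (p ^ 3 * n))"
      using z_small p n by (intro mult_right_mono) auto
    also have "\<dots> = p ^ 5 / 750" using p n by (simp add: field_simps power_add[symmetric])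
    finally show ?thesis .
  qed
  have sqrt_\<epsilon>: "sqrt \<epsilon> \<le> (p / 4) ^ 6"
  proof -
    have "(p / 4) ^ 12 = ((p / 4) ^ 6)\<^sup>2" by (simp add: power_mult[symmetric])
    then show ?thesis using \<epsilon> p by (intro real_le_lsqrt) auto
  qed
  interpret T: triangle_weights V' A p "3 * sqrt \<epsilon>" U
  proof
    show "finite V'" "V' \<noteq> {}" by (fact fin V'_ne)+
    show "A u v = 0 \<or> A u v = 1" "A u v = A v u" for u v by (fact A01 A_sym)+
    show "0 < p" "p \<le> 1" by (fact p)+
    show "0 < 3 * sqrt \<epsilon>" using \<epsilon> by simp
    show "3 * sqrt \<epsilon> \<le> 3 * p ^ 6 / 4096" using sqrt_\<epsilon> by (simp add: power_divide)
    show "\<bar>\<Sum>u\<in>V'. \<Sum>v\<in>V'. (A u v - p) * f u * g v\<bar> \<le> (3 * sqrt \<epsilon>)\<^sup>2 * (real (card V'))\<^sup>2"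
      if fg: "\<And>u. \<bar>f u\<bar> \<le> 1" "\<And>v. \<bar>g v\<bar> \<le> 1" for f g
    proof -
      let ?f = "\<lambda>u. if u \<in> V' then f u else 0" and ?g = "\<lambda>v. if v \<in> V' then g v else 0"
      have "(\<Sum>u\<in>V'. \<Sum>v\<in>V'. (A u v - p) * f u * g v) = (\<Sum>u\<in>V'. \<Sum>v\<in>V. R u v * ?f u * ?g v)"
        using finV sub by (intro sum.cong refl sum.mono_neutral_cong_left) (auto simp: R_def)
      also have "\<dots> = (\<Sum>u\<in>V. \<Sum>v\<in>V. R u v * ?f u * ?g v)"
        using finV sub by (intro sum.mono_neutral_left) auto
      also have "\<bar>\<dots>\<bar> \<le> K" using fg by (intro bR) auto
      \<comment> \<open>Passing from \<open>17 / 2\<close> to 9 pays for the removed vertices and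
        makes the constant the square of \<open>3 * sqrt \<epsilon>\<close> divided by
        \<epsilon>.\<close>
      also have "K \<le> 9 * \<epsilon> * N\<^sup>2"
      proof -
        have "((1 - 1 / 12000) * n)\<^sup>2 \<le> N\<^sup>2" using N_ge n by (intro power_mono) auto
        moreover have "17 / 18 * n\<^sup>2 \<le> (1 - 1 / 12000)\<^sup>2 * n\<^sup>2"
          by (intro mult_right_mono) (auto simp: power2_eq_square)
        ultimately have "17 / 18 * n\<^sup>2 \<le> N\<^sup>2" unfolding power_mult_distrib by linarith
        then have "9 * \<epsilon> * (17 / 18 * n\<^sup>2) \<le> 9 * \<epsilon> * N\<^sup>2" using \<epsilon> by (intro mult_left_mono) auto
        then show ?thesis by (simp add: K_def)
      qed
      finally show ?thesis using \<epsilon> by (simp add: power_mult_distrib N_def)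
    qed
    \<comment> \<open>Removing Z changes a row sum by at most z; the threshold was set with 160
      instead of 150 to leave room for this.\<close>
    show "\<bar>\<Sum>v\<in>V'. A u v - p\<bar> \<le> p ^ 3 / 150 * p * real (card V')" if u: "u \<in> V'" for u
    proof -
      have "r u = (\<Sum>v\<in>V'. A u v - p) + (\<Sum>v\<in>Z. R u v)"
        unfolding r_def V'_def using finV sub by (subst sum.subset_diff[of Z V]) (auto simp: R_def)
      moreover have "\<bar>\<Sum>v\<in>Z. R u v\<bar> \<le> (\<Sum>v\<in>Z. 1)"
      proof (rule order_trans[OF sum_abs sum_mono])
        fix v show "\<bar>R u v\<bar> \<le> 1" using A01[of u v] p by (auto simp: R_def)
      qed
      moreover have "\<bar>r u\<bar> \<le> p ^ 4 * n / 160" using u by (auto simp: V'_def Z_def)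
      moreover have "p ^ 8 * n \<le> p ^ 4 * n" using p n power_decreasing[of 4 8 p] by (intro mult_right_mono) auto
      moreover have "p ^ 4 * ((1 - 1 / 12000) * n) \<le> p ^ 4 * N" using N_ge p by (intro mult_left_mono) auto
      moreover have "0 \<le> p ^ 4 * n" using p n by simp
      moreover have "\<bar>s\<bar> \<le> b / 150" if "r = s + t" "\<bar>t\<bar> \<le> z" "\<bar>r\<bar> \<le> P / 160" "Q \<le> P"
        "P * (1 - 1 / 12000) \<le> b" "0 \<le> P" "z \<le> Q / 12000" for r s t z P Q b :: real
        using that by argo
      ultimately have "\<bar>\<Sum>v\<in>V'. A u v - p\<bar> \<le> p ^ 4 * N / 150"
        using z_small unfolding z_def by (simp add: mult_ac)
      also have "\<dots> = p ^ 3 / 150 * p * real (card V')" by (simp add: N_def eval_nat_numeral)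
      finally show ?thesis .
    qed
    show "U u v = U v u" for u v by (simp add: U_def mult.commute)
    show "0 \<le> U u v" for u v unfolding U_def by (intro sum_nonneg U0)
    show "U u v \<le> p ^ 5 / 750" for u v by (rule U_le)
  qed
  have T_N: "T.N = N" by (simp add: T.N_def N_def)
  define X1 where "X1 u v w = A u v * A v w * A w u * (y u v w + y v w u + y w u v)" for u v w
  define X2 where "X2 u v w = (if u \<in> V' \<and> v \<in> V' \<and> w \<in> V' then T.X u v w else 0)" for u v w
  define X where "X u v w = X1 u v w + X2 u v w" for u v w
  have X1_ge: "0 \<le> X1 u v w" for u v w
    unfolding X1_def using A_ge y_ge by (intro mult_nonneg_nonneg add_nonneg_nonneg) auto
  have X2_ge: "0 \<le> X2 u v w" for u v w using T.X_bounds(1) by (auto simp: X2_def)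
  have y_sum: "y u v w + y v w u + y w u v \<le> 16 / (p ^ 3 * n)" for u v w
  proof -
    have "0 \<le> 16 / (p ^ 3 * n)" using p n by simp
    then show ?thesis using inv_d Z'_V' by (auto simp: y_def)
  qed
  have X1_le: "X1 u v w \<le> 16 / (p ^ 3 * n)" for u v w
  proof -
    have "A u v * A v w * A w u \<le> 1" "0 \<le> A u v * A v w * A w u"
      using A01[of u v] A01[of v w] A01[of w u] by auto
    then have "X1 u v w \<le> 1 * (y u v w + y v w u + y w u v)"
      unfolding X1_def using y_ge by (intro mult_right_mono add_nonneg_nonneg) auto
    then show ?thesis using y_sum[of u v w] by simp
  qed
  have X2_le: "X2 u v w \<le> 4 / (p ^ 3 * n)" for u v w
  proof -
    have "2 / T.D \<le> 4 / (p ^ 3 * n)"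
    proof -
      have "p ^ 3 \<le> p\<^sup>2" using p by (intro power_decreasing) auto
      then have "p ^ 3 * n \<le> p\<^sup>2 * (2 * N)" using N_ge n p by (intro mult_mono) auto
      then have "4 / (p\<^sup>2 * (2 * N)) \<le> 4 / (p ^ 3 * n)" using p n N by (intro divide_left_mono) auto
      then show ?thesis by (simp add: T.D_def T_N mult.commute)
    qed
    moreover have "0 \<le> 4 / (p ^ 3 * n)" using p n by simp
    ultimately show ?thesis using T.X_bounds(2)[of u v w] by (auto simp: X2_def)
  qed
  have X1_cyc: "X1 u v w = X1 v w u" for u v w by (simp add: X1_def algebra_simps)
  have X2_cyc: "X2 u v w = X2 v w u" for u v w using T.X_cyclic[of u v w] by (auto simp: X2_def)
  have X_supp: "u \<in> V \<and> v \<in> V \<and> w \<in> V \<and> A u v = 1 \<and> A v w = 1 \<and> A w u = 1" if "X u v w \<noteq> 0" for u v w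
  proof (cases "X1 u v w = 0")
    case False
    then have "A u v = 1" "A v w = 1" "A w u = 1" using A01[of u v] A01[of v w] A01[of w u] by (auto simp: X1_def)
    moreover have "y u v w + y v w u + y w u v \<noteq> 0" using False by (auto simp: X1_def)
    then have "u \<in> V \<and> v \<in> V \<and> w \<in> V" using sub by (auto simp: y_def split: if_splits)
    ultimately show ?thesis by simp
  next
    case True
    then have "X2 u v w \<noteq> 0" using that by (simp add: X_def)
    then have V'w: "u \<in> V'" "v \<in> V'" "w \<in> V'" and "T.X u v w \<noteq> 0" by (auto simp: X2_def split: if_splits)
    then have "T.G u v \<noteq> 0" "T.G v w \<noteq> 0" "T.G u w \<noteq> 0" by (auto simp: T.X_def)
    then have "A u v = 1" "A v w = 1" "A w u = 1"
      using T.G_cases[of u v] T.G_cases[of v w] T.G_cases[of u w] A_sym[of w u] by auto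
    then show ?thesis using V'w sub by auto
  qed
  define W where "W u v = (\<Sum>w\<in>V. X u v w)" for u v
  have W_inner: "A u v * cover_cost (W u v) = A u v * cover_cost ((\<Sum>w\<in>V'. T.X u v w) + U u v)"
    if V: "u \<in> V'" "v \<in> V'" for u v
  proof (cases "A u v = 1")
    case True
    have "(\<Sum>w\<in>V. X1 u v w) = (\<Sum>w\<in>V. if w \<in> Z' then A w u * A w v / (p * d w) else 0)"
    proof (rule sum.cong[OF refl])
      fix w
      have "y u v w = 0" "y v w u = 0" using V Z'_V' by (auto simp: y_def)
      moreover have "y w u v = (if w \<in> Z' then 1 / (p * d w) else 0)" using V by (simp add: y_def)
      ultimately show "X1 u v w = (if w \<in> Z' then A w u * A w v / (p * d w) else 0)"
        using True by (simp add: X1_def A_sym[of v w])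
    qed
    also have "\<dots> = U u v" unfolding U_def by (rule sum_if_subset[OF finV(1) sub(3)])
    finally have "(\<Sum>w\<in>V. X1 u v w) = U u v" .
    moreover have "(\<Sum>w\<in>V. X2 u v w) = (\<Sum>w\<in>V'. T.X u v w)"
      unfolding X2_def using V finV(1) sub(4) by (intro sum.mono_neutral_cong_right) auto
    ultimately show ?thesis by (simp add: W_def X_def sum.distrib add.commute)
  next
    case False
    then show ?thesis using A01[of u v] by simp
  qed
  have W_zero: "W u v = 0" if "u \<in> Lo \<or> v \<in> Lo \<or> (u \<in> Z \<and> v \<in> Z)" for u v
  proof -
    have "X1 u v w = 0" "X2 u v w = 0" for w
      using that Lo_Z by (auto simp: X1_def X2_def y_def Z'_def V'_def)
    then show ?thesis by (simp add: W_def X_def)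
  qed
  \<comment> \<open>Relative error of the number of common ordinary neighbours of x and v against
    the expected \<open>p * d x\<close>.\<close>
  define e where "e x v = (\<Sum>w\<in>V'. A x w * A v w) / (p * d x) - 1" for x v
  have W_mixed: "W x v = 1 + e x v" "W v x = 1 + e x v" if x: "x \<in> Z'" and v: "v \<in> V'" and a: "A x v = 1" for x v
  proof -
    have "(\<Sum>w\<in>V'. A x w * A v w) / (p * d x) = (\<Sum>w\<in>V. if w \<in> V' then A x w * A v w / (p * d x) else 0)"
      unfolding sum_divide_distrib by (rule sum_if_subset[OF finV(1) sub(4), symmetric])
    also have "\<dots> = W x v" unfolding W_def
    proof (rule sum.cong[OF refl])
      fix w
      have "y v w x = 0" "y w x v = 0" using x v Z'_V' by (auto simp: y_def)
      moreover have "X2 x v w = 0" using Z'_V'[OF x] by (simp add: X2_def)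
      moreover have "y x v w = (if w \<in> V' then 1 / (p * d x) else 0)" using x v by (simp add: y_def)
      ultimately show "(if w \<in> V' then A x w * A v w / (p * d x) else 0) = X x v w"
        using a by (simp add: X_def X1_def A_sym[of w x] mult.commute)
    qed
    finally show "W x v = 1 + e x v" by (simp add: e_def)
    have "X v x w = X x v w" for w
    proof -
      have "X1 v x w = X1 x v w" by (simp add: X1_def A_sym[of v x] A_sym[of x w] A_sym[of w v] y_def conj_commute)
      moreover have "X2 v x w = 0" "X2 x v w = 0" using Z'_V'[OF x] by (auto simp: X2_def)
      ultimately show ?thesis by (simp add: X_def)
    qed
    then have "W v x = W x v" by (simp add: W_def)
    then show "W v x = 1 + e x v" using \<open>W x v = 1 + e x v\<close> by simp
  qed
  \<comment> \<open>The neighbourhood of x serves as a test function, so the common neighbours are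
    right on average over v; those in Z are missing and cost at most z per arc.\<close>
  have sum_e: "(\<Sum>v\<in>V'. A x v * \<bar>e x v\<bar>) \<le> 136 * \<epsilon> * n / p ^ 3 + z / p" if x: "x \<in> Z'" for x
  proof -
    have pd: "0 < p * d x" using d_pos[OF x] p by simp
    have "A x v * \<bar>e x v\<bar> \<le> (\<bar>\<Sum>w\<in>V. R v w * A x w\<bar> + A x v * z) / (p * d x)" for v
    proof -
      have "(\<Sum>w\<in>V'. A x w * A v w) = (\<Sum>w\<in>V. A x w * A v w) - (\<Sum>w\<in>Z. A x w * A v w)"
        unfolding V'_def using finV sub by (simp add: sum_diff)
      also have "(\<Sum>w\<in>V. A x w * A v w) = (\<Sum>w\<in>V. R v w * A x w) + p * d x"
        by (simp add: d_def R_def sum_distrib_left sum.distrib[symmetric] algebra_simps)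
      moreover have "s / q - 1 = (a - b) / q" if "s = a + q - b" "q > 0" for s a b q :: real
        using that by (simp add: field_simps)
      ultimately have "e x v = ((\<Sum>w\<in>V. R v w * A x w) - (\<Sum>w\<in>Z. A x w * A v w)) / (p * d x)"
        unfolding e_def using pd by simp
      moreover have "0 \<le> (\<Sum>w\<in>Z. A x w * A v w)" "(\<Sum>w\<in>Z. A x w * A v w) \<le> z"
      proof -
        show "0 \<le> (\<Sum>w\<in>Z. A x w * A v w)" using A_ge by (intro sum_nonneg) auto
        have "(\<Sum>w\<in>Z. A x w * A v w) \<le> (\<Sum>w\<in>Z. 1 * 1)" using A_ge by (intro sum_mono mult_mono) auto
        then show "(\<Sum>w\<in>Z. A x w * A v w) \<le> z" by (simp add: z_def)
      qed
      ultimately have "\<bar>e x v\<bar> \<le> (\<bar>\<Sum>w\<in>V. R v w * A x w\<bar> + z) / (p * d x)"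
        using pd by (simp add: divide_right_mono)
      moreover have "0 \<le> \<bar>\<Sum>w\<in>V. R v w * A x w\<bar> / (p * d x)" using pd by simp
      ultimately show ?thesis using A01[of x v] pd by (auto simp: add_divide_distrib)
    qed
    then have "(\<Sum>v\<in>V'. A x v * \<bar>e x v\<bar>) \<le> (\<Sum>v\<in>V'. (\<bar>\<Sum>w\<in>V. R v w * A x w\<bar> + A x v * z) / (p * d x))"
      by (intro sum_mono)
    also have "\<dots> \<le> (\<Sum>v\<in>V. (\<bar>\<Sum>w\<in>V. R v w * A x w\<bar> + A x v * z) / (p * d x))"
      using finV sub pd A_ge z(1) by (intro sum_mono2) auto
    also have "\<dots> = ((\<Sum>v\<in>V. \<bar>\<Sum>w\<in>V. R v w * A x w\<bar>) + d x * z) / (p * d x)"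
      by (simp add: sum_divide_distrib[symmetric] sum.distrib d_def sum_distrib_right)
    also have "\<dots> \<le> (K + d x * z) / (p * d x)"
      using pd row[of "A x"] A_ge by (intro divide_right_mono add_right_mono) auto
    also have "\<dots> = K * (1 / (p * d x)) + z / p" using d_pos[OF x] p by (simp add: field_simps)
    also have "\<dots> \<le> K * (16 / (p ^ 3 * n)) + z / p"
      using inv_d[OF x] \<epsilon> n by (intro add_right_mono mult_left_mono) (auto simp: K_def)
    also have "\<dots> = 136 * \<epsilon> * n / p ^ 3 + z / p" using p n by (simp add: K_def field_simps power2_eq_square)
    finally show ?thesis .
  qed
  \<comment> \<open>Each arc is charged to one reason: both ends ordinary; an end in
    \<open>Lo\<close>, given up; both ends in Z, at most \<open>z\<^sup>2\<close> arcs; exactly one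
    end in Z', where e measures the error in either direction.\<close>
  have pt: "A u v * cover_cost (W u v) \<le>
      (if u \<in> V' then if v \<in> V' then A u v * cover_cost ((\<Sum>w\<in>V'. T.X u v w) + U u v) else 0 else 0)
      + (if u \<in> Lo then A u v else 0) + (if v \<in> Lo then A u v else 0)
      + (if u \<in> Z then if v \<in> Z then 1 else 0 else 0)
      + (if u \<in> Z' then if v \<in> V' then 2 * (A u v * \<bar>e u v\<bar>) else 0 else 0)
      + (if v \<in> Z' then if u \<in> V' then 2 * (A v u * \<bar>e v u\<bar>) else 0 else 0)"
    if V: "u \<in> V" "v \<in> V" for u v
  proof -
    have cost0: "A u v * cover_cost (W u v) \<le> A u v" if "W u v = 0" using that A_ge by (simp add: cover_cost_def)
    have nn: "0 \<le> A u v" "A u v \<le> 1" "0 \<le> A u v * \<bar>e u v\<bar>" "0 \<le> A v u * \<bar>e v u\<bar>" using A_ge by auto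
    let ?t1 = "if u \<in> V' then if v \<in> V' then A u v * cover_cost ((\<Sum>w\<in>V'. T.X u v w) + U u v) else 0 else 0"
    let ?t2 = "if u \<in> Lo then A u v else 0" and ?t3 = "if v \<in> Lo then A u v else 0"
    let ?t4 = "if u \<in> Z then if v \<in> Z then 1 else 0 else (0 :: real)"
    let ?t5 = "if u \<in> Z' then if v \<in> V' then 2 * (A u v * \<bar>e u v\<bar>) else 0 else 0"
    let ?t6 = "if v \<in> Z' then if u \<in> V' then 2 * (A v u * \<bar>e v u\<bar>) else 0 else 0"
    have t2: "0 \<le> ?t2" and t3: "0 \<le> ?t3" and t4: "0 \<le> ?t4" and t5: "0 \<le> ?t5" and t6: "0 \<le> ?t6"
      using nn by simp_all
    consider "u \<in> V'" "v \<in> V'" | "u \<in> Lo \<or> v \<in> Lo" | "u \<in> Z'" "v \<in> Z'" | "u \<in> Z'" "v \<in> V'" | "u \<in> V'" "v \<in> Z'"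
      using V by (auto simp: V'_def Z'_def)
    then show ?thesis
    proof cases
      case 1
      then have "u \<notin> Lo" "v \<notin> Lo" "u \<notin> Z" "u \<notin> Z'" "v \<notin> Z'" using Lo_Z by (auto simp: V'_def Z'_def)
      then show ?thesis using 1 by (simp add: W_inner[OF 1])
    next
      case 2
      then have "?t1 = 0" using Lo_Z by (auto simp: V'_def)
      moreover have "A u v \<le> ?t2 + ?t3" using 2 nn by auto
      moreover have "A u v * cover_cost (W u v) \<le> A u v" using 2 W_zero[of u v] by (intro cost0) auto
      ultimately show ?thesis using t4 t5 t6 by linarith
    next
      case 3
      then have Z: "u \<in> Z" "v \<in> Z" "u \<notin> V'" "v \<notin> V'" by (auto simp: V'_def Z'_def)
      then have "A u v * cover_cost (W u v) \<le> A u v" using W_zero[of u v] by (intro cost0) auto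
      moreover have "?t1 = 0" "?t4 = 1" using Z by auto
      ultimately show ?thesis using nn(2) t2 t3 t5 t6 by linarith
    next
      case 4
      have "A u v * cover_cost (W u v) \<le> 2 * (A u v * \<bar>e u v\<bar>)"
      proof (cases "A u v = 1")
        case True
        then show ?thesis using W_mixed(1)[OF 4 True] cover_cost_le[of 0 "e u v"] by simp
      qed (use A01[of u v] in auto)
      moreover have "u \<notin> V'" "v \<notin> Z'" "v \<notin> Z" "v \<notin> Lo" "u \<notin> Lo" using 4 Lo_Z by (auto simp: V'_def Z'_def)
      ultimately show ?thesis using 4 by simp
    next
      case 5
      have "A u v * cover_cost (W u v) \<le> 2 * (A v u * \<bar>e v u\<bar>)"
      proof (cases "A v u = 1")
        case True
        then show ?thesis using W_mixed(2)[OF 5(2,1) True] cover_cost_le[of 0 "e v u"] A_sym[of u v] by simp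
      qed (use A01[of v u] A_sym[of u v] in auto)
      moreover have "v \<notin> V'" "u \<notin> Z'" "u \<notin> Z" "v \<notin> Lo" "u \<notin> Lo" using 5 Lo_Z by (auto simp: V'_def Z'_def)
      ultimately show ?thesis using 5 by simp
    qed
  qed
  define E where "E = (\<Sum>x\<in>Z'. \<Sum>v\<in>V'. 2 * (A x v * \<bar>e x v\<bar>))"
  define Q where "Q = (\<Sum>x\<in>Lo. d x)"
  have "(\<Sum>u\<in>V. \<Sum>v\<in>V. A u v * cover_cost (W u v)) \<le> (\<Sum>u\<in>V. \<Sum>v\<in>V.
      (if u \<in> V' then if v \<in> V' then A u v * cover_cost ((\<Sum>w\<in>V'. T.X u v w) + U u v) else 0 else 0)
      + (if u \<in> Lo then A u v else 0) + (if v \<in> Lo then A u v else 0)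
      + (if u \<in> Z then if v \<in> Z then 1 else 0 else 0)
      + (if u \<in> Z' then if v \<in> V' then 2 * (A u v * \<bar>e u v\<bar>) else 0 else 0)
      + (if v \<in> Z' then if u \<in> V' then 2 * (A v u * \<bar>e v u\<bar>) else 0 else 0))"
    by (intro sum_mono pt)
  also have "\<dots> = (\<Sum>u\<in>V'. \<Sum>v\<in>V'. A u v * cover_cost ((\<Sum>w\<in>V'. T.X u v w) + U u v)) + Q + Q + z\<^sup>2 + E + E"
  proof -
    have push: "(\<Sum>v\<in>V. if u \<in> S then g v else 0) = (if u \<in> S then (\<Sum>v\<in>V. g v) else 0)"
      for u :: 'a and S and g :: "'a \<Rightarrow> real" by simp
    have dbl: "(\<Sum>u\<in>V. \<Sum>v\<in>V. if u \<in> S then if v \<in> S' then g u v else 0 else 0) = (\<Sum>u\<in>S. \<Sum>v\<in>S'. g u v)"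
      if "S \<subseteq> V" "S' \<subseteq> V" for S S' and g :: "'a \<Rightarrow> 'a \<Rightarrow> real"
      unfolding push sum_if_subset[OF finV(1) that(2)] by (rule sum_if_subset[OF finV(1) that(1)])
    have Q1: "(\<Sum>u\<in>V. \<Sum>v\<in>V. if u \<in> Lo then A u v else 0) = Q"
      unfolding push Q_def d_def by (rule sum_if_subset[OF finV(1) sub(2)])
    have "(\<Sum>u\<in>V. \<Sum>v\<in>V. if v \<in> Lo then A u v else 0) = (\<Sum>v\<in>V. \<Sum>u\<in>V. if v \<in> Lo then A v u else 0)"
      by (subst sum.swap) (intro sum.cong refl if_cong A_sym)
    then have Q2: "(\<Sum>u\<in>V. \<Sum>v\<in>V. if v \<in> Lo then A u v else 0) = Q" using Q1 by simp
    have E2: "(\<Sum>u\<in>V. \<Sum>v\<in>V. if v \<in> Z' then if u \<in> V' then 2 * (A v u * \<bar>e v u\<bar>) else 0 else 0) = E"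
      by (subst sum.swap) (simp only: dbl[OF sub(3,4)] E_def)
    have zz: "(\<Sum>u\<in>Z. \<Sum>v\<in>Z. 1) = z\<^sup>2" by (simp add: z_def power2_eq_square)
    show ?thesis
      by (simp only: sum.distrib dbl[OF sub(4,4)] dbl[OF sub(1,1)] dbl[OF sub(3,4)] Q1 Q2 E2 zz E_def[symmetric])
  qed
  also have "\<dots> \<le> 99 / 20 * (\<epsilon> * p) * n\<^sup>2 + (17 / 30 * (\<epsilon> * p) * n\<^sup>2) + (17 / 30 * (\<epsilon> * p) * n\<^sup>2)
      + 1 / 9 * (\<epsilon> * p) * n\<^sup>2 + 1 / 4 * (\<epsilon> * p) * n\<^sup>2 + 1 / 4 * (\<epsilon> * p) * n\<^sup>2"
  proof (intro add_mono)
    have sq: "(3 * sqrt \<epsilon>)\<^sup>2 = 9 * \<epsilon>" using \<epsilon> by (simp add: power_mult_distrib)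
    have "(\<Sum>u\<in>V'. \<Sum>v\<in>V'. A u v * cover_cost ((\<Sum>w\<in>V'. T.X u v w) + U u v)) \<le> 11 / 20 * p * (9 * \<epsilon>) * N\<^sup>2"
      using T.sum_cover_cost_le unfolding sq T_N .
    also have "\<dots> \<le> 11 / 20 * p * (9 * \<epsilon>) * n\<^sup>2" using p \<epsilon> N by (intro mult_left_mono power_mono) auto
    finally show "(\<Sum>u\<in>V'. \<Sum>v\<in>V'. A u v * cover_cost ((\<Sum>w\<in>V'. T.X u v w) + U u v)) \<le> 99 / 20 * (\<epsilon> * p) * n\<^sup>2"
      by (simp add: mult_ac)
    \<comment> \<open>A vertex of \<open>Lo\<close> has degree at most
      \<open>p\<^sup>2 * n / 16\<close> but deviation at least \<open>15 / 16 * p * n\<close>. The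
      ratio \<open>p / 15\<close> supplies the factor p that makes giving up its arcs
      affordable.\<close>
    have "Q \<le> (\<Sum>x\<in>Lo. p\<^sup>2 * n / 16)" unfolding Q_def by (intro sum_mono) (auto simp: Lo_def)
    also have "\<dots> = real (card Lo) * (15 / 16 * p * n) * (p / 15)" by (simp add: power2_eq_square)
    also have "\<dots> \<le> K * (p / 15)" using lo p by (intro mult_right_mono) auto
    finally show "Q \<le> 17 / 30 * (\<epsilon> * p) * n\<^sup>2" "Q \<le> 17 / 30 * (\<epsilon> * p) * n\<^sup>2"
      by (simp_all add: K_def mult_ac)
    have eps2: "\<epsilon>\<^sup>2 / p ^ 9 \<le> \<epsilon> * p / 16777216" "\<epsilon>\<^sup>2 / p ^ 8 \<le> \<epsilon> * p / 16777216"
    proof -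
      have "\<epsilon>\<^sup>2 / p ^ 9 \<le> \<epsilon> * (p ^ 12 / 16777216) / p ^ 9"
        unfolding power2_eq_square using \<epsilon> \<epsilon>p p by (intro divide_right_mono mult_left_mono) auto
      also have "\<dots> = \<epsilon> * p ^ 3 / 16777216" using p by (simp add: field_simps power_add[symmetric])
      also have "\<dots> \<le> \<epsilon> * p / 16777216"
        using \<epsilon> p power_decreasing[of 1 3 p] by (intro divide_right_mono mult_left_mono) auto
      finally show "\<epsilon>\<^sup>2 / p ^ 9 \<le> \<epsilon> * p / 16777216" .
      moreover have "\<epsilon>\<^sup>2 / p ^ 8 \<le> \<epsilon>\<^sup>2 / p ^ 9"
        using p power_decreasing[of 8 9 p] by (intro divide_left_mono) auto
      ultimately show "\<epsilon>\<^sup>2 / p ^ 8 \<le> \<epsilon> * p / 16777216" by linarith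
    qed
    have "z\<^sup>2 \<le> (1360 * \<epsilon> / p ^ 4 * n)\<^sup>2" using z by (intro power_mono) auto
    also have "\<dots> = 1849600 * (\<epsilon>\<^sup>2 / p ^ 8) * n\<^sup>2" by (simp add: power_mult_distrib power_divide power_mult[symmetric])
    also have "\<dots> \<le> 1849600 * (\<epsilon> * p / 16777216) * n\<^sup>2" using eps2 by (intro mult_left_mono mult_right_mono) auto
    also have "\<dots> = 1849600 / 16777216 * (\<epsilon> * p * n\<^sup>2)" by simp
    also have "\<dots> \<le> 1 / 9 * (\<epsilon> * p * n\<^sup>2)" using \<epsilon> p by (intro mult_right_mono) auto
    finally show "z\<^sup>2 \<le> 1 / 9 * (\<epsilon> * p) * n\<^sup>2" by (simp add: mult_ac)
    have zp: "z / p \<le> 1360 * \<epsilon> * n / p ^ 5"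
    proof -
      have "z / p \<le> (1360 * \<epsilon> / p ^ 4 * n) / p" using z p by (intro divide_right_mono) auto
      then show ?thesis by (simp add: power_Suc2[symmetric] eval_nat_numeral mult_ac)
    qed
    have p53: "136 * \<epsilon> * n / p ^ 3 \<le> 136 * \<epsilon> * n / p ^ 5"
      using p n \<epsilon> power_decreasing[of 3 5 p] by (intro divide_left_mono) auto
    have "E \<le> (\<Sum>x\<in>Z'. 2 * (136 * \<epsilon> * n / p ^ 3 + z / p))"
      unfolding E_def sum_distrib_left[symmetric] by (intro sum_mono mult_left_mono sum_e) auto
    also have "\<dots> \<le> z * (2 * (1496 * \<epsilon> * n / p ^ 5))"
    proof -
      have "2 * (136 * \<epsilon> * n / p ^ 3 + z / p) \<le> 2 * (1496 * \<epsilon> * n / p ^ 5)"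
      proof -
        have "136 * \<epsilon> * n / p ^ 5 + 1360 * \<epsilon> * n / p ^ 5 = 1496 * \<epsilon> * n / p ^ 5"
          by (simp add: add_divide_distrib[symmetric])
        then show ?thesis using zp p53 by (intro mult_left_mono) linarith+
      qed
      moreover have "real (card Z') \<le> z" using card_mono[OF fin(1), of Z'] by (simp add: z_def Z'_def)
      moreover have "0 \<le> 2 * (136 * \<epsilon> * n / p ^ 3 + z / p)" using \<epsilon> n p z by auto
      ultimately have "real (card Z') * (2 * (136 * \<epsilon> * n / p ^ 3 + z / p)) \<le> z * (2 * (1496 * \<epsilon> * n / p ^ 5))"
        using z by (intro mult_mono) auto
      then show ?thesis by simp
    qed
    also have "\<dots> \<le> (1360 * \<epsilon> / p ^ 4 * n) * (2 * (1496 * \<epsilon> * n / p ^ 5))"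
      using z \<epsilon> n p by (intro mult_right_mono) auto
    also have "\<dots> = 4069120 * (\<epsilon>\<^sup>2 / p ^ 9) * n\<^sup>2"
      using p by (simp add: field_simps power2_eq_square power_add[symmetric])
    also have "\<dots> \<le> 4069120 * (\<epsilon> * p / 16777216) * n\<^sup>2" using eps2 by (intro mult_left_mono mult_right_mono) auto
    also have "\<dots> = 4069120 / 16777216 * (\<epsilon> * p * n\<^sup>2)" by simp
    also have "\<dots> \<le> 1 / 4 * (\<epsilon> * p * n\<^sup>2)" using \<epsilon> p by (intro mult_right_mono) auto
    finally show "E \<le> 1 / 4 * (\<epsilon> * p) * n\<^sup>2" "E \<le> 1 / 4 * (\<epsilon> * p) * n\<^sup>2"
      by (simp_all add: mult_ac)
  qed
  also have "\<dots> = (99 / 20 + 17 / 15 + 1 / 9 + 1 / 2) * (\<epsilon> * p * n\<^sup>2)" by simp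
  also have "\<dots> \<le> 8 * (\<epsilon> * p * n\<^sup>2)" using \<epsilon> p by (intro mult_right_mono) auto
  finally have "(\<Sum>u\<in>V. \<Sum>v\<in>V. A u v * cover_cost (W u v)) \<le> 8 * \<epsilon> * p * n\<^sup>2" by simp
  moreover have "0 \<le> X u v w \<and> X u v w \<le> 20 / (p ^ 3 * n)" for u v w
    using X1_ge[of u v w] X2_ge[of u v w] X1_le[of u v w] X2_le[of u v w]
    by (simp add: X_def add_divide_distrib[symmetric])
  moreover have "X u v w = X v w u" for u v w using X1_cyc[of u v w] X2_cyc[of u v w] by (simp add: X_def)
  ultimately show ?thesis using X_supp unfolding n_def W_def by blast
qed

section \<open>Near-perfect matchings in linear triple systems\<close>

definition bern_weight :: "'i set \<Rightarrow> ('i \<Rightarrow> real) \<Rightarrow> 'i set \<Rightarrow> real" where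
  "bern_weight I q S = (\<Prod>i\<in>S. q i) * (\<Prod>i\<in>I - S. 1 - q i)"

definition bern_exp :: "'i set \<Rightarrow> ('i \<Rightarrow> real) \<Rightarrow> ('i set \<Rightarrow> real) \<Rightarrow> real" where
  "bern_exp I q f = (\<Sum>S\<in>Pow I. bern_weight I q S * f S)"

text \<open>Prescribing a coin sets one of its two factors to 0. The sum over all S then is the
  expansion of a product of sums \<open>?f i + ?g i\<close>, which equal 1 at every free
  coin.\<close>

lemma bern_exp_pattern:
  assumes "finite I" "A \<subseteq> I" "B \<subseteq> I" "A \<inter> B = {}"
  shows "bern_exp I q (\<lambda>S. of_bool (A \<subseteq> S \<and> B \<inter> S = {})) = (\<Prod>i\<in>A. q i) * (\<Prod>i\<in>B. 1 - q i)"
proof -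
  let ?f = "\<lambda>i. if i \<in> B then 0 else q i" and ?g = "\<lambda>i. if i \<in> A then 0 else 1 - q i"
  have "bern_weight I q S * of_bool (A \<subseteq> S \<and> B \<inter> S = {}) = (\<Prod>i\<in>S. ?f i) * (\<Prod>i\<in>I - S. ?g i)"
    if S: "S \<in> Pow I" for S
  proof (cases "A \<subseteq> S \<and> B \<inter> S = {}")
    case True
    then have "(\<Prod>i\<in>S. ?f i) = (\<Prod>i\<in>S. q i)" "(\<Prod>i\<in>I - S. ?g i) = (\<Prod>i\<in>I - S. 1 - q i)"
      by (auto intro!: prod.cong)
    with True show ?thesis by (simp add: bern_weight_def)
  next
    case False
    then consider i where "i \<in> A" "i \<notin> S" | i where "i \<in> B" "i \<in> S" by auto
    then have "(\<Prod>i\<in>S. ?f i) * (\<Prod>i\<in>I - S. ?g i) = 0"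
    proof cases
      case 1
      then have "(\<Prod>i\<in>I - S. ?g i) = 0"
        using assms by (intro prod_zero) auto
      then show ?thesis by simp
    next
      case 2
      then have "(\<Prod>i\<in>S. ?f i) = 0"
        using assms S finite_subset by (intro prod_zero) auto
      then show ?thesis by simp
    qed
    moreover have "of_bool (A \<subseteq> S \<and> B \<inter> S = {}) = (0::real)" using False by auto
    ultimately show ?thesis by (simp only: mult_zero_right)
  qed
  then have "bern_exp I q (\<lambda>S. of_bool (A \<subseteq> S \<and> B \<inter> S = {})) = (\<Prod>i\<in>I. ?f i + ?g i)"
    by (simp add: bern_exp_def prod_add[OF assms(1)])
  also have "\<dots> = (\<Prod>i\<in>A \<union> B. ?f i + ?g i)"
    using assms by (intro prod.mono_neutral_right) auto
  also have "\<dots> = (\<Prod>i\<in>A. ?f i + ?g i) * (\<Prod>i\<in>B. ?f i + ?g i)"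
    using assms by (intro prod.union_disjoint) (auto intro: finite_subset)
  also have "(\<Prod>i\<in>A. ?f i + ?g i) = (\<Prod>i\<in>A. q i)"
    using assms by (intro prod.cong) auto
  also have "(\<Prod>i\<in>B. ?f i + ?g i) = (\<Prod>i\<in>B. 1 - q i)"
    using assms by (intro prod.cong) auto
  finally show ?thesis .
qed

lemma bern_exp_const:
  assumes "finite I"
  shows "bern_exp I q (\<lambda>_. c) = c"
  using bern_exp_pattern[of I "{}" "{}" q] assms
  by (simp add: bern_exp_def sum_distrib_right[symmetric])

lemma bern_exp_add: "bern_exp I q (\<lambda>S. f S + g S) = bern_exp I q f + bern_exp I q g"
  by (simp add: bern_exp_def distrib_left sum.distrib)

lemma bern_exp_diff: "bern_exp I q (\<lambda>S. f S - g S) = bern_exp I q f - bern_exp I q g"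
  by (simp add: bern_exp_def right_diff_distrib sum_subtractf)

lemma bern_exp_cmult: "bern_exp I q (\<lambda>S. c * f S) = c * bern_exp I q f"
  by (simp add: bern_exp_def sum_distrib_left mult.left_commute)

lemma bern_exp_sum: "bern_exp I q (\<lambda>S. \<Sum>j\<in>J. f j S) = (\<Sum>j\<in>J. bern_exp I q (f j))"
  unfolding bern_exp_def sum_distrib_left by (rule sum.swap)

lemma bern_exp_mono:
  assumes "\<And>i. i \<in> I \<Longrightarrow> 0 \<le> q i \<and> q i \<le> 1" "\<And>S. S \<subseteq> I \<Longrightarrow> f S \<le> g S"
  shows "bern_exp I q f \<le> bern_exp I q g"
  unfolding bern_exp_def bern_weight_def using assms
  by (intro sum_mono mult_left_mono mult_nonneg_nonneg prod_nonneg) (auto simp: subset_iff)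

lemma bern_exp_attained:
  assumes "finite I" "\<And>i. i \<in> I \<Longrightarrow> 0 \<le> q i \<and> q i \<le> 1"
  shows "\<exists>S\<subseteq>I. f S \<le> bern_exp I q f"
proof -
  define m where "m = Min (f ` Pow I)"
  have fin: "finite (f ` Pow I)" "f ` Pow I \<noteq> {}" using assms(1) by auto
  have "m \<in> f ` Pow I" unfolding m_def using fin by (rule Min_in)
  then obtain S where S: "S \<subseteq> I" "f S = m" by auto
  have "m = bern_exp I q (\<lambda>_. m)" using assms(1) by (simp add: bern_exp_const)
  also have "\<dots> \<le> bern_exp I q f"
    using fin by (intro bern_exp_mono assms(2)) (auto simp: m_def)
  finally show ?thesis using S by auto
qed

lemma bern_exp_abs_le:
  assumes "finite I" "\<And>i. i \<in> I \<Longrightarrow> 0 \<le> q i \<and> q i \<le> 1"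
    and "bern_exp I q (\<lambda>S. (f S)\<^sup>2) \<le> \<gamma>\<^sup>2" "\<gamma> > 0"
  shows "bern_exp I q (\<lambda>S. \<bar>f S\<bar>) \<le> \<gamma>"
proof -
  have "\<bar>f S\<bar> \<le> (1 / (2 * \<gamma>)) * (f S)\<^sup>2 + \<gamma> / 2" for S
  proof -
    have "0 \<le> (\<bar>f S\<bar> - \<gamma>)\<^sup>2" by simp
    then have "2 * \<gamma> * \<bar>f S\<bar> \<le> (f S)\<^sup>2 + \<gamma>\<^sup>2" by (simp add: power2_diff mult.commute mult.left_commute)
    then show ?thesis using assms(4) by (simp add: field_simps power2_eq_square)
  qed
  then have "bern_exp I q (\<lambda>S. \<bar>f S\<bar>) \<le> bern_exp I q (\<lambda>S. (1 / (2 * \<gamma>)) * (f S)\<^sup>2 + \<gamma> / 2)"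
    by (intro bern_exp_mono assms(2))
  also have "\<dots> = (1 / (2 * \<gamma>)) * bern_exp I q (\<lambda>S. (f S)\<^sup>2) + \<gamma> / 2"
    by (simp only: bern_exp_add bern_exp_cmult bern_exp_const[OF assms(1)])
  also have "\<dots> \<le> (1 / (2 * \<gamma>)) * \<gamma>\<^sup>2 + \<gamma> / 2"
    using assms(3,4) by (intro add_mono mult_left_mono) auto
  also have "\<dots> = \<gamma>" using assms(4) by (simp add: power2_eq_square)
  finally show ?thesis .
qed

text \<open>Weierstrass's product inequality, in effect the union bound for independent
  events.\<close>

lemma one_minus_sum_le_prod:
  fixes a :: "'a \<Rightarrow> real"
  assumes "finite A" "\<And>i. i \<in> A \<Longrightarrow> 0 \<le> a i \<and> a i \<le> 1"
  shows "1 - (\<Sum>i\<in>A. a i) \<le> (\<Prod>i\<in>A. 1 - a i)"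
  using assms
proof (induction A rule: finite_induct)
  case (insert j A)
  have P: "0 \<le> (\<Prod>i\<in>A. 1 - a i)" "(\<Prod>i\<in>A. 1 - a i) \<le> 1"
    using insert.prems by (auto intro!: prod_nonneg prod_le_1)
  have "1 - a j - (\<Sum>i\<in>A. a i) \<le> (\<Prod>i\<in>A. 1 - a i) - a j * 1"
    using insert by simp
  also have "\<dots> \<le> (\<Prod>i\<in>A. 1 - a i) - a j * (\<Prod>i\<in>A. 1 - a i)"
    using P insert.prems by (intro diff_left_mono mult_left_mono) auto
  finally show ?case using insert.hyps by (simp add: algebra_simps)
qed simp

section \<open>Weighted degrees in linear triple systems\<close>

definition wdeg :: "'b set set \<Rightarrow> ('b set \<Rightarrow> real) \<Rightarrow> 'b \<Rightarrow> real" where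
  "wdeg H x e = (\<Sum>T\<in>{T \<in> H. e \<in> T}. x T)"

lemma sum_wdeg_mult:
  assumes "finite X" "\<And>T. T \<in> H \<Longrightarrow> T \<subseteq> X"
  shows "(\<Sum>e\<in>X. g e * wdeg H x e) = (\<Sum>T\<in>H. x T * (\<Sum>e\<in>T. g e))"
proof -
  have "finite H" using assms by (meson PowI finite_Pow_iff finite_subset subsetI)
  have "(\<Sum>e\<in>X. g e * wdeg H x e) = (\<Sum>e\<in>X. \<Sum>T\<in>H. if e \<in> T then g e * x T else 0)"
    unfolding wdeg_def sum_distrib_left using \<open>finite H\<close> by (simp add: sum.inter_filter)
  also have "\<dots> = (\<Sum>T\<in>H. \<Sum>e\<in>X. if e \<in> T then g e * x T else 0)" by (rule sum.swap)
  also have "\<dots> = (\<Sum>T\<in>H. x T * (\<Sum>e\<in>T. g e))"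
  proof (rule sum.cong[OF refl])
    fix T assume "T \<in> H"
    then have "{e \<in> X. e \<in> T} = T" using assms by auto
    then show "(\<Sum>e\<in>X. if e \<in> T then g e * x T else 0) = x T * (\<Sum>e\<in>T. g e)"
      using assms(1) by (simp add: sum.inter_filter[symmetric] sum_distrib_left mult.commute)
  qed
  finally show ?thesis .
qed

definition linear_triples :: "'b set \<Rightarrow> 'b set set \<Rightarrow> bool" where
  "linear_triples X H \<longleftrightarrow> finite X \<and> (\<forall>T\<in>H. T \<subseteq> X \<and> card T = 3) \<and>
     (\<forall>T\<in>H. \<forall>T'\<in>H. \<forall>e f. e \<noteq> f \<longrightarrow> {e, f} \<subseteq> T \<inter> T' \<longrightarrow> T = T')"

lemma linear_triples_finite: "linear_triples X H \<Longrightarrow> finite H"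
  unfolding linear_triples_def by (meson PowI finite_Pow_iff finite_subset subsetI)

lemma sum_wdeg_triples:
  assumes "linear_triples X H"
  shows "(\<Sum>e\<in>X. wdeg H x e) = 3 * (\<Sum>T\<in>H. x T)"
  using sum_wdeg_mult[of X H "\<lambda>_. 1" x] assms
  by (simp add: linear_triples_def sum_distrib_right[symmetric] mult.commute)

text \<open>Every overloaded point e scales the triples through it by \<open>1 / wdeg H x e\<close>,
  that is \<open>1 - c e\<close>, and the factors of the three points multiply. A triple loses at
  most its weight times the sum of its values of c, and over all triples this adds up to the total
  excess.\<close>

lemma truncate_weights:
  assumes lin: "linear_triples X H" and x: "\<And>T. T \<in> H \<Longrightarrow> 0 \<le> x T"
  shows "\<exists>y. (\<forall>T\<in>H. 0 \<le> y T \<and> y T \<le> x T) \<and> (\<forall>e\<in>X. wdeg H y e \<le> 1) \<and>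
    (\<Sum>T\<in>H. x T) - (\<Sum>e\<in>X. max 0 (wdeg H x e - 1)) \<le> (\<Sum>T\<in>H. y T)"
proof -
  have X: "finite X" "\<And>T. T \<in> H \<Longrightarrow> T \<subseteq> X" and H: "finite H"
    using lin linear_triples_finite[OF lin] by (auto simp: linear_triples_def)
  have fT: "finite T" if "T \<in> H" for T using X that finite_subset by blast
  define c where "c e = (if wdeg H x e > 1 then 1 - 1 / wdeg H x e else 0)" for e
  have c: "0 \<le> c e" "c e \<le> 1" for e
    by (auto simp: c_def field_simps)
  have cw: "c e * wdeg H x e = max 0 (wdeg H x e - 1)" for e
    by (auto simp: c_def field_simps)
  define y where "y T = x T * (\<Prod>e\<in>T. 1 - c e)" for T
  have P: "0 \<le> (\<Prod>e\<in>T. 1 - c e)" "(\<Prod>e\<in>T. 1 - c e) \<le> 1" for T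
    using c by (auto intro!: prod_nonneg prod_le_1)
  have "0 \<le> y T \<and> y T \<le> x T" if "T \<in> H" for T
    using x[OF that] P[of T] by (auto simp: y_def mult_left_le)
  moreover have "wdeg H y e \<le> 1" if "e \<in> X" for e
  proof -
    have "(\<Prod>e\<in>T. 1 - c e) \<le> 1 - c e" if "T \<in> H" "e \<in> T" for T
    proof -
      have "(\<Prod>e\<in>T. 1 - c e) = (1 - c e) * (\<Prod>e\<in>T - {e}. 1 - c e)"
        using that fT by (simp add: prod.remove)
      also have "\<dots> \<le> (1 - c e) * 1"
        using c by (intro mult_left_mono prod_le_1) auto
      finally show ?thesis by simp
    qed
    then have "wdeg H y e \<le> (\<Sum>T\<in>{T \<in> H. e \<in> T}. x T * (1 - c e))"
      unfolding wdeg_def y_def using x by (intro sum_mono mult_left_mono) auto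
    also have "\<dots> = wdeg H x e - c e * wdeg H x e"
      unfolding wdeg_def sum_distrib_right[symmetric] by (simp add: algebra_simps)
    also have "\<dots> \<le> 1" unfolding cw by auto
    finally show ?thesis .
  qed
  moreover have "(\<Sum>T\<in>H. x T) - (\<Sum>e\<in>X. max 0 (wdeg H x e - 1)) \<le> (\<Sum>T\<in>H. y T)"
  proof -
    have "(\<Sum>e\<in>X. max 0 (wdeg H x e - 1)) = (\<Sum>T\<in>H. x T * (\<Sum>e\<in>T. c e))"
      unfolding cw[symmetric] by (rule sum_wdeg_mult[OF X])
    then have "(\<Sum>T\<in>H. x T) - (\<Sum>e\<in>X. max 0 (wdeg H x e - 1)) = (\<Sum>T\<in>H. x T * (1 - (\<Sum>e\<in>T. c e)))"
      by (simp add: sum_subtractf right_diff_distrib)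
    also have "\<dots> \<le> (\<Sum>T\<in>H. y T)"
      unfolding y_def using x c fT
      by (intro sum_mono mult_left_mono one_minus_sum_le_prod) auto
    finally show ?thesis .
  qed
  ultimately show ?thesis by blast
qed

section \<open>One random bite\<close>

text \<open>A round of the Roedl nibble: a triple is selected with probability \<theta> times its
  weight, so a point of full degree is hit with probability about \<theta>. Weights below a small
  \<delta> ensure that one shared coin hardly correlates two points.\<close>

locale random_bite =
  fixes X :: "'b set" and H :: "'b set set" and x :: "'b set \<Rightarrow> real" and \<delta> \<theta> :: real
  assumes lin: "linear_triples X H"
    and x: "T \<in> H \<Longrightarrow> 0 \<le> x T" "T \<in> H \<Longrightarrow> x T \<le> \<delta>"
    and deg: "e \<in> X \<Longrightarrow> wdeg H x e \<le> 1"
    and \<theta>: "0 < \<theta>" "\<theta> \<le> 1 / 2" and \<delta>: "0 < \<delta>" "\<delta> \<le> 1"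
begin

definition "s = 1 - \<theta>"
text \<open>A lower bound for the factor that a single selection coin contributes to a survival
  probability.\<close>

definition "r = 1 - \<theta> * \<delta>"
definition "coins = (Inl ` H \<union> Inr ` X :: ('b set + 'b) set)"
definition "keep e = (\<Prod>T\<in>{T \<in> H. e \<in> T}. 1 - \<theta> * x T)"

text \<open>
  A coin \<open>Inl T\<close> selects the triple \<open>T\<close>; the coin \<open>Inr e\<close> deletes \<open>e\<close>, with the probability
  that makes every point survive with probability exactly \<open>s\<close>.
\<close>

definition "q i = (case i of Inl T \<Rightarrow> \<theta> * x T | Inr e \<Rightarrow> 1 - s / keep e)"
definition "nbr e = (Inl ` {T \<in> H. e \<in> T} \<union> {Inr e} :: ('b set + 'b) set)"
definition "surv S = {e \<in> X. nbr e \<inter> S = {}}"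
definition "pr F = (\<Prod>i\<in>(\<Union>e\<in>F. nbr e). 1 - q i)"

lemma fin: "finite X" "finite H" "finite coins"
  using lin linear_triples_finite[OF lin] by (auto simp: linear_triples_def coins_def)

lemma H: "T \<in> H \<Longrightarrow> T \<subseteq> X" "T \<in> H \<Longrightarrow> card T = 3" "T \<in> H \<Longrightarrow> finite T"
  using lin finite_subset by (auto simp: linear_triples_def)

lemma s: "1 / 2 \<le> s" "s < 1" "0 < s"
  using \<theta> by (auto simp: s_def)

lemma r: "0 < r" "r < 1"
proof -
  have "\<theta> * \<delta> \<le> 1 / 2 * 1" using \<theta> \<delta> by (intro mult_mono) auto
  then show "0 < r" by (simp add: r_def)
  show "r < 1" using \<theta> \<delta> by (simp add: r_def)
qed

lemma \<theta>x: assumes "T \<in> H" shows "0 \<le> \<theta> * x T \<and> \<theta> * x T \<le> 1 - r \<and> \<theta> * x T \<le> 1"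
proof -
  have "\<theta> * x T \<le> \<theta> * \<delta>" using x[OF assms] \<theta> by (intro mult_left_mono) auto
  moreover have "0 \<le> \<theta> * x T" using x[OF assms] \<theta> by simp
  moreover have "\<theta> * \<delta> = 1 - r" by (simp add: r_def)
  ultimately show ?thesis using r by linarith
qed

lemma keep: assumes "e \<in> X" shows "s \<le> keep e" "keep e \<le> 1"
proof -
  have "1 - \<theta> * wdeg H x e \<le> keep e"
    unfolding keep_def wdeg_def sum_distrib_left using \<theta>x fin
    by (intro one_minus_sum_le_prod) auto
  moreover have "\<theta> * wdeg H x e \<le> \<theta> * 1"
    using deg[OF assms] \<theta> by (intro mult_left_mono) auto
  ultimately show "s \<le> keep e" by (simp add: s_def)
  show "keep e \<le> 1" unfolding keep_def using \<theta>x by (intro prod_le_1) auto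
qed

lemma q01: assumes "i \<in> coins" shows "0 \<le> q i \<and> q i \<le> 1"
  using assms \<theta>x keep s by (force simp: coins_def q_def field_simps)

lemma nbr: assumes "e \<in> X" shows "nbr e \<subseteq> coins" "finite (nbr e)"
  using assms fin finite_subset by (auto simp: nbr_def coins_def)

lemma prod_nbr: assumes "e \<in> X" shows "(\<Prod>i\<in>nbr e. 1 - q i) = s"
proof -
  have "(\<Prod>i\<in>nbr e. 1 - q i) = (1 - q (Inr e)) * (\<Prod>i\<in>Inl ` {T \<in> H. e \<in> T}. 1 - q i)"
    using fin unfolding nbr_def by (subst Un_commute, subst insert_is_Un[symmetric], subst prod.insert) auto
  also have "(\<Prod>i\<in>Inl ` {T \<in> H. e \<in> T}. 1 - q i) = keep e"
    by (simp add: prod.reindex keep_def q_def)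
  finally show ?thesis using keep[OF assms] s by (simp add: q_def)
qed

lemma exp_surv:
  assumes "F \<subseteq> X"
  shows "bern_exp coins q (\<lambda>S. of_bool (F \<subseteq> surv S)) = pr F"
proof -
  have "F \<subseteq> surv S \<longleftrightarrow> {} \<subseteq> S \<and> (\<Union>e\<in>F. nbr e) \<inter> S = {}" for S
    using assms by (auto simp: surv_def)
  then have "bern_exp coins q (\<lambda>S. of_bool (F \<subseteq> surv S)) =
      bern_exp coins q (\<lambda>S. of_bool ({} \<subseteq> S \<and> (\<Union>e\<in>F. nbr e) \<inter> S = {}))"
    by (simp only:)
  also have "\<dots> = pr F"
    using assms nbr fin by (subst bern_exp_pattern) (auto simp: pr_def)
  finally show ?thesis .
qed

text \<open>The survival of f would be independent of that of F without common coins. By linearity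
  each point of F shares at most one triple with f, so there are at most \<open>card F\<close>
  common coins, and each contributes a factor of at least r.\<close>

lemma pr_insert:
  assumes F: "finite F" "F \<subseteq> X" and f: "f \<in> X" "f \<notin> F"
  obtains P where "pr (insert f F) = pr F * P" "s \<le> P" "P * r ^ card F \<le> s"
proof
  let ?U = "\<Union>e\<in>F. nbr e"
  let ?P = "\<Prod>i\<in>nbr f - ?U. 1 - q i" and ?Q = "\<Prod>i\<in>nbr f \<inter> ?U. 1 - q i"
  have U: "?U \<subseteq> coins" "finite ?U" using F nbr by auto
  have "(\<Union>e\<in>insert f F. nbr e) = ?U \<union> (nbr f - ?U)" by auto
  then show "pr (insert f F) = pr F * ?P"
    unfolding pr_def using U nbr(2)[OF f(1)]
      by (metis Diff_disjoint finite_Diff prod.union_disjoint)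
  have "?P * ?Q = (\<Prod>i\<in>(nbr f - ?U) \<union> (nbr f \<inter> ?U). 1 - q i)"
    using nbr(2)[OF f(1)] by (intro prod.union_disjoint[symmetric]) auto
  also have "(nbr f - ?U) \<union> (nbr f \<inter> ?U) = nbr f" by auto
  finally have PQ: "?P * ?Q = s" using prod_nbr[OF f(1)] by simp
  have pos: "0 \<le> 1 - q i" "1 - q i \<le> 1" if "i \<in> nbr f" for i
    using q01[of i] nbr(1)[OF f(1)] that by auto
  have P: "0 \<le> ?P" using pos by (intro prod_nonneg) auto
  have Q1: "?Q \<le> 1" using pos by (intro prod_le_1) auto
  show "s \<le> ?P" using mult_left_mono[OF Q1 P] PQ by simp
  let ?C = "\<Union>g\<in>F. {T \<in> H. f \<in> T \<and> g \<in> T}"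
  have C: "nbr f \<inter> ?U \<subseteq> Inl ` ?C" using f(2) by (auto simp: nbr_def)
  have "card {T \<in> H. f \<in> T \<and> g \<in> T} \<le> 1" if "g \<in> F" for g
  proof -
    have "f \<noteq> g" using f(2) that by auto
    then have "T = T'" if "T \<in> H" "f \<in> T" "g \<in> T" "T' \<in> H" "f \<in> T'" "g \<in> T'" for T T'
      using lin that unfolding linear_triples_def by blast
    then have "\<forall>T\<in>{T \<in> H. f \<in> T \<and> g \<in> T}. \<forall>T'\<in>{T \<in> H. f \<in> T \<and> g \<in> T}. T = T'" by blast
    then show ?thesis using fin(2) by (subst One_nat_def, subst card_le_Suc0_iff_eq) auto
  qed
  then have "card ?C \<le> (\<Sum>g\<in>F. 1)"
    by (intro order_trans[OF card_UN_le[OF F(1)]] sum_mono)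
  moreover have "card (nbr f \<inter> ?U) \<le> card (Inl ` ?C :: ('b set + 'b) set)"
    using C fin F by (intro card_mono) auto
  moreover have "card (Inl ` ?C :: ('b set + 'b) set) = card ?C" by (simp add: card_image)
  ultimately have card: "card (nbr f \<inter> ?U) \<le> card F" by simp
  have "r ^ card F \<le> r ^ card (nbr f \<inter> ?U)"
    using card r by (intro power_decreasing) auto
  also have "\<dots> = (\<Prod>i\<in>nbr f \<inter> ?U. r)" by simp
  also have "\<dots> \<le> ?Q"
  proof (intro prod_mono conjI)
    fix i assume "i \<in> nbr f \<inter> ?U"
    then obtain T where "i = Inl T" "T \<in> H" using C by blast
    then show "r \<le> 1 - q i" using \<theta>x[of T] by (simp add: q_def)
  qed (use r in auto)
  finally have "r ^ card F \<le> ?Q" .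
  then show "?P * r ^ card F \<le> s" using mult_left_mono[OF _ P] PQ by metis
qed

text \<open>Adding the points one at a time collects the exponent
  \<open>0 + 1 + ... + (card F - 1)\<close> of r, which is rounded up to a square.\<close>

lemma pr_bounds:
  assumes "finite F" "F \<subseteq> X"
  shows "s ^ card F \<le> pr F \<and> pr F * r ^ (card F)\<^sup>2 \<le> s ^ card F"
  using assms
proof (induction F rule: finite_induct)
  case empty
  show ?case by (simp add: pr_def)
next
  case (insert f F)
  then have IH: "s ^ card F \<le> pr F" "pr F * r ^ (card F)\<^sup>2 \<le> s ^ card F" by auto
  obtain P where P: "pr (insert f F) = pr F * P" "s \<le> P" "P * r ^ card F \<le> s"
    using pr_insert[of F f] insert by auto
  have pos: "0 \<le> pr F" using IH(1) s by (meson order_trans zero_le_power less_imp_le)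
  have "s ^ card F * s \<le> pr F * P" using IH P s pos by (intro mult_mono) auto
  moreover have "pr F * P * r ^ (Suc (card F))\<^sup>2 \<le> s ^ card F * s"
  proof -
    have "pr F * P * r ^ (Suc (card F))\<^sup>2 \<le> pr F * P * (r ^ (card F)\<^sup>2 * r ^ card F)"
    proof -
      have "r ^ (Suc (card F))\<^sup>2 \<le> r ^ ((card F)\<^sup>2 + card F)"
        using r by (intro power_decreasing) (auto simp: power2_eq_square)
      then show ?thesis using pos P s by (intro mult_left_mono) (auto simp: power_add)
    qed
    also have "\<dots> = (pr F * r ^ (card F)\<^sup>2) * (P * r ^ card F)" by simp
    also have "\<dots> \<le> s ^ card F * s" using IH P s r pos by (intro mult_mono) auto
    finally show ?thesis .
  qed
  ultimately show ?case using insert.hyps P(1) by (simp add: mult.commute)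
qed

text \<open>The largest set needed is the union of two triples with one common point, which has 5
  elements; hence the exponent \<open>25 = 5\<^sup>2\<close>.\<close>

lemma exp_surv_bounds:
  assumes "finite F" "F \<subseteq> X" "card F = k" "k \<le> 5"
  shows "s ^ k \<le> bern_exp coins q (\<lambda>S. of_bool (F \<subseteq> surv S))"
    and "bern_exp coins q (\<lambda>S. of_bool (F \<subseteq> surv S)) * r ^ 25 \<le> s ^ k"
proof -
  show "s ^ k \<le> bern_exp coins q (\<lambda>S. of_bool (F \<subseteq> surv S))"
    using pr_bounds[of F] assms by (simp add: exp_surv)
  have p0: "0 \<le> pr F" using pr_bounds[of F] assms s by (meson order_trans zero_le_power less_imp_le)
  have "k\<^sup>2 \<le> 5\<^sup>2" using assms by (intro power_mono) auto
  then have "pr F * r ^ 25 \<le> pr F * r ^ (card F)\<^sup>2"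
    using r p0 assms by (intro mult_left_mono power_decreasing) auto
  then show "bern_exp coins q (\<lambda>S. of_bool (F \<subseteq> surv S)) * r ^ 25 \<le> s ^ k"
    using pr_bounds[of F] assms by (auto simp: exp_surv)
qed

lemma exp_surv_one: "e \<in> X \<Longrightarrow> bern_exp coins q (\<lambda>S. of_bool (e \<in> surv S)) = s"
  using exp_surv[of "{e}"] by (simp add: pr_def prod_nbr)

definition "isolated (S :: ('b set + 'b) set) = {T \<in> H. Inl T \<in> S \<and> (\<forall>T'\<in>H. Inl T' \<in> S \<longrightarrow> T' \<noteq> T \<longrightarrow> T' \<inter> T = {})}"

lemma exp_selected:
  assumes "A \<subseteq> H"
  shows "bern_exp coins q (\<lambda>S. of_bool (Inl ` A \<subseteq> S)) = (\<Prod>T\<in>A. \<theta> * x T)"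
proof -
  have "Inl ` A \<subseteq> coins" using assms by (auto simp: coins_def)
  then have "bern_exp coins q (\<lambda>S. of_bool (Inl ` A \<subseteq> S \<and> {} \<inter> S = {})) = (\<Prod>i\<in>Inl ` A. q i)"
    using fin by (subst bern_exp_pattern) auto
  then show ?thesis by (simp add: prod.reindex q_def)
qed

text \<open>The triples meeting a given one have total weight at most 3, since its points have
  degree at most 1. By the union bound, conflicts cost only second order in \<theta>, and this is
  what makes small bites efficient.\<close>

lemma exp_isolated:
  "3 * \<theta> * (\<Sum>T\<in>H. x T) - 3 * \<theta>\<^sup>2 * card X \<le> 3 * bern_exp coins q (\<lambda>S. card (isolated S))"
proof -
  define nb where "nb T = {T' \<in> H. T' \<noteq> T \<and> T' \<inter> T \<noteq> {}}" for T
  have nb: "(\<Sum>T'\<in>nb T. x T') \<le> 3" if T: "T \<in> H" for T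
  proof -
    have "x T' \<le> (\<Sum>e\<in>T. if e \<in> T' then x T' else 0)" if T': "T' \<in> nb T" for T'
    proof -
      from T' obtain e where e: "e \<in> T" "e \<in> T'" by (auto simp: nb_def)
      have "(if e \<in> T' then x T' else 0) \<le> (\<Sum>e\<in>T. if e \<in> T' then x T' else 0)"
        using e x(1)[of T'] T' H(3)[OF T] by (intro member_le_sum) (auto simp: nb_def)
      then show ?thesis using e by simp
    qed
    then have "(\<Sum>T'\<in>nb T. x T') \<le> (\<Sum>T'\<in>nb T. \<Sum>e\<in>T. if e \<in> T' then x T' else 0)"
      by (rule sum_mono)
    also have "\<dots> \<le> (\<Sum>T'\<in>H. \<Sum>e\<in>T. if e \<in> T' then x T' else 0)"
      using fin x by (intro sum_mono2 sum_nonneg) (auto simp: nb_def)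
    also have "\<dots> = (\<Sum>e\<in>T. wdeg H x e)"
      unfolding wdeg_def by (subst sum.swap) (simp add: fin sum.inter_filter)
    also have "\<dots> \<le> (\<Sum>e\<in>T. 1)" using deg H(1)[OF T] by (intro sum_mono) auto
    finally show ?thesis using H(2)[OF T] by simp
  qed
  have ge: "of_bool (Inl ` {T} \<subseteq> S) - (\<Sum>T'\<in>nb T. of_bool (Inl ` {T, T'} \<subseteq> S))
      \<le> (of_bool (T \<in> isolated S) :: real)" if T: "T \<in> H" for T S
  proof (cases "Inl T \<in> S \<and> T \<notin> isolated S")
    case True
    then obtain T' where T': "T' \<in> nb T" "Inl T' \<in> S" using T by (auto simp: isolated_def nb_def)
    have "(of_bool (Inl ` {T, T'} \<subseteq> S) :: real) \<le> (\<Sum>T'\<in>nb T. of_bool (Inl ` {T, T'} \<subseteq> S))"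
      using T' fin by (intro member_le_sum) (auto simp: nb_def)
    then show ?thesis using True T' by simp
  next
    case False
    have "0 \<le> (\<Sum>T'\<in>nb T. of_bool (Inl ` {T, T'} \<subseteq> S) :: real)" by (intro sum_nonneg) auto
    then show ?thesis using False by (auto simp: isolated_def)
  qed
  have "bern_exp coins q (\<lambda>S. card (isolated S)) = bern_exp coins q (\<lambda>S. \<Sum>T\<in>H. of_bool (T \<in> isolated S))"
  proof -
    have "real (card (isolated S)) = (\<Sum>T\<in>H. of_bool (T \<in> isolated S))" for S
    proof -
      have "H \<inter> isolated S = isolated S" by (auto simp: isolated_def)
      then show ?thesis using fin by (simp add: of_bool_def sum.If_cases)
    qed
    then show ?thesis by (simp only:)
  qed
  also have "\<dots> \<ge> bern_exp coins q (\<lambda>S. \<Sum>T\<in>H. of_bool (Inl ` {T} \<subseteq> S) -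
      (\<Sum>T'\<in>nb T. of_bool (Inl ` {T, T'} \<subseteq> S)))"
    by (intro bern_exp_mono q01 sum_mono ge)
  moreover have "bern_exp coins q (\<lambda>S. \<Sum>T\<in>H. of_bool (Inl ` {T} \<subseteq> S) -
      (\<Sum>T'\<in>nb T. of_bool (Inl ` {T, T'} \<subseteq> S))) = (\<Sum>T\<in>H. \<theta> * x T - (\<Sum>T'\<in>nb T. \<theta> * x T * (\<theta> * x T')))"
    unfolding bern_exp_sum bern_exp_diff
  proof (intro sum.cong refl arg_cong2[where f = "(-)"])
    fix T assume T: "T \<in> H"
    show "bern_exp coins q (\<lambda>S. of_bool (Inl ` {T} \<subseteq> S)) = \<theta> * x T"
      using exp_selected[of "{T}"] T by simp
    fix T' assume T': "T' \<in> nb T"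
    then have "T \<noteq> T'" "{T, T'} \<subseteq> H" using T by (auto simp: nb_def)
    then show "bern_exp coins q (\<lambda>S. of_bool (Inl ` {T, T'} \<subseteq> S)) = \<theta> * x T * (\<theta> * x T')"
      using exp_selected[of "{T, T'}"] by simp
  qed
  moreover have "\<theta> * x T - 3 * \<theta>\<^sup>2 * x T \<le> \<theta> * x T - (\<Sum>T'\<in>nb T. \<theta> * x T * (\<theta> * x T'))" if "T \<in> H" for T
  proof -
    have "(\<Sum>T'\<in>nb T. \<theta> * x T * (\<theta> * x T')) = \<theta>\<^sup>2 * x T * (\<Sum>T'\<in>nb T. x T')"
      by (simp add: sum_distrib_left power2_eq_square mult_ac)
    also have "\<dots> \<le> \<theta>\<^sup>2 * x T * 3" using nb[OF that] x[OF that] by (intro mult_left_mono) auto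
    finally show ?thesis by simp
  qed
  then have "(\<Sum>T\<in>H. \<theta> * x T - 3 * \<theta>\<^sup>2 * x T) \<le> (\<Sum>T\<in>H. \<theta> * x T - (\<Sum>T'\<in>nb T. \<theta> * x T * (\<theta> * x T')))"
    by (rule sum_mono)
  moreover have "(\<Sum>T\<in>H. \<theta> * x T - 3 * \<theta>\<^sup>2 * x T) = \<theta> * (\<Sum>T\<in>H. x T) - 3 * \<theta>\<^sup>2 * (\<Sum>T\<in>H. x T)"
    by (simp add: sum_subtractf sum_distrib_left)
  moreover have "\<theta>\<^sup>2 * (3 * (\<Sum>T\<in>H. x T)) \<le> \<theta>\<^sup>2 * card X"
  proof -
    have "(\<Sum>e\<in>X. wdeg H x e) \<le> (\<Sum>e\<in>X. 1)" using deg by (intro sum_mono) auto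
    then show ?thesis using sum_wdeg_triples[OF lin, of x] by (intro mult_left_mono) auto
  qed
  ultimately show ?thesis by (simp add: algebra_simps)
qed


text \<open>If e survives, a triple through e survives with probability about
  \<open>s\<^sup>2\<close>; division by it keeps the expected degree of a surviving point at its old
  value.\<close>

definition "new_deg S e = (\<Sum>T\<in>{T \<in> H. e \<in> T}. x T / s\<^sup>2 * of_bool (T \<subseteq> surv S))"

text \<open>A second moment computation. Two distinct triples through e survive together with
  probability about \<open>s ^ 5\<close>, and up to the correlation factor \<open>r ^ 25\<close> the
  three terms of the square cancel. The diagonal contributes at most \<open>16 * \<delta>\<close>,
  as \<open>1 / s ^ 4 \<le> 16\<close>.\<close>

lemma exp_deviation_square:
  assumes e: "e \<in> X"
  shows "bern_exp coins q (\<lambda>S. (of_bool (e \<in> surv S) * (new_deg S e - wdeg H x e))\<^sup>2)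
    \<le> 1 / r ^ 25 - 1 + 16 * \<delta>"
proof -
  define He where "He = {T \<in> H. e \<in> T}"
  define w where "w = wdeg H x e"
  define p where "p F = bern_exp coins q (\<lambda>S. of_bool (F \<subseteq> surv S))" for F
  have He: "finite He" "\<And>T. T \<in> He \<Longrightarrow> T \<in> H" using fin by (auto simp: He_def)
  have w: "w = (\<Sum>T\<in>He. x T)" "0 \<le> w" "w \<le> 1"
    using deg[OF e] x by (auto simp: w_def wdeg_def He_def intro!: sum_nonneg)
  have w2: "w\<^sup>2 \<le> 1" using w by (simp add: power_le_one)
  have "(of_bool (e \<in> surv S) * (new_deg S e - w))\<^sup>2 =
      (\<Sum>T\<in>He. \<Sum>T'\<in>He. x T / s\<^sup>2 * (x T' / s\<^sup>2) * of_bool (T \<union> T' \<subseteq> surv S))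
      - (\<Sum>T\<in>He. 2 * w * (x T / s\<^sup>2) * of_bool (T \<subseteq> surv S)) + w\<^sup>2 * of_bool ({e} \<subseteq> surv S)" for S
  proof (cases "e \<in> surv S")
    case True
    have "(new_deg S e)\<^sup>2 = (\<Sum>T\<in>He. \<Sum>T'\<in>He. x T / s\<^sup>2 * (x T' / s\<^sup>2) * of_bool (T \<union> T' \<subseteq> surv S))"
      unfolding new_deg_def power2_eq_square He_def[symmetric] sum_product
      by (intro sum.cong refl) (auto simp: of_bool_def)
    moreover have "2 * w * new_deg S e = (\<Sum>T\<in>He. 2 * w * (x T / s\<^sup>2) * of_bool (T \<subseteq> surv S))"
      unfolding new_deg_def He_def[symmetric] sum_distrib_left by (simp add: mult.assoc)
    ultimately show ?thesis using True by (simp add: power2_diff mult.commute)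
  next
    case False
    then have "\<not> T \<subseteq> surv S" if "T \<in> He" for T using that by (auto simp: He_def)
    with False show ?thesis by simp
  qed
  then have "bern_exp coins q (\<lambda>S. (of_bool (e \<in> surv S) * (new_deg S e - w))\<^sup>2) =
      (\<Sum>T\<in>He. \<Sum>T'\<in>He. x T / s\<^sup>2 * (x T' / s\<^sup>2) * p (T \<union> T'))
      - (\<Sum>T\<in>He. 2 * w * (x T / s\<^sup>2) * p T) + w\<^sup>2 * p {e}"
    by (simp only: bern_exp_add bern_exp_diff bern_exp_sum bern_exp_cmult p_def)
  also have "p {e} = s" using exp_surv_one[OF e] by (simp add: p_def)
  finally have eq: "bern_exp coins q (\<lambda>S. (of_bool (e \<in> surv S) * (new_deg S e - w))\<^sup>2) =
      (\<Sum>T\<in>He. \<Sum>T'\<in>He. x T / s\<^sup>2 * (x T' / s\<^sup>2) * p (T \<union> T'))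
      - (\<Sum>T\<in>He. 2 * w * (x T / s\<^sup>2) * p T) + w\<^sup>2 * s" .
  have lower: "(\<Sum>T\<in>He. 2 * w * (x T / s\<^sup>2) * p T) \<ge> 2 * w\<^sup>2 * s"
  proof -
    have "s ^ 3 \<le> p T" if "T \<in> He" for T
      unfolding p_def using H[OF He(2)[OF that]] by (intro exp_surv_bounds) auto
    then have "(\<Sum>T\<in>He. 2 * w * (x T / s\<^sup>2) * s ^ 3) \<le> (\<Sum>T\<in>He. 2 * w * (x T / s\<^sup>2) * p T)"
      using w x He by (intro sum_mono mult_left_mono) auto
    moreover have "(\<Sum>T\<in>He. 2 * w * (x T / s\<^sup>2) * s ^ 3) = (\<Sum>T\<in>He. 2 * w * s * x T)"
      using s by (intro sum.cong refl) (simp add: power2_eq_square power3_eq_cube)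
    moreover have "\<dots> = 2 * w\<^sup>2 * s"
      by (simp add: sum_distrib_left[symmetric] w(1)[symmetric] power2_eq_square)
    ultimately show ?thesis by simp
  qed
  have upper: "(\<Sum>T\<in>He. \<Sum>T'\<in>He. x T / s\<^sup>2 * (x T' / s\<^sup>2) * p (T \<union> T')) \<le> w\<^sup>2 * (s / r ^ 25) + 16 * \<delta>"
  proof -
    have off: "p (T \<union> T') \<le> s ^ 5 / r ^ 25" if T: "T \<in> He" "T' \<in> He" "T \<noteq> T'" for T T'
    proof -
      have "card (T \<inter> T') = 1"
      proof -
        have "T \<inter> T' = {e}"
          using T lin unfolding linear_triples_def He_def by blast
        then show ?thesis by simp
      qed
      then have "card (T \<union> T') = 5"
        using card_Un_Int[of T T'] H[OF He(2)[OF T(1)]] H[OF He(2)[OF T(2)]] by simp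
      then have "p (T \<union> T') * r ^ 25 \<le> s ^ 5"
        unfolding p_def using H[OF He(2)[OF T(1)]] H[OF He(2)[OF T(2)]]
        by (intro exp_surv_bounds) auto
      then show ?thesis using r by (simp add: field_simps)
    qed
    have p1: "p F \<le> 1" for F
    proof -
      have "p F \<le> bern_exp coins q (\<lambda>_. 1)"
        unfolding p_def by (intro bern_exp_mono q01) auto
      then show ?thesis using fin by (simp add: bern_exp_const)
    qed
    have pair: "x T / s\<^sup>2 * (x T' / s\<^sup>2) * p (T \<union> T')
        \<le> x T * x T' * (s / r ^ 25) + (if T' = T then 16 * \<delta> * x T else 0)"
      if T: "T \<in> He" "T' \<in> He" for T T'
    proof (cases "T' = T")
      case False
      have "x T / s\<^sup>2 * (x T' / s\<^sup>2) * p (T \<union> T') \<le> x T / s\<^sup>2 * (x T' / s\<^sup>2) * (s ^ 5 / r ^ 25)"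
        using off T False x He by (intro mult_left_mono mult_nonneg_nonneg) auto
      also have "\<dots> = x T * x T' * (s / r ^ 25)"
        using s by (simp add: field_simps power2_eq_square eval_nat_numeral)
      finally show ?thesis using False by simp
    next
      case True
      have "x T / s\<^sup>2 * (x T / s\<^sup>2) * p T \<le> x T / s\<^sup>2 * (x T / s\<^sup>2) * 1"
        using p1 by (intro mult_left_mono mult_nonneg_nonneg) (use x He T in auto)
      also have "\<dots> = x T * x T * (1 / s ^ 4)"
        by (simp add: field_simps power2_eq_square eval_nat_numeral)
      also have "\<dots> \<le> x T * \<delta> * 16"
      proof (intro mult_mono)
        have "(1 / 2) ^ 4 \<le> s ^ 4" using s by (intro power_mono) auto
        then show "1 / s ^ 4 \<le> 16" using s by (simp add: field_simps)
      qed (use x He T \<delta> s in auto)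
      finally have "x T / s\<^sup>2 * (x T / s\<^sup>2) * p T \<le> 16 * \<delta> * x T" by (simp add: mult_ac)
      moreover have "0 \<le> x T * x T * (s / r ^ 25)" using s r by auto
      ultimately show ?thesis using True by simp
    qed
    have "(\<Sum>T\<in>He. \<Sum>T'\<in>He. x T / s\<^sup>2 * (x T' / s\<^sup>2) * p (T \<union> T'))
        \<le> (\<Sum>T\<in>He. \<Sum>T'\<in>He. x T * x T' * (s / r ^ 25) + (if T' = T then 16 * \<delta> * x T else 0))"
      by (intro sum_mono pair)
    also have "\<dots> = w\<^sup>2 * (s / r ^ 25) + 16 * \<delta> * w"
    proof -
      have "(\<Sum>T\<in>He. \<Sum>T'\<in>He. x T * x T' * (s / r ^ 25)) = w\<^sup>2 * (s / r ^ 25)"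
      proof -
        have "(\<Sum>T\<in>He. \<Sum>T'\<in>He. x T * x T' * (s / r ^ 25)) =
            (\<Sum>T\<in>He. \<Sum>T'\<in>He. x T * x T') * (s / r ^ 25)"
          by (simp only: sum_distrib_right)
        then show ?thesis by (simp add: w(1) power2_eq_square sum_product)
      qed
      moreover have "(\<Sum>T\<in>He. 16 * \<delta> * x T) = 16 * \<delta> * w"
        unfolding w(1) sum_distrib_left by simp
      ultimately show ?thesis using He(1) by (simp add: sum.distrib)
    qed
    also have "\<dots> \<le> w\<^sup>2 * (s / r ^ 25) + 16 * \<delta>"
      using w \<delta> by simp
    finally show ?thesis .
  qed
  have "bern_exp coins q (\<lambda>S. (of_bool (e \<in> surv S) * (new_deg S e - w))\<^sup>2)
      \<le> w\<^sup>2 * (s / r ^ 25) + 16 * \<delta> - 2 * w\<^sup>2 * s + w\<^sup>2 * s" using eq lower upper by linarith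
  also have "\<dots> = w\<^sup>2 * s * (1 / r ^ 25 - 1) + 16 * \<delta>" by (simp add: algebra_simps)
  also have "\<dots> \<le> 1 * (1 / r ^ 25 - 1) + 16 * \<delta>"
  proof -
    have "w\<^sup>2 * s \<le> 1 * 1" using w2 s by (intro mult_mono) auto
    moreover have "0 \<le> 1 / r ^ 25 - 1" using r by (simp add: field_simps power_le_one)
    ultimately show ?thesis by (intro add_mono mult_right_mono order_refl) auto
  qed
  finally show ?thesis by (simp add: w_def)
qed

text \<open>One functional combines all that must be controlled: points not matched now, fractional
  weight kept for later, excess degrees to be truncated, and an anticipated loss c per surviving
  point. Some outcome does not exceed its expectation, in which \<open>\<theta> + s = 1\<close>
  restores the full fractional weight.\<close>

lemma exists_bite:
  fixes c :: real
  assumes \<gamma>: "1 / r ^ 25 - 1 + 16 * \<delta> \<le> \<gamma>\<^sup>2" "\<gamma> > 0"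
  shows "\<exists>S. real (card X) - 3 * real (card (isolated S)) - 3 * (\<Sum>T\<in>H. x T / s\<^sup>2 * of_bool (T \<subseteq> surv S))
      + 3 * (\<Sum>e\<in>surv S. \<bar>new_deg S e - wdeg H x e\<bar>) + c * card (surv S)
    \<le> real (card X) - 3 * (\<Sum>T\<in>H. x T) + (3 * \<theta>\<^sup>2 + c * s + 3 * \<gamma>) * card X"
proof -
  let ?E = "bern_exp coins q"
  have surv_sum: "(\<Sum>e\<in>surv S. g e) = (\<Sum>e\<in>X. of_bool (e \<in> surv S) * g e)" for S and g :: "'b \<Rightarrow> real"
  proof -
    have "(\<Sum>e\<in>X. of_bool (e \<in> surv S) * g e) = (\<Sum>e\<in>surv S. of_bool (e \<in> surv S) * g e)"
      using fin by (intro sum.mono_neutral_right) (auto simp: surv_def)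
    then show ?thesis by simp
  qed
  define f where "f S = real (card X) - 3 * real (card (isolated S)) - 3 * (\<Sum>T\<in>H. x T / s\<^sup>2 * of_bool (T \<subseteq> surv S))
      + 3 * (\<Sum>e\<in>X. \<bar>of_bool (e \<in> surv S) * (new_deg S e - wdeg H x e)\<bar>) + c * (\<Sum>e\<in>X. of_bool (e \<in> surv S))" for S
  have "?E f = real (card X) - 3 * ?E (\<lambda>S. card (isolated S)) - 3 * (\<Sum>T\<in>H. x T / s\<^sup>2 * ?E (\<lambda>S. of_bool (T \<subseteq> surv S)))
      + 3 * (\<Sum>e\<in>X. ?E (\<lambda>S. \<bar>of_bool (e \<in> surv S) * (new_deg S e - wdeg H x e)\<bar>))
      + c * (\<Sum>e\<in>X. ?E (\<lambda>S. of_bool (e \<in> surv S)))"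
    unfolding f_def
    by (simp only: bern_exp_add bern_exp_diff bern_exp_sum bern_exp_cmult bern_exp_const[OF fin(3)])
  also have "\<dots> \<le> real (card X) - (3 * \<theta> * (\<Sum>T\<in>H. x T) - 3 * \<theta>\<^sup>2 * card X) - 3 * (s * (\<Sum>T\<in>H. x T))
      + 3 * (\<Sum>e\<in>X. \<gamma>) + c * (\<Sum>e\<in>X. s)"
  proof -
    have e1: "s * (\<Sum>T\<in>H. x T) \<le> (\<Sum>T\<in>H. x T / s\<^sup>2 * ?E (\<lambda>S. of_bool (T \<subseteq> surv S)))"
      unfolding sum_distrib_left
    proof (rule sum_mono)
      fix T assume T: "T \<in> H"
      have "s * x T = x T / s\<^sup>2 * s ^ 3" using s by (simp add: power2_eq_square power3_eq_cube)
      also have "\<dots> \<le> x T / s\<^sup>2 * ?E (\<lambda>S. of_bool (T \<subseteq> surv S))"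
        using x[OF T] H[OF T] by (intro mult_left_mono exp_surv_bounds) auto
      finally show "s * x T \<le> x T / s\<^sup>2 * ?E (\<lambda>S. of_bool (T \<subseteq> surv S))" .
    qed
    have e2: "(\<Sum>e\<in>X. ?E (\<lambda>S. \<bar>of_bool (e \<in> surv S) * (new_deg S e - wdeg H x e)\<bar>)) \<le> (\<Sum>e\<in>X. \<gamma>)"
      using order_trans[OF exp_deviation_square \<gamma>(1)] \<gamma>(2)
      by (intro sum_mono bern_exp_abs_le q01 fin) auto
    have e3: "(\<Sum>e\<in>X. ?E (\<lambda>S. of_bool (e \<in> surv S))) = (\<Sum>e\<in>X. s)"
      using exp_surv_one by (intro sum.cong) auto
    show ?thesis unfolding e3 using e1 e2 exp_isolated by linarith
  qed
  also have "\<dots> = real (card X) - 3 * (\<Sum>T\<in>H. x T) + (3 * \<theta>\<^sup>2 + c * s + 3 * \<gamma>) * card X"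
    by (simp add: s_def algebra_simps)
  finally have Ef: "?E f \<le> real (card X) - 3 * (\<Sum>T\<in>H. x T) + (3 * \<theta>\<^sup>2 + c * s + 3 * \<gamma>) * card X" .
  have "\<exists>S\<subseteq>coins. f S \<le> ?E f" using fin(3) q01 by (intro bern_exp_attained) auto
  then obtain S where "f S \<le> ?E f" by blast
  with Ef have "f S \<le> real (card X) - 3 * (\<Sum>T\<in>H. x T) + (3 * \<theta>\<^sup>2 + c * s + 3 * \<gamma>) * card X"
    by linarith
  moreover have "f S = real (card X) - 3 * real (card (isolated S)) - 3 * (\<Sum>T\<in>H. x T / s\<^sup>2 * of_bool (T \<subseteq> surv S))
      + 3 * (\<Sum>e\<in>surv S. \<bar>new_deg S e - wdeg H x e\<bar>) + c * card (surv S)"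
    using surv_sum[of "\<lambda>_. 1" S] surv_sum[of "\<lambda>e. \<bar>new_deg S e - wdeg H x e\<bar>" S]
    by (simp add: f_def abs_mult)
  ultimately show ?thesis by (intro exI[of _ S]) simp
qed

end

section \<open>Iterating the bite\<close>

text \<open>A loss a is a number of unmatched points per point of X, beyond those missed by the
  fractional matching, that is achievable once all weights are small. The slack \<eta> allows the
  infimum of all losses to be one of them.\<close>

definition matching_loss :: "'b itself \<Rightarrow> real set" where
  "matching_loss _ = {a. 0 \<le> a \<and> (\<forall>\<eta>>0. \<exists>\<delta>>0. \<forall>(X :: 'b set) H (x :: 'b set \<Rightarrow> real). linear_triples X H \<longrightarrow>
     (\<forall>T\<in>H. 0 \<le> x T \<and> x T \<le> \<delta>) \<longrightarrow> (\<forall>e\<in>X. wdeg H x e \<le> 1) \<longrightarrow>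
     (\<exists>M\<subseteq>H. disjoint M \<and>
        real (card X) - 3 * real (card M) \<le> real (card X) - 3 * (\<Sum>T\<in>H. x T) + (a + \<eta>) * card X))}"

text \<open>A bite leaves about the fraction \<open>1 - \<theta>\<close> of the points, to which the
  loss a applies, and its conflicts waste \<open>3 * \<theta>\<^sup>2\<close> per point. All other
  errors vanish with \<delta>.\<close>

lemma matching_loss_step:
  assumes a: "a \<in> matching_loss TYPE('b)" and \<theta>: "0 < \<theta>" "\<theta> \<le> 1 / 2"
  shows "(1 - \<theta>) * a + 3 * \<theta>\<^sup>2 \<in> matching_loss TYPE('b)"
  unfolding matching_loss_def
proof (intro CollectI conjI allI impI)
  show "0 \<le> (1 - \<theta>) * a + 3 * \<theta>\<^sup>2" using assms by (auto simp: matching_loss_def)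
  fix \<eta> :: real assume \<eta>: "\<eta> > 0"
  then have "\<eta> / 2 > 0" by simp
  with a obtain \<delta>' where \<delta>': "\<delta>' > 0" and IH:
    "\<And>(X :: 'b set) H (x :: 'b set \<Rightarrow> real). linear_triples X H \<Longrightarrow>
     (\<forall>T\<in>H. 0 \<le> x T \<and> x T \<le> \<delta>') \<Longrightarrow> (\<forall>e\<in>X. wdeg H x e \<le> 1) \<Longrightarrow>
     (\<exists>M\<subseteq>H. disjoint M \<and>
        real (card X) - 3 * real (card M) \<le> real (card X) - 3 * (\<Sum>T\<in>H. x T) + (a + \<eta> / 2) * card X)"
    unfolding matching_loss_def by blast
  \<comment> \<open>The degree deviation is to be below \<open>\<eta> / 6\<close>. Also
    \<open>\<delta>' / 4\<close> is required, because rescaling by \<open>1 / s\<^sup>2\<close>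
    multiplies weights by at most 4.\<close>
  have "((\<lambda>\<delta>. 1 / (1 - \<theta> * \<delta>) ^ 25 - 1 + 16 * \<delta>) \<longlongrightarrow> 1 / (1 - \<theta> * 0) ^ 25 - 1 + 16 * 0) (at_right 0)"
    by (intro tendsto_intros) auto
  moreover have "1 / (1 - \<theta> * 0) ^ 25 - 1 + 16 * 0 < (\<eta> / 6)\<^sup>2" using \<eta> by simp
  ultimately have "eventually (\<lambda>\<delta>. 1 / (1 - \<theta> * \<delta>) ^ 25 - 1 + 16 * \<delta> < (\<eta> / 6)\<^sup>2) (at_right 0)"
    by (rule order_tendstoD)
  moreover have "eventually (\<lambda>\<delta>::real. \<delta> < min 1 (\<delta>' / 4)) (at_right 0)"
    using \<delta>' by (intro order_tendstoD(2)[OF tendsto_ident_at]) auto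
  moreover have "eventually (\<lambda>\<delta>::real. 0 < \<delta>) (at_right 0)" by (rule eventually_at_right_less)
  ultimately have "eventually (\<lambda>\<delta>. 1 / (1 - \<theta> * \<delta>) ^ 25 - 1 + 16 * \<delta> < (\<eta> / 6)\<^sup>2
      \<and> \<delta> < min 1 (\<delta>' / 4) \<and> 0 < \<delta>) (at_right 0)" by eventually_elim auto
  then obtain \<delta> where small: "1 / (1 - \<theta> * \<delta>) ^ 25 - 1 + 16 * \<delta> < (\<eta> / 6)\<^sup>2" "\<delta> < 1" "\<delta> < \<delta>' / 4" "0 < \<delta>"
    using eventually_happens'[OF trivial_limit_at_right_real] by auto
  show "\<exists>\<delta>>0. \<forall>(X :: 'b set) H (x :: 'b set \<Rightarrow> real). linear_triples X H \<longrightarrow>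
     (\<forall>T\<in>H. 0 \<le> x T \<and> x T \<le> \<delta>) \<longrightarrow> (\<forall>e\<in>X. wdeg H x e \<le> 1) \<longrightarrow>
     (\<exists>M\<subseteq>H. disjoint M \<and> real (card X) - 3 * real (card M)
        \<le> real (card X) - 3 * (\<Sum>T\<in>H. x T) + ((1 - \<theta>) * a + 3 * \<theta>\<^sup>2 + \<eta>) * card X)"
  proof (intro exI[of _ \<delta>] conjI small(4) allI impI)
    fix X :: "'b set" and H x
    assume prems: "linear_triples X H" "\<forall>T\<in>H. 0 \<le> x T \<and> x T \<le> \<delta>" "\<forall>e\<in>X. wdeg H x e \<le> 1"
    interpret random_bite X H x \<delta> \<theta>
      using prems \<theta> small by unfold_locales auto
    obtain S where S: "real (card X) - 3 * real (card (isolated S)) - 3 * (\<Sum>T\<in>H. x T / s\<^sup>2 * of_bool (T \<subseteq> surv S))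
        + 3 * (\<Sum>e\<in>surv S. \<bar>new_deg S e - wdeg H x e\<bar>) + (a + \<eta> / 2) * card (surv S)
      \<le> real (card X) - 3 * (\<Sum>T\<in>H. x T) + (3 * \<theta>\<^sup>2 + (a + \<eta> / 2) * s + 3 * (\<eta> / 6)) * card X"
      using exists_bite[of "\<eta> / 6" "a + \<eta> / 2"] small(1) \<eta> unfolding r_def by force
    define H' where "H' = {T \<in> H. T \<subseteq> surv S}"
    have lin': "linear_triples (surv S) H'"
      using lin unfolding linear_triples_def H'_def surv_def by auto
    have fin': "finite (surv S)" "finite H'" using fin by (auto simp: surv_def H'_def)
    obtain y where y: "\<And>T. T \<in> H' \<Longrightarrow> 0 \<le> y T \<and> y T \<le> x T / s\<^sup>2" "\<And>e. e \<in> surv S \<Longrightarrow> wdeg H' y e \<le> 1"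
      "(\<Sum>T\<in>H'. x T / s\<^sup>2) - (\<Sum>e\<in>surv S. max 0 (wdeg H' (\<lambda>T. x T / s\<^sup>2) e - 1)) \<le> (\<Sum>T\<in>H'. y T)"
      using truncate_weights[OF lin', of "\<lambda>T. x T / s\<^sup>2"] H'_def prems(2) by auto
    have "0 \<le> y T \<and> y T \<le> \<delta>'" if "T \<in> H'" for T
    proof -
      have "x T / s\<^sup>2 \<le> \<delta> / (1 / 2)\<^sup>2"
        using that prems(2) s small by (intro frac_le power_mono) (auto simp: H'_def)
      also have "\<dots> \<le> \<delta>'" using small(3) by (simp add: power2_eq_square)
      finally show ?thesis using y(1)[OF that] by linarith
    qed
    then obtain M' where M': "M' \<subseteq> H'" "disjoint M'"
      "real (card (surv S)) - 3 * real (card M') \<le> real (card (surv S)) - 3 * (\<Sum>T\<in>H'. y T) + (a + \<eta> / 2) * card (surv S)"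
      using IH[OF lin', of y] y(2) by blast
    have disj: "T \<inter> T' = {}" if "T \<in> isolated S" "T' \<in> H'" for T T'
      using that by (auto simp: isolated_def H'_def surv_def nbr_def)
    have ne: "T \<noteq> {}" if "T \<in> H" for T using H(2)[OF that] by auto
    let ?M = "isolated S \<union> M'"
    have "?M \<subseteq> H" using M'(1) by (auto simp: isolated_def H'_def)
    moreover have "disjoint ?M"
    proof (rule disjointI)
      fix A B assume "A \<in> ?M" "B \<in> ?M" "A \<noteq> B"
      moreover have "A \<inter> B = {}" if "A \<in> isolated S" "B \<in> isolated S" "A \<noteq> B" for A B
        using that by (auto simp: isolated_def)
      moreover have "A \<inter> B = {}" if "A \<in> M'" "B \<in> M'" "A \<noteq> B" for A B
        using M'(2) that by (auto simp: disjoint_def)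
      ultimately show "A \<inter> B = {}" using disj M'(1) by blast
    qed
    moreover have "real (card X) - 3 * real (card ?M)
        \<le> real (card X) - 3 * (\<Sum>T\<in>H. x T) + ((1 - \<theta>) * a + 3 * \<theta>\<^sup>2 + \<eta>) * card X"
    proof -
      have "isolated S \<inter> M' = {}"
      proof (rule ccontr)
        assume "isolated S \<inter> M' \<noteq> {}"
        then obtain T where "T \<in> isolated S" "T \<in> H'" using M'(1) by auto
        then show False using disj[of T T] ne[of T] by (auto simp: H'_def)
      qed
      then have "card ?M = card (isolated S) + card M'"
        using fin' fin M'(1) finite_subset
        by (intro card_Un_disjoint) (auto simp: isolated_def)
      moreover have "(\<Sum>T\<in>H'. x T / s\<^sup>2) = (\<Sum>T\<in>H. x T / s\<^sup>2 * of_bool (T \<subseteq> surv S))"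
        unfolding H'_def using fin by (simp add: sum.inter_filter of_bool_def if_distrib cong: if_cong)
      moreover have "(\<Sum>e\<in>surv S. max 0 (wdeg H' (\<lambda>T. x T / s\<^sup>2) e - 1))
          \<le> (\<Sum>e\<in>surv S. \<bar>new_deg S e - wdeg H x e\<bar>)"
      proof (rule sum_mono)
        fix e assume e: "e \<in> surv S"
        have "wdeg H' (\<lambda>T. x T / s\<^sup>2) e = new_deg S e"
        proof -
          show ?thesis unfolding wdeg_def new_deg_def
            using fin by (intro sum.mono_neutral_cong_left) (auto simp: H'_def)
        qed
        moreover have "wdeg H x e \<le> 1" using e prems(3) by (auto simp: surv_def)
        ultimately show "max 0 (wdeg H' (\<lambda>T. x T / s\<^sup>2) e - 1) \<le> \<bar>new_deg S e - wdeg H x e\<bar>" by simp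
      qed
      ultimately have "real (card X) - 3 * real (card ?M)
          \<le> real (card X) - 3 * (\<Sum>T\<in>H. x T) + (3 * \<theta>\<^sup>2 + (a + \<eta> / 2) * s + 3 * (\<eta> / 6)) * card X"
        using S M'(3) y(3) by simp
      also have "\<dots> \<le> real (card X) - 3 * (\<Sum>T\<in>H. x T) + ((1 - \<theta>) * a + 3 * \<theta>\<^sup>2 + \<eta>) * card X"
      proof -
        have "\<eta> * s \<le> \<eta> * 1" using s \<eta> by (intro mult_left_mono) auto
        then have "3 * \<theta>\<^sup>2 + (a + \<eta> / 2) * s + 3 * (\<eta> / 6) \<le> (1 - \<theta>) * a + 3 * \<theta>\<^sup>2 + \<eta>"
          by (simp add: s_def algebra_simps diff_divide_distrib)
        then show ?thesis by (intro add_left_mono mult_right_mono) auto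
      qed
      finally show ?thesis .
    qed
    ultimately show "\<exists>M\<subseteq>H. disjoint M \<and> real (card X) - 3 * real (card M)
        \<le> real (card X) - 3 * (\<Sum>T\<in>H. x T) + ((1 - \<theta>) * a + 3 * \<theta>\<^sup>2 + \<eta>) * card X"
      by blast
  qed
qed

text \<open>
  The infimum \<open>a\<close> of all losses is attained, and a bite with \<open>\<theta>\<close> small compared to \<open>a\<close> would decrease it.
\<close>

theorem near_perfect_matching:
  fixes \<eta> :: real
  assumes "\<eta> > 0"
  shows "\<exists>\<delta>>0. \<forall>(X :: 'b set) H (x :: 'b set \<Rightarrow> real). linear_triples X H \<longrightarrow>
     (\<forall>T\<in>H. 0 \<le> x T \<and> x T \<le> \<delta>) \<longrightarrow> (\<forall>e\<in>X. wdeg H x e \<le> 1) \<longrightarrow>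
     (\<exists>M\<subseteq>H. disjoint M \<and> real (card X) - 3 * real (card M) \<le> real (card X) - 3 * (\<Sum>T\<in>H. x T) + \<eta> * card X)"
proof -
  let ?L = "matching_loss TYPE('b)"
  define a where "a = Inf ?L"
  have bdd: "bdd_below ?L" by (auto simp: matching_loss_def bdd_below_def)
  have "1 \<in> ?L"
    unfolding matching_loss_def
  proof (intro CollectI conjI allI impI)
    fix \<eta> :: real assume \<eta>: "\<eta> > 0"
    show "\<exists>\<delta>>0. \<forall>(X :: 'b set) H (x :: 'b set \<Rightarrow> real). linear_triples X H \<longrightarrow>
     (\<forall>T\<in>H. 0 \<le> x T \<and> x T \<le> \<delta>) \<longrightarrow> (\<forall>e\<in>X. wdeg H x e \<le> 1) \<longrightarrow>
     (\<exists>M\<subseteq>H. disjoint M \<and> real (card X) - 3 * real (card M) \<le> real (card X) - 3 * (\<Sum>T\<in>H. x T) + (1 + \<eta>) * card X)"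
    proof (intro exI[of _ 1] conjI allI impI exI[of _ "{}"])
      fix X :: "'b set" and H x
      assume prems: "linear_triples X H" "\<forall>T\<in>H. 0 \<le> x T \<and> x T \<le> 1" "\<forall>e\<in>X. wdeg H x e \<le> 1"
      have "(\<Sum>e\<in>X. wdeg H x e) \<le> (\<Sum>e\<in>X. 1)" using prems(3) by (intro sum_mono) auto
      then have "3 * (\<Sum>T\<in>H. x T) \<le> card X" using sum_wdeg_triples[OF prems(1), of x] by simp
      moreover have "0 \<le> \<eta> * card X" using \<eta> by simp
      ultimately show "real (card X) - 3 * real (card {}) \<le> real (card X) - 3 * (\<Sum>T\<in>H. x T) + (1 + \<eta>) * card X"
        by (simp add: algebra_simps)
    qed (auto simp: disjoint_def)
  qed simp
  then have ne: "?L \<noteq> {}" by auto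
  have a0: "0 \<le> a" unfolding a_def using ne by (intro cInf_greatest) (auto simp: matching_loss_def)
  have a_in: "a \<in> ?L"
    unfolding matching_loss_def
  proof (intro CollectI conjI allI impI a0)
    fix \<eta> :: real assume \<eta>: "\<eta> > 0"
    then obtain b where b: "b \<in> ?L" "b < a + \<eta> / 2"
      using cInf_lessD[OF ne, of "a + \<eta> / 2"] by (auto simp: a_def)
    from \<eta> have "\<eta> / 2 > 0" by simp
    with b obtain \<delta> where \<delta>: "\<delta> > 0" and IH:
      "\<And>(X :: 'b set) H (x :: 'b set \<Rightarrow> real). linear_triples X H \<Longrightarrow>
       (\<forall>T\<in>H. 0 \<le> x T \<and> x T \<le> \<delta>) \<Longrightarrow> (\<forall>e\<in>X. wdeg H x e \<le> 1) \<Longrightarrow>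
       (\<exists>M\<subseteq>H. disjoint M \<and>
          real (card X) - 3 * real (card M) \<le> real (card X) - 3 * (\<Sum>T\<in>H. x T) + (b + \<eta> / 2) * card X)"
      unfolding matching_loss_def by blast
    show "\<exists>\<delta>>0. \<forall>(X :: 'b set) H (x :: 'b set \<Rightarrow> real). linear_triples X H \<longrightarrow>
     (\<forall>T\<in>H. 0 \<le> x T \<and> x T \<le> \<delta>) \<longrightarrow> (\<forall>e\<in>X. wdeg H x e \<le> 1) \<longrightarrow>
     (\<exists>M\<subseteq>H. disjoint M \<and> real (card X) - 3 * real (card M) \<le> real (card X) - 3 * (\<Sum>T\<in>H. x T) + (a + \<eta>) * card X)"
    proof (intro exI[of _ \<delta>] conjI \<delta> allI impI)
      fix X :: "'b set" and H and x :: "'b set \<Rightarrow> real"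
      assume prems: "linear_triples X H" "\<forall>T\<in>H. 0 \<le> x T \<and> x T \<le> \<delta>" "\<forall>e\<in>X. wdeg H x e \<le> 1"
      obtain M where "M \<subseteq> H" "disjoint M"
        "real (card X) - 3 * real (card M) \<le> real (card X) - 3 * (\<Sum>T\<in>H. x T) + (b + \<eta> / 2) * card X"
        using IH[OF prems] by blast
      moreover have "(b + \<eta> / 2) * card X \<le> (a + \<eta>) * card X"
        using b(2) by (intro mult_right_mono) auto
      ultimately show "\<exists>M\<subseteq>H. disjoint M \<and>
          real (card X) - 3 * real (card M) \<le> real (card X) - 3 * (\<Sum>T\<in>H. x T) + (a + \<eta>) * card X"
        by (intro exI[of _ M]) linarith
    qed
  qed
  have "a = 0"
  proof (rule ccontr)
    assume "a \<noteq> 0"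
    with a0 have a_pos: "a > 0" by simp
    define \<theta> where "\<theta> = min (1 / 2) (a / 6)"
    have \<theta>: "0 < \<theta>" "\<theta> \<le> 1 / 2" "\<theta> \<le> a / 6" using a_pos by (auto simp: \<theta>_def)
    then have "a \<le> (1 - \<theta>) * a + 3 * \<theta>\<^sup>2"
      unfolding a_def by (intro cInf_lower bdd matching_loss_step) (use a_in in \<open>auto simp: a_def\<close>)
    then have "\<theta> * a \<le> \<theta> * (3 * \<theta>)" by (simp add: algebra_simps power2_eq_square)
    then have "a \<le> 3 * \<theta>" using \<theta>(1) by (rule mult_left_le_imp_le)
    then show False using \<theta> a_pos by simp
  qed
  then show ?thesis using a_in assms unfolding matching_loss_def by auto
qed

section \<open>Random labels\<close>

text \<open>Neither F nor g looks at coordinate i, so for a uniformly random f the event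
  \<open>f i = g f\<close> has probability \<open>1 / L\<close> whatever the other coordinates
  are.\<close>

lemma sum_PiE_fresh_coordinate:
  fixes F :: "('i \<Rightarrow> nat) \<Rightarrow> real"
  assumes I: "finite I" "i \<in> I" and L: "L > 0"
    and F: "\<And>f c. F (f(i := c)) = F f" and g: "\<And>f c. g (f(i := c)) = g f"
    and gL: "\<And>f. f \<in> (\<Pi>\<^sub>E i\<in>I. {..<L}) \<Longrightarrow> g f < L"
  shows "real L * (\<Sum>f\<in>(\<Pi>\<^sub>E i\<in>I. {..<L}). F f * of_bool (f i = g f)) = (\<Sum>f\<in>(\<Pi>\<^sub>E i\<in>I. {..<L}). F f)"
proof -
  define J where "J = I - {i}"
  let ?P = "\<Pi>\<^sub>E j\<in>J. {..<L}"
  have IJ: "I = insert i J" "i \<notin> J" "finite J" using I by (auto simp: J_def)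
  have split: "(\<Sum>f\<in>(\<Pi>\<^sub>E i\<in>I. {..<L}). h f) = (\<Sum>m\<in>?P. \<Sum>c<L. h (m(i := c)))" for h :: "('i \<Rightarrow> nat) \<Rightarrow> real"
  proof -
    have "(\<Sum>f\<in>(\<Pi>\<^sub>E i\<in>I. {..<L}). h f) = (\<Sum>(c, m)\<in>{..<L} \<times> ?P. h (m(i := c)))"
      unfolding IJ(1) PiE_insert_eq
      by (subst sum.reindex[OF inj_combinator[OF IJ(2)]]) (simp add: case_prod_beta o_def)
    also have "\<dots> = (\<Sum>c<L. \<Sum>m\<in>?P. h (m(i := c)))" by (simp add: sum.cartesian_product)
    finally show ?thesis by (subst (asm) sum.swap)
  qed
  have "(\<Sum>f\<in>(\<Pi>\<^sub>E i\<in>I. {..<L}). F f * of_bool (f i = g f)) = (\<Sum>m\<in>?P. F m)"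
    unfolding split
  proof (rule sum.cong[OF refl])
    fix m assume m: "m \<in> ?P"
    have "m(i := 0) \<in> (\<Pi>\<^sub>E i\<in>I. {..<L})" using m IJ L by (auto simp: PiE_iff extensional_def)
    then have "g m < L" using gL[of "m(i := 0)"] g by simp
    moreover have "(\<Sum>c<L. F (m(i := c)) * of_bool ((m(i := c)) i = g (m(i := c)))) =
        (\<Sum>c<L. if c = g m then F m else 0)"
      by (intro sum.cong refl) (simp add: F g)
    ultimately show "(\<Sum>c<L. F (m(i := c)) * of_bool ((m(i := c)) i = g (m(i := c)))) = F m"
      by simp
  qed
  moreover have "(\<Sum>f\<in>(\<Pi>\<^sub>E i\<in>I. {..<L}). F f) = real L * (\<Sum>m\<in>?P. F m)"
    unfolding split by (simp add: F sum_distrib_left)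
  ultimately show ?thesis by simp
qed

lemma sum_PiE_fresh_coordinates:
  assumes I: "finite I" and J: "J \<subseteq> I" and L: "L > 0"
    and g: "\<And>f c i j. i \<in> J \<Longrightarrow> j \<in> J \<Longrightarrow> g j (f(i := c)) = g j f"
    and gL: "\<And>f j. f \<in> (\<Pi>\<^sub>E i\<in>I. {..<L}) \<Longrightarrow> g j f < L"
  shows "real L ^ card J * (\<Sum>f\<in>(\<Pi>\<^sub>E i\<in>I. {..<L}). of_bool (\<forall>j\<in>J. f j = g j f)) =
    real (card (\<Pi>\<^sub>E i\<in>I. {..<L}))"
proof -
  have "finite J" using I J by (rule finite_subset[rotated])
  then show ?thesis using J g
  proof (induction J rule: finite_induct)
    case (insert i J)
    let ?F = "\<lambda>f. of_bool (\<forall>j\<in>J. f j = g j f) :: real"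
    have F: "?F (f(i := c)) = ?F f" for f c
    proof -
      have "g j (f(i := c)) = g j f" if "j \<in> J" for j using insert.prems(2) that by blast
      moreover have "(f(i := c)) j = f j" if "j \<in> J" for j using that insert.hyps by auto
      ultimately show ?thesis by simp
    qed
    have "real L * (\<Sum>f\<in>(\<Pi>\<^sub>E i\<in>I. {..<L}). ?F f * of_bool (f i = g i f)) = (\<Sum>f\<in>(\<Pi>\<^sub>E i\<in>I. {..<L}). ?F f)"
      by (rule sum_PiE_fresh_coordinate[where F = ?F and g = "g i", OF I _ L F _ gL])
        (use insert.prems in blast)+
    moreover have "?F f * of_bool (f i = g i f) = of_bool (\<forall>j\<in>insert i J. f j = g j f)" for f
      by auto
    ultimately have "real L ^ card (insert i J) * (\<Sum>f\<in>(\<Pi>\<^sub>E i\<in>I. {..<L}). of_bool (\<forall>j\<in>insert i J. f j = g j f))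
        = real L ^ card J * (\<Sum>f\<in>(\<Pi>\<^sub>E i\<in>I. {..<L}). ?F f)"
      using insert.hyps by simp
    also have "\<dots> = real (card (\<Pi>\<^sub>E i\<in>I. {..<L}))"
      using insert.prems by (intro insert.IH) auto
    finally show ?case .
  qed simp
qed

text \<open>The value \<open>f (v, u)\<close> is the label of the neighbour u at the vertex v. A
  face traversed as u, v, w needs a rotation at v sending u to w, and so on; these are the
  conditions at v, w and u.\<close>

definition ascending :: "nat \<Rightarrow> ('a \<times> 'a \<Rightarrow> nat) \<Rightarrow> 'a \<Rightarrow> 'a \<Rightarrow> 'a \<Rightarrow> bool" where
  "ascending L f u v w \<longleftrightarrow> f (v, w) = (f (v, u) + 1) mod L \<and> f (w, u) = (f (w, v) + 1) mod L \<and>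
     f (u, v) = (f (u, w) + 1) mod L"

text \<open>A triangle is ascending with probability \<open>1 / L ^ 3\<close>, which the factor
  \<open>L ^ 3\<close> compensates. For a fixed arc the events for different third vertices
  prescribe disjoint sets of labels and are pairwise independent, so the variance of the cover is at
  most \<open>L ^ 3 * \<delta>\<close> times its mean.\<close>

lemma random_labels:
  fixes X :: "'a \<Rightarrow> 'a \<Rightarrow> 'a \<Rightarrow> real"
  assumes V: "finite V" and L: "L > 0"
    and X: "\<And>u v w. 0 \<le> X u v w" "\<And>u v w. X u v w \<le> \<delta>"
      "\<And>u v w. \<not> distinct [u, v, w] \<Longrightarrow> X u v w = 0"
    and \<gamma>: "\<And>u v. real L ^ 3 * \<delta> * (\<Sum>w\<in>V. X u v w) \<le> \<gamma>\<^sup>2" "\<gamma> > 0"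
  shows "\<exists>f. (\<forall>a\<in>V. \<forall>b\<in>V. f (a, b) < L) \<and>
    (\<Sum>u\<in>V. \<Sum>v\<in>V. \<bar>(\<Sum>w\<in>V. real L ^ 3 * X u v w * of_bool (ascending L f u v w)) - (\<Sum>w\<in>V. X u v w)\<bar>)
      \<le> \<gamma> * (real (card V))\<^sup>2"
proof -
  define \<Omega> where "\<Omega> = (\<Pi>\<^sub>E i\<in>V \<times> V. {..<L})"
  have \<Omega>: "finite \<Omega>" unfolding \<Omega>_def using V by (intro finite_PiE) auto
  have ne: "\<Omega> \<noteq> {}" using L by (auto simp: \<Omega>_def PiE_eq_empty_iff)
  define m where "m = real (card \<Omega>)"
  have m: "m > 0" using \<Omega> ne by (simp add: m_def card_gt_0_iff)
  define asc where "asc u v w f = (of_bool (ascending L f u v w) :: real)" for u v w :: 'a and f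
  define Y where "Y u v f = (\<Sum>w\<in>V. real L ^ 3 * X u v w * asc u v w f)" for u v f
  define W where "W u v = (\<Sum>w\<in>V. X u v w)" for u v
  have W0: "0 \<le> W u v" for u v using X(1) by (auto simp: W_def intro!: sum_nonneg)
  have dev: "(\<Sum>f\<in>\<Omega>. \<bar>Y u v f - W u v\<bar>) \<le> \<gamma> * m" if uv: "u \<in> V" "v \<in> V" for u v
  proof (cases "u = v")
    case True
    then have "X u v w = 0" for w using X(3)[of u v w] by simp
    then show ?thesis using m \<gamma>(2) by (simp add: Y_def W_def)
  next
    case False
    define Jc where "Jc w = {(v, w), (w, u), (u, w)}" for w
    define V' where "V' = V - {u, v}"
    have V': "finite V'" "\<And>w. w \<in> V' \<Longrightarrow> w \<in> V \<and> w \<noteq> u \<and> w \<noteq> v" using V by (auto simp: V'_def)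
    \<comment> \<open>The condition at u is solved for \<open>f (u, w)\<close>, because
      \<open>f (u, v)\<close> is common to all w. Adding L before subtracting 1 avoids truncated
      subtraction.\<close>
    define g where "g j f = (if fst j = v then (f (v, u) + 1) mod L else
      if fst j = u then (f (u, v) + L - 1) mod L else (f (fst j, v) + 1) mod L)" for j :: "'a \<times> 'a" and f :: "'a \<times> 'a \<Rightarrow> nat"
    have pred: "(y = (x + 1) mod L) \<longleftrightarrow> (x = (y + L - 1) mod L)" if "x < L" "y < L" for x y :: nat
    proof -
      have "(x + 1) mod L = (if x + 1 = L then 0 else x + 1)" using that by simp
      moreover have "(y + L - 1) mod L = (if y = 0 then L - 1 else y - 1)"
      proof (cases "y = 0")
        case False
        then have "y + L - 1 = (y - 1) + L" by linarith
        then have "(y + L - 1) mod L = (y - 1) mod L" by (metis mod_add_self2)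
        then show ?thesis using False that by simp
      qed (use that in simp)
      ultimately show ?thesis using that by (simp split: if_split) linarith
    qed
    have asc: "asc u v w f = of_bool (\<forall>j\<in>Jc w. f j = g j f)" if "f \<in> \<Omega>" "w \<in> V'" for f w
    proof -
      have "f (u, v) < L" "f (u, w) < L"
        using that uv V'(2)[OF that(2)] PiE_mem[of f "V \<times> V"] by (auto simp: \<Omega>_def)
      then have "(f (u, v) = (f (u, w) + 1) mod L) \<longleftrightarrow> (f (u, w) = (f (u, v) + L - 1) mod L)"
        by (intro pred)
      then show ?thesis using False V'(2)[OF that(2)]
        by (simp add: asc_def ascending_def Jc_def g_def)
    qed
    have prob: "real L ^ card K * (\<Sum>f\<in>\<Omega>. of_bool (\<forall>j\<in>K. f j = g j f)) = m"
      if K: "K \<subseteq> (\<Union>w\<in>V'. Jc w)" for K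
      unfolding m_def \<Omega>_def
    proof (rule sum_PiE_fresh_coordinates)
      show "K \<subseteq> V \<times> V" using K uv V'(2) by (auto simp: Jc_def)
      show "g j (f(i := c)) = g j f" if "i \<in> K" "j \<in> K" for f c i j
        using subsetD[OF K that(1)] V'(2) False by (auto simp: g_def Jc_def)
      show "g j f < L" for f j using L by (simp add: g_def)
    qed (use V L in auto)
    have p1: "real L ^ 3 * (\<Sum>f\<in>\<Omega>. asc u v w f) = m" if "w \<in> V'" for w
    proof -
      have "card (Jc w) = 3" using V'(2)[OF that] False by (auto simp: Jc_def)
      moreover have "(\<Sum>f\<in>\<Omega>. asc u v w f) = (\<Sum>f\<in>\<Omega>. of_bool (\<forall>j\<in>Jc w. f j = g j f))"
        using asc that by (intro sum.cong) auto
      ultimately show ?thesis using prob[of "Jc w"] that by auto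
    qed
    have p2: "real L ^ 3 * (real L ^ 3 * (\<Sum>f\<in>\<Omega>. asc u v w f * asc u v w' f)) = m"
      if w: "w \<in> V'" "w' \<in> V'" "w \<noteq> w'" for w w'
    proof -
      have "Jc w \<inter> Jc w' = {}" using V'(2)[OF w(1)] V'(2)[OF w(2)] w(3) by (auto simp: Jc_def)
      moreover have "card (Jc w) = 3" "card (Jc w') = 3"
        using V'(2)[OF w(1)] V'(2)[OF w(2)] False by (auto simp: Jc_def)
      moreover have "finite (Jc w)" "finite (Jc w')" by (auto simp: Jc_def)
      ultimately have "card (Jc w \<union> Jc w') = 6" by (simp add: card_Un_disjoint)
      moreover have "(\<Sum>f\<in>\<Omega>. asc u v w f * asc u v w' f) = (\<Sum>f\<in>\<Omega>. of_bool (\<forall>j\<in>Jc w \<union> Jc w'. f j = g j f))"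
        using asc w by (intro sum.cong refl) (auto simp: ball_Un)
      ultimately have "real L ^ 6 * (\<Sum>f\<in>\<Omega>. asc u v w f * asc u v w' f) = m"
        using prob[of "Jc w \<union> Jc w'"] w by auto
      then show ?thesis by (simp add: mult.assoc[symmetric] power_add[symmetric])
    qed
    have zero: "X u v w = 0" if "w \<in> V - V'" for w
      using that X(3)[of u v w] by (auto simp: V'_def)
    have WV': "W u v = (\<Sum>w\<in>V'. X u v w)"
      unfolding W_def using V zero by (intro sum.mono_neutral_right) (auto simp: V'_def)
    have YV': "Y u v f = (\<Sum>w\<in>V'. real L ^ 3 * X u v w * asc u v w f)" for f
      unfolding Y_def using V zero by (intro sum.mono_neutral_right) (auto simp: V'_def)
    have EY: "(\<Sum>f\<in>\<Omega>. Y u v f) = W u v * m"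
    proof -
      have "(\<Sum>f\<in>\<Omega>. Y u v f) = (\<Sum>w\<in>V'. X u v w * (real L ^ 3 * (\<Sum>f\<in>\<Omega>. asc u v w f)))"
        unfolding YV' sum_distrib_left by (subst sum.swap) (intro sum.cong refl, simp)
      also have "\<dots> = (\<Sum>w\<in>V'. X u v w * m)" using p1 by (intro sum.cong) auto
      finally show ?thesis by (simp add: WV' sum_distrib_right)
    qed
    have EY2: "(\<Sum>f\<in>\<Omega>. (Y u v f)\<^sup>2) \<le> ((W u v)\<^sup>2 + \<gamma>\<^sup>2) * m"
    proof -
      have "(\<Sum>f\<in>\<Omega>. (Y u v f)\<^sup>2) = (\<Sum>f\<in>\<Omega>. \<Sum>w\<in>V'. \<Sum>w'\<in>V'. X u v w * X u v w' *
          (real L ^ 3 * (real L ^ 3 * (asc u v w f * asc u v w' f))))"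
        unfolding YV' power2_eq_square sum_product by (simp add: mult_ac)
      also have "\<dots> = (\<Sum>w\<in>V'. \<Sum>f\<in>\<Omega>. \<Sum>w'\<in>V'. X u v w * X u v w' *
          (real L ^ 3 * (real L ^ 3 * (asc u v w f * asc u v w' f))))"
        by (rule sum.swap)
      also have "\<dots> = (\<Sum>w\<in>V'. \<Sum>w'\<in>V'. X u v w * X u v w' *
          (real L ^ 3 * (real L ^ 3 * (\<Sum>f\<in>\<Omega>. asc u v w f * asc u v w' f))))"
        by (subst sum.swap) (simp add: sum_distrib_left)
      also have "\<dots> \<le> (\<Sum>w\<in>V'. \<Sum>w'\<in>V'. X u v w * X u v w' * m +
          (if w' = w then X u v w * (real L ^ 3 * \<delta> * m) else 0))"
      proof (intro sum_mono)
        fix w w' assume w: "w \<in> V'" "w' \<in> V'"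
        show "X u v w * X u v w' * (real L ^ 3 * (real L ^ 3 * (\<Sum>f\<in>\<Omega>. asc u v w f * asc u v w' f)))
          \<le> X u v w * X u v w' * m + (if w' = w then X u v w * (real L ^ 3 * \<delta> * m) else 0)"
        proof (cases "w' = w")
          case False
          then show ?thesis using p2[OF w] by simp
        next
          case True
          have "(\<Sum>f\<in>\<Omega>. asc u v w f * asc u v w f) = (\<Sum>f\<in>\<Omega>. asc u v w f)"
            by (intro sum.cong refl) (auto simp: asc_def)
          then have "X u v w * X u v w * (real L ^ 3 * (real L ^ 3 * (\<Sum>f\<in>\<Omega>. asc u v w f * asc u v w f)))
              = X u v w * X u v w * (real L ^ 3 * m)" using p1[OF w(1)] by simp
          also have "\<dots> \<le> X u v w * \<delta> * (real L ^ 3 * m)"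
            using X m by (intro mult_right_mono mult_left_mono) auto
          finally have "X u v w * X u v w * (real L ^ 3 * (real L ^ 3 * (\<Sum>f\<in>\<Omega>. asc u v w f * asc u v w f)))
              \<le> X u v w * (real L ^ 3 * \<delta> * m)" by (simp add: mult_ac)
          moreover have "0 \<le> X u v w * X u v w * m" using m by simp
          ultimately show ?thesis using True by simp
        qed
      qed
      also have "\<dots> = (W u v)\<^sup>2 * m + W u v * (real L ^ 3 * \<delta> * m)"
      proof -
        have "(\<Sum>w\<in>V'. \<Sum>w'\<in>V'. X u v w * X u v w' * m) = (\<Sum>w\<in>V'. \<Sum>w'\<in>V'. X u v w * X u v w') * m"
          by (simp only: sum_distrib_right)
        moreover have "(\<Sum>w\<in>V'. X u v w * (real L ^ 3 * \<delta> * m)) = W u v * (real L ^ 3 * \<delta> * m)"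
          by (simp only: sum_distrib_right WV')
        ultimately show ?thesis using V'(1)
          by (simp add: sum.distrib WV' power2_eq_square sum_product)
      qed
      also have "\<dots> = (W u v)\<^sup>2 * m + (real L ^ 3 * \<delta> * W u v) * m" by simp
      also have "\<dots> \<le> (W u v)\<^sup>2 * m + \<gamma>\<^sup>2 * m"
        using \<gamma>(1)[of u v] m by (intro add_left_mono mult_right_mono) (auto simp: W_def)
      finally show ?thesis by (simp add: distrib_right)
    qed
    have "2 * \<gamma> * \<bar>Y u v f - W u v\<bar> \<le> (Y u v f)\<^sup>2 - 2 * W u v * Y u v f + ((W u v)\<^sup>2 + \<gamma>\<^sup>2)" for f
    proof -
      have "0 \<le> (\<bar>Y u v f - W u v\<bar> - \<gamma>)\<^sup>2" by simp
      then show ?thesis by (simp add: power2_diff algebra_simps)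
    qed
    then have "(\<Sum>f\<in>\<Omega>. 2 * \<gamma> * \<bar>Y u v f - W u v\<bar>)
        \<le> (\<Sum>f\<in>\<Omega>. (Y u v f)\<^sup>2 - 2 * W u v * Y u v f + ((W u v)\<^sup>2 + \<gamma>\<^sup>2))"
      by (rule sum_mono)
    also have "\<dots> = (\<Sum>f\<in>\<Omega>. (Y u v f)\<^sup>2) - 2 * W u v * (\<Sum>f\<in>\<Omega>. Y u v f) + m * ((W u v)\<^sup>2 + \<gamma>\<^sup>2)"
      by (simp add: sum.distrib sum_subtractf sum_distrib_left m_def)
    also have "\<dots> \<le> 2 * \<gamma> * (\<gamma> * m)"
      using EY2 unfolding EY by (simp add: algebra_simps power2_eq_square)
    finally have "2 * \<gamma> * (\<Sum>f\<in>\<Omega>. \<bar>Y u v f - W u v\<bar>) \<le> 2 * \<gamma> * (\<gamma> * m)"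
      by (simp add: sum_distrib_left)
    then show ?thesis using \<gamma>(2) by simp
  qed
  define tot where "tot f = (\<Sum>u\<in>V. \<Sum>v\<in>V. \<bar>Y u v f - W u v\<bar>)" for f
  have "(\<Sum>f\<in>\<Omega>. tot f) = (\<Sum>u\<in>V. \<Sum>v\<in>V. \<Sum>f\<in>\<Omega>. \<bar>Y u v f - W u v\<bar>)"
    unfolding tot_def by (subst sum.swap) (intro sum.cong refl sum.swap)
  also have "\<dots> \<le> (\<Sum>u\<in>V. \<Sum>v\<in>V. \<gamma> * m)" by (intro sum_mono dev)
  also have "\<dots> = (\<Sum>f\<in>\<Omega>. \<gamma> * (real (card V))\<^sup>2)" by (simp add: power2_eq_square m_def)
  finally have le: "(\<Sum>f\<in>\<Omega>. tot f) \<le> (\<Sum>f\<in>\<Omega>. \<gamma> * (real (card V))\<^sup>2)" .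
  have "\<exists>f\<in>\<Omega>. tot f \<le> \<gamma> * (real (card V))\<^sup>2"
  proof (rule ccontr)
    assume "\<not> ?thesis"
    then have "(\<Sum>f\<in>\<Omega>. \<gamma> * (real (card V))\<^sup>2) < (\<Sum>f\<in>\<Omega>. tot f)"
      using \<Omega> ne by (intro sum_strict_mono) (auto simp: not_le)
    with le show False by simp
  qed
  then obtain f where "f \<in> \<Omega>" "tot f \<le> \<gamma> * (real (card V))\<^sup>2" by blast
  then show ?thesis
    by (intro exI[of _ f]) (auto simp: \<Omega>_def tot_def Y_def W_def asc_def)
qed

section \<open>Cyclic extensions of partial injections\<close>

text \<open>Composition with the transposition of two elements in different orbits merges these
  orbits and changes the permutation at these two elements only. As R meets every orbit, merging
  inside R ends with a single orbit; a second representative of the same orbit is dropped.\<close>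

lemma cyclic_on_merge_orbits:
  assumes "finite A" "\<pi> permutes A" "R \<subseteq> A" "R \<noteq> {}"
    and "\<And>a. a \<in> A \<Longrightarrow> \<exists>r\<in>R. a \<in> orbit \<pi> r"
  shows "\<exists>g. cyclic_on g A \<and> (\<forall>a\<in>A - R. g a = \<pi> a)"
  using assms(2-)
proof (induction "card R" arbitrary: R \<pi> rule: less_induct)
  case less
  have R: "finite R" using less.prems(2) assms(1) by (rule finite_subset)
  have perm: "permutation \<pi>" using less.prems(1) assms(1) by (auto simp: permutation_permutes)
  have self: "a \<in> orbit \<pi> a" for a using perm by (rule permutation_self_in_orbit)
  obtain r where r: "r \<in> R" using less.prems(3) by auto
  show ?case
  proof (cases "R = {r}")
    case True
    have "orbit \<pi> r \<subseteq> A"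
    proof
      fix x assume "x \<in> orbit \<pi> r"
      then show "x \<in> A"
        using less.prems(1,2) r by induction (auto simp: permutes_in_image)
    qed
    then have "A = orbit \<pi> r" using less.prems(4) True by auto
    then have "cyclic_on \<pi> A" using r less.prems(2) by (auto simp: cyclic_on_def)
    then show ?thesis by auto
  next
    case False
    then obtain r' where r': "r' \<in> R" "r' \<noteq> r" using r by auto
    have card: "card (R - {r'}) < card R" using r' R by (intro psubset_card_mono) auto
    have sub: "R - {r'} \<subseteq> A" "R - {r'} \<noteq> {}" using less.prems(2) r r' by auto
    show ?thesis
    proof (cases "r' \<in> orbit \<pi> r")
      case True
      have "\<exists>r\<in>R - {r'}. a \<in> orbit \<pi> r" if "a \<in> A" for a
        using less.prems(4)[OF that] True r r' orbit_trans by (metis Diff_iff singletonD)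
      then obtain g where "cyclic_on g A" "\<forall>a\<in>A - (R - {r'}). g a = \<pi> a"
        using less.hyps[OF card less.prems(1) sub] by blast
      then show ?thesis by (intro exI[of _ g]) auto
    next
      case False
      define \<sigma> where "\<sigma> = \<pi> \<circ> transpose r r'"
      have \<sigma>: "\<sigma> r = \<pi> r'" "\<sigma> r' = \<pi> r" "\<And>a. a \<noteq> r \<Longrightarrow> a \<noteq> r' \<Longrightarrow> \<sigma> a = \<pi> a"
        by (auto simp: \<sigma>_def)
      have "\<sigma> permutes A"
        unfolding \<sigma>_def using less.prems(1,2) r r'
        by (intro permutes_compose permutes_swap_id) auto
      moreover have "\<exists>t\<in>R - {r'}. a \<in> orbit \<sigma> t" if "a \<in> A" for a
      proof -
        have r_notin: "r \<notin> orbit \<pi> r'"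
          using False orbit_swap[OF self[of r'], of r] by auto
        have B1: "y \<in> orbit \<sigma> r" if "y \<in> orbit \<pi> r'" for y
          using that
        proof induction
          case base
          show ?case using \<sigma>(1) orbit.base[of \<sigma> r] by simp
        next
          case (step y)
          show ?case
          proof (cases "y = r'")
            case True
            then show ?thesis using \<sigma>(1) orbit.base[of \<sigma> r] by simp
          next
            case False
            moreover have "y \<noteq> r" using step.hyps r_notin by auto
            ultimately show ?thesis using \<sigma>(3)[of y] orbit.step[OF step.IH] by simp
          qed
        qed
        have "r' \<in> orbit \<sigma> r" using B1 self by auto
        then have pr: "\<pi> r \<in> orbit \<sigma> r" using \<sigma>(2) orbit.step by metis
        have B2: "y \<in> orbit \<sigma> r" if "y \<in> orbit \<pi> r" for y
          using that
        proof induction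
          case base
          show ?case by (rule pr)
        next
          case (step y)
          show ?case
          proof (cases "y = r")
            case True
            then show ?thesis using pr by simp
          next
            case False
            moreover have "y \<noteq> r'" using step.hyps \<open>r' \<notin> orbit \<pi> r\<close> by auto
            ultimately show ?thesis using \<sigma>(3)[of y] orbit.step[OF step.IH] by simp
          qed
        qed
        obtain t where t: "t \<in> R" "a \<in> orbit \<pi> t" using less.prems(4)[OF \<open>a \<in> A\<close>] by auto
        show ?thesis
        proof (cases "r \<in> orbit \<pi> t \<or> r' \<in> orbit \<pi> t")
          case True
          then have "a \<in> orbit \<pi> r \<or> a \<in> orbit \<pi> r'"
            using t orbit_swap[OF self[of t]] orbit_trans[OF t(2)] by blast
          then show ?thesis using B1 B2 r r' by auto
        next
          case False
          have "y \<in> orbit \<sigma> t" if "y \<in> orbit \<pi> t" for y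
            using that
          proof induction
            case base
            have "t \<noteq> r" "t \<noteq> r'" using False self by auto
            then show ?case using \<sigma>(3)[of t] orbit.base[of \<sigma> t] by simp
          next
            case (step y)
            then have "y \<noteq> r" "y \<noteq> r'" using False by auto
            then show ?case using \<sigma>(3)[of y] orbit.step[OF step.IH] by simp
          qed
          moreover have "t \<noteq> r'" using False self by auto
          ultimately show ?thesis using t by auto
        qed
      qed
      ultimately obtain g where g: "cyclic_on g A" "\<And>a. a \<in> A - (R - {r'}) \<Longrightarrow> g a = \<sigma> a"
        using less.hyps[OF card _ sub] by blast
      have "g a = \<pi> a" if "a \<in> A - R" for a
      proof -
        have "a \<noteq> r" "a \<noteq> r'" using that r r' by auto
        then show ?thesis using g(2)[of a] \<sigma>(3)[of a] that by auto
      qed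
      then show ?thesis using g(1) by blast
    qed
  qed
qed

lemma permutes_extension:
  assumes "finite A" "D \<subseteq> A" "inj_on f D" "f ` D \<subseteq> A"
  shows "\<exists>\<pi>. \<pi> permutes A \<and> (\<forall>u\<in>D. \<pi> u = f u)"
proof -
  have "card (A - D) = card (A - f ` D)"
    using assms by (simp add: card_Diff_subset finite_subset card_image)
  then obtain h where h: "bij_betw h (A - D) (A - f ` D)"
    using assms(1) by (metis finite_Diff finite_same_card_bij)
  define \<pi> where "\<pi> u = (if u \<in> D then f u else if u \<in> A then h u else u)" for u
  have "bij_betw \<pi> D (f ` D)"
    using assms(3) by (auto simp: \<pi>_def bij_betw_def inj_on_def)
  moreover have "bij_betw \<pi> (A - D) (A - f ` D)"
    using h by (subst bij_betw_cong[of _ _ h]) (auto simp: \<pi>_def)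
  ultimately have "bij_betw \<pi> (D \<union> (A - D)) (f ` D \<union> (A - f ` D))"
    by (rule bij_betw_combine) auto
  then have "bij_betw \<pi> A A" using assms(2,4) by (simp add: Un_absorb1)
  then have "\<pi> permutes A" using assms(2) by (intro bij_imp_permutes) (auto simp: \<pi>_def)
  then show ?thesis by (auto simp: \<pi>_def)
qed

text \<open>
  A label that increases by 1 modulo \<open>L\<close> along \<open>f\<close> takes every value on each cycle of \<open>f\<close>, so all
  cycles can be cut open at the elements of a rare label.
\<close>

lemma cyclic_extension:
  fixes lab :: "'a \<Rightarrow> nat"
  assumes "finite A" "A \<noteq> {}" "D \<subseteq> A" "inj_on f D" "f ` D \<subseteq> A" "L > 0"
    and lab: "\<And>u. u \<in> D \<Longrightarrow> lab (f u) = (lab u + 1) mod L" "\<And>u. u \<in> A \<Longrightarrow> lab u < L"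
  shows "\<exists>g. cyclic_on g A \<and> L * card {u \<in> D. g u \<noteq> f u} \<le> card A"
proof -
  have "\<exists>j<L. L * card {u \<in> A. lab u = j} \<le> card A"
  proof (rule ccontr)
    assume "\<not> (\<exists>j<L. L * card {u \<in> A. lab u = j} \<le> card A)"
    then have *: "card A < L * card {u \<in> A. lab u = j}" if "j < L" for j
      using that by (auto simp: not_le)
    have "(\<Sum>j<L. card {u \<in> A. lab u = j}) = card A"
      using assms(1) lab(2) sum_fun_comp[of A "{..<L}" lab "\<lambda>_. 1 :: nat"]
      by (simp add: image_subset_iff)
    then have "L * card A = (\<Sum>j<L. L * card {u \<in> A. lab u = j})"
      by (simp add: sum_distrib_left[symmetric])
    also have "\<dots> > (\<Sum>j<L. card A)" using * assms(6) by (intro sum_strict_mono) auto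
    finally show False by simp
  qed
  then obtain j where j: "j < L" "L * card {u \<in> A. lab u = j} \<le> card A" by blast
  obtain \<pi> where \<pi>: "\<pi> permutes A" "\<And>u. u \<in> D \<Longrightarrow> \<pi> u = f u"
    using permutes_extension[OF assms(1,3,4,5)] by auto
  \<comment> \<open>Outside D nothing is prescribed, so changes there are free; inside D only the
    elements with the rare label j are sacrificed.\<close>
  define R where "R = {u \<in> A. u \<notin> D \<or> lab u = j}"
  have perm: "permutation \<pi>" using \<pi>(1) assms(1) by (auto simp: permutation_permutes)
  have cover: "\<exists>r\<in>R. a \<in> orbit \<pi> r" if a: "a \<in> A" for a
  proof (rule ccontr)
    assume no: "\<not> (\<exists>r\<in>R. a \<in> orbit \<pi> r)"
    have in_orb: "(\<pi> ^^ k) a \<in> orbit \<pi> a" for k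
      using orbit_altdef_permutation[OF perm] by auto
    have in_A: "(\<pi> ^^ k) a \<in> A" for k
      using a \<pi>(1) by (induction k) (auto simp: permutes_in_image)
    have notR: "(\<pi> ^^ k) a \<notin> R" for k
      using no orbit_swap[OF permutation_self_in_orbit[OF perm] in_orb] by auto
    have "lab ((\<pi> ^^ k) a) = (lab a + k) mod L" for k
    proof (induction k)
      case 0
      show ?case using lab(2)[OF a] by simp
    next
      case (Suc k)
      have "(\<pi> ^^ k) a \<in> D" using notR[of k] in_A[of k] by (auto simp: R_def)
      then show ?case using lab(1) \<pi>(2) Suc.IH by (simp add: mod_Suc_eq)
    qed
    \<comment> \<open>The number of steps from the label of a to j modulo L; adding L keeps the
      natural difference from being truncated.\<close>
    from this[of "j + L - lab a"] have "lab ((\<pi> ^^ (j + L - lab a)) a) = j"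
      using lab(2)[OF a] j(1) by simp
    then show False using notR[of "j + L - lab a"] in_A[of "j + L - lab a"] by (auto simp: R_def)
  qed
  then have "R \<noteq> {}" using assms(2) by blast
  moreover have "R \<subseteq> A" by (auto simp: R_def)
  ultimately obtain g where g: "cyclic_on g A" "\<And>a. a \<in> A - R \<Longrightarrow> g a = \<pi> a"
    using cyclic_on_merge_orbits[OF assms(1) \<pi>(1) _ _ cover] by blast
  have "{u \<in> D. g u \<noteq> f u} \<subseteq> {u \<in> A. lab u = j}"
    using g(2) \<pi>(2) assms(3) by (auto simp: R_def)
  then have "card {u \<in> D. g u \<noteq> f u} \<le> card {u \<in> A. lab u = j}"
    using assms(1) by (intro card_mono) auto
  then have "L * card {u \<in> D. g u \<noteq> f u} \<le> card A"
    using j(2) by (meson le_trans mult_le_mono2)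
  then show ?thesis using g(1) by blast
qed

section \<open>From triangle packings to embeddings\<close>

text \<open>The facial walk as a set of arcs. The reverse triangle is a different, disjoint set, so
  both sides of a triangle may be packed.\<close>

definition tri :: "'a \<Rightarrow> 'a \<Rightarrow> 'a \<Rightarrow> ('a \<times> 'a) set" where
  "tri u v w = {(u, v), (v, w), (w, u)}"

lemma tri_rotate: "tri u v w = tri v w u"
  by (auto simp: tri_def)

lemma tri_eqD:
  assumes "distinct [u, v, w]" "tri u v w = tri a b c"
  shows "(a, b, c) = (u, v, w) \<or> (a, b, c) = (v, w, u) \<or> (a, b, c) = (w, u, v)"
proof -
  have "(a, b) \<in> tri u v w" "(b, c) \<in> tri u v w" using assms(2) by (auto simp: tri_def)
  then show ?thesis using assms(1) by (auto simp: tri_def)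
qed

lemma tri_third_eq:
  assumes "distinct [u, v, w]" "distinct [u, v, w']" "tri u v w = tri u v w'"
  shows "w = w'"
  using tri_eqD[OF assms(1,3)] assms(1) by auto

lemma tri_through_arc:
  assumes "(u, v) \<in> tri a b c"
  obtains w where "tri a b c = tri u v w" "(u, v, w) = (a, b, c) \<or> (u, v, w) = (b, c, a) \<or> (u, v, w) = (c, a, b)"
proof -
  from assms consider "u = a" "v = b" | "u = b" "v = c" | "u = c" "v = a" by (auto simp: tri_def)
  then show ?thesis
  proof cases
    case 1
    then show ?thesis using that[of c] by simp
  next
    case 2
    then show ?thesis using that[of a] tri_rotate[of a b c] by simp
  next
    case 3
    then show ?thesis using that[of b] tri_rotate[of c a b] by simp
  qed
qed

lemma card_tri: "distinct [u, v, w] \<Longrightarrow> card (tri u v w) = 3"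
  by (auto simp: tri_def)

lemma ascending_rotate: "ascending L f u v w = ascending L f v w u"
  by (auto simp: ascending_def)

lemma cover_cost_lipschitz: "cover_cost t \<le> cover_cost t' + 2 * \<bar>t - t'\<bar>"
  unfolding cover_cost_def by (auto simp: abs_if max_def)

text \<open>With arcs as points and directed triangles as triples, the weighted degree of an arc is
  its cover t. Truncation loses the excess once per triple and thus three points each time;
  \<open>1 - t + 3 * max 0 (t - 1)\<close> is \<open>cover_cost t\<close>.\<close>

lemma triangle_packing:
  fixes \<eta> :: real
  assumes "\<eta> > 0"
  obtains \<delta> :: real where "\<delta> > 0"
    "\<And>V (E :: ('a \<times> 'a) set) Y. finite V \<Longrightarrow> E \<subseteq> V \<times> V \<Longrightarrow> (\<And>u v w. 0 \<le> Y u v w \<and> Y u v w \<le> \<delta>) \<Longrightarrow>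
      (\<And>u v w. Y u v w = Y v w u) \<Longrightarrow> (\<And>u v w. Y u v w \<noteq> 0 \<Longrightarrow> distinct [u, v, w] \<and> tri u v w \<subseteq> E) \<Longrightarrow>
      \<exists>M. (\<forall>T\<in>M. \<exists>u v w. T = tri u v w \<and> Y u v w \<noteq> 0) \<and> disjoint M \<and>
        real (card E) - 3 * real (card M) \<le> (\<Sum>(u, v)\<in>E. cover_cost (\<Sum>w\<in>V. Y u v w)) + \<eta> * real (card E)"
proof -
  obtain \<delta> where \<delta>: "\<delta> > 0" and match: "\<And>(X :: ('a \<times> 'a) set) H (x :: ('a \<times> 'a) set \<Rightarrow> real). linear_triples X H \<Longrightarrow>
     (\<forall>T\<in>H. 0 \<le> x T \<and> x T \<le> \<delta>) \<Longrightarrow> (\<forall>e\<in>X. wdeg H x e \<le> 1) \<Longrightarrow>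
     (\<exists>M\<subseteq>H. disjoint M \<and> real (card X) - 3 * real (card M) \<le> real (card X) - 3 * (\<Sum>T\<in>H. x T) + \<eta> * card X)"
    using near_perfect_matching[OF assms] by metis
  have main: "\<exists>M. (\<forall>T\<in>M. \<exists>u v w. T = tri u v w \<and> Y u v w \<noteq> 0) \<and> disjoint M \<and>
        real (card E) - 3 * real (card M) \<le> (\<Sum>(u, v)\<in>E. cover_cost (\<Sum>w\<in>V. Y u v w)) + \<eta> * real (card E)"
    if V: "finite V" and E: "E \<subseteq> V \<times> V" and Y: "\<And>u v w. 0 \<le> Y u v w \<and> Y u v w \<le> \<delta>"
      and cyc: "\<And>u v w. Y u v w = Y v w u"
      and supp: "\<And>u v w. Y u v w \<noteq> 0 \<Longrightarrow> distinct [u, v, w] \<and> tri u v w \<subseteq> E"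
    for V and E :: "('a \<times> 'a) set" and Y
  proof -
    have finE: "finite E" using V E finite_subset by blast
    define H where "H = {tri u v w | u v w. Y u v w \<noteq> 0}"
    \<comment> \<open>A directed triangle has three descriptions by ordered vertices; cyclic
      invariance of Y makes the choice immaterial.\<close>
    define x where "x T = (SOME r. \<exists>u v w. T = tri u v w \<and> Y u v w \<noteq> 0 \<and> r = Y u v w)" for T
    have x_tri: "x (tri u v w) = Y u v w" if "Y u v w \<noteq> 0" for u v w
    proof -
      have "r = Y u v w" if "\<exists>a b c. tri u v w = tri a b c \<and> Y a b c \<noteq> 0 \<and> r = Y a b c" for r
      proof -
        from that obtain a b c where abc: "tri u v w = tri a b c" "r = Y a b c" by blast
        have "distinct [u, v, w]" using supp[OF \<open>Y u v w \<noteq> 0\<close>] by (rule conjunct1)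
        from tri_eqD[OF this abc(1)]
        have "(a, b, c) = (u, v, w) \<or> (a, b, c) = (v, w, u) \<or> (a, b, c) = (w, u, v)" .
        then show ?thesis using abc(2) cyc[of u v w] cyc[of v w u] by auto
      qed
      moreover have "\<exists>a b c. tri u v w = tri a b c \<and> Y a b c \<noteq> 0 \<and> x (tri u v w) = Y a b c"
        unfolding x_def by (rule someI_ex) (use that in blast)
      ultimately show ?thesis by blast
    qed
    have H_arc: "\<exists>w. T = tri u v w \<and> Y u v w \<noteq> 0 \<and> distinct [u, v, w] \<and> w \<in> V"
      if T: "T \<in> H" "(u, v) \<in> T" for T u v
    proof -
      from T obtain a b c where abc: "T = tri a b c" "Y a b c \<noteq> 0" by (auto simp: H_def)
      have "(u, v) \<in> tri a b c" using T(2) abc(1) by simp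
      then obtain w where "tri a b c = tri u v w" and
        w2: "(u, v, w) = (a, b, c) \<or> (u, v, w) = (b, c, a) \<or> (u, v, w) = (c, a, b)"
        by (rule tri_through_arc)
      then have w: "T = tri u v w" using abc(1) by simp
      have Y0: "Y u v w \<noteq> 0" using w2 abc(2) cyc[of a b c] cyc[of b c a] by auto
      have "(v, w) \<in> E" using supp[OF Y0] by (auto simp: tri_def)
      then have "w \<in> V" using E by auto
      then show ?thesis using w Y0 supp[OF Y0] by (intro exI[of _ w]) auto
    qed
    have lin: "linear_triples E H"
      unfolding linear_triples_def
    proof (intro conjI ballI allI impI finE)
      fix T assume "T \<in> H"
      then obtain a b c where abc: "T = tri a b c" "Y a b c \<noteq> 0" by (auto simp: H_def)
      show "T \<subseteq> E" "card T = 3" using supp[OF abc(2)] card_tri[of a b c] abc(1) by auto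
    next
      \<comment> \<open>Two arcs determine a directed triangle: the first fixes u and v, the second
        the remaining vertex.\<close>
      fix T T' e f assume T: "T \<in> H" "T' \<in> H" "e \<noteq> f" "{e, f} \<subseteq> T \<inter> T'"
      obtain u v where e: "e = (u, v)" by (cases e)
      obtain w where w: "T = tri u v w" "distinct [u, v, w]" using H_arc[of T u v] T e by auto
      obtain w' where w': "T' = tri u v w'" "distinct [u, v, w']" using H_arc[of T' u v] T e by auto
      have "f \<in> tri u v w" "f \<in> tri u v w'" using T w w' by auto
      then have "w = w'" using w(2) w'(2) T(3) e by (auto simp: tri_def)
      then show "T = T'" using w w' by simp
    qed
    have finH: "finite H" using lin by (rule linear_triples_finite)
    have wdeg: "wdeg H x (u, v) = (\<Sum>w\<in>V. Y u v w)" for u v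
    proof -
      have "wdeg H x (u, v) = (\<Sum>w\<in>{w \<in> V. Y u v w \<noteq> 0}. x (tri u v w))"
        unfolding wdeg_def
      proof (rule sum.reindex_cong[where l = "tri u v"])
        show "inj_on (tri u v) {w \<in> V. Y u v w \<noteq> 0}"
        proof (rule inj_onI)
          fix w w' assume w: "w \<in> {w \<in> V. Y u v w \<noteq> 0}" "w' \<in> {w \<in> V. Y u v w \<noteq> 0}" "tri u v w = tri u v w'"
          have "distinct [u, v, w]" "distinct [u, v, w']" using supp[of u v w] supp[of u v w'] w by auto
          then show "w = w'" using w(3) by (rule tri_third_eq)
        qed
        show "{T \<in> H. (u, v) \<in> T} = tri u v ` {w \<in> V. Y u v w \<noteq> 0}"
        proof
          show "{T \<in> H. (u, v) \<in> T} \<subseteq> tri u v ` {w \<in> V. Y u v w \<noteq> 0}"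
          proof
            fix T assume "T \<in> {T \<in> H. (u, v) \<in> T}"
            then obtain w where "T = tri u v w" "Y u v w \<noteq> 0" "w \<in> V" using H_arc[of T u v] by auto
            then show "T \<in> tri u v ` {w \<in> V. Y u v w \<noteq> 0}" by auto
          qed
          show "tri u v ` {w \<in> V. Y u v w \<noteq> 0} \<subseteq> {T \<in> H. (u, v) \<in> T}"
            unfolding H_def by (auto simp: tri_def)
        qed
      qed simp
      also have "\<dots> = (\<Sum>w\<in>{w \<in> V. Y u v w \<noteq> 0}. Y u v w)" using x_tri by (intro sum.cong) auto
      also have "\<dots> = (\<Sum>w\<in>V. Y u v w)" using V by (intro sum.mono_neutral_left) auto
      finally show ?thesis .
    qed
    have x_bd: "0 \<le> x T" "x T \<le> \<delta>" if T: "T \<in> H" for T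
    proof -
      from T obtain u v w where uvw: "T = tri u v w" "Y u v w \<noteq> 0" by (auto simp: H_def)
      show "0 \<le> x T" "x T \<le> \<delta>" using x_tri[OF uvw(2)] Y[of u v w] uvw(1) by auto
    qed
    obtain y where y: "\<And>T. T \<in> H \<Longrightarrow> 0 \<le> y T \<and> y T \<le> x T" "\<And>e. e \<in> E \<Longrightarrow> wdeg H y e \<le> 1"
      "(\<Sum>T\<in>H. x T) - (\<Sum>e\<in>E. max 0 (wdeg H x e - 1)) \<le> (\<Sum>T\<in>H. y T)"
      using truncate_weights[OF lin, of x] x_bd by blast
    have "\<forall>T\<in>H. 0 \<le> y T \<and> y T \<le> \<delta>" using y(1) x_bd(2) by (meson order_trans)
    then obtain M where M: "M \<subseteq> H" "disjoint M"
      "real (card E) - 3 * real (card M) \<le> real (card E) - 3 * (\<Sum>T\<in>H. y T) + \<eta> * card E"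
      using match[OF lin, of y] y(2) by blast
    have "real (card E) - 3 * (\<Sum>T\<in>H. y T) \<le> (\<Sum>e\<in>E. 1) - 3 * (\<Sum>T\<in>H. x T) + 3 * (\<Sum>e\<in>E. max 0 (wdeg H x e - 1))"
      using y(3) by simp
    also have "\<dots> = (\<Sum>e\<in>E. 1 - wdeg H x e + 3 * max 0 (wdeg H x e - 1))"
      unfolding sum_wdeg_triples[OF lin, of x, symmetric]
      by (simp only: sum.distrib sum_subtractf sum_distrib_left)
    also have "\<dots> = (\<Sum>(u, v)\<in>E. cover_cost (\<Sum>w\<in>V. Y u v w))"
    proof (rule sum.cong[OF refl])
      fix e assume "e \<in> E"
      obtain u v where e: "e = (u, v)" by (cases e)
      show "1 - wdeg H x e + 3 * max 0 (wdeg H x e - 1) = (case e of (u, v) \<Rightarrow> cover_cost (\<Sum>w\<in>V. Y u v w))"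
        unfolding e by (simp add: wdeg cover_cost_def max_def)
    qed
    finally have "real (card E) - 3 * real (card M) \<le> (\<Sum>(u, v)\<in>E. cover_cost (\<Sum>w\<in>V. Y u v w)) + \<eta> * real (card E)"
      using M(3) by linarith
    moreover have "\<forall>T\<in>M. \<exists>u v w. T = tri u v w \<and> Y u v w \<noteq> 0" using M(1) unfolding H_def by blast
    ultimately show ?thesis using M(2) by blast
  qed
  show ?thesis by (rule that[OF \<delta> main])
qed

lemma card_arcs_le:
  assumes "finite (uedges G)"
  shows "card (parcs G) \<le> 2 * card (uedges G)"
proof -
  define F where "F e = {(u, v). e = {u, v} \<and> (u, v) \<in> parcs G}" for e
  have F: "finite (F e) \<and> card (F e) \<le> 2" for e
  proof (cases "F e = {}")
    case False
    then obtain a b where ab: "e = {a, b}" by (auto simp: F_def)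
    have "F e \<subseteq> {(a, b), (b, a)}" unfolding F_def ab by (auto simp: doubleton_eq_iff)
    moreover have "card {(a, b), (b, a)} \<le> 2" by (cases "a = b") auto
    moreover have "finite {(a, b), (b, a)}" by simp
    ultimately show ?thesis using card_mono[of "{(a, b), (b, a)}" "F e"] finite_subset by auto
  qed simp
  have "parcs G \<subseteq> (\<Union>e\<in>uedges G. F e)" by (auto simp: uedges_def F_def)
  then have "card (parcs G) \<le> card (\<Union>e\<in>uedges G. F e)" using assms F by (intro card_mono) auto
  also have "\<dots> \<le> (\<Sum>e\<in>uedges G. card (F e))" using assms by (rule card_UN_le)
  also have "\<dots> \<le> (\<Sum>e\<in>uedges G. 2)" using F by (intro sum_mono) auto
  finally show ?thesis by simp
qed

lemma triangle_orbit:
  assumes "rot v u = w" "rot w v = u" "rot u w = v"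
  shows "orbit (face_step rot) (u, v) = tri u v w"
proof -
  have "orbit (face_step rot) (u, v) = {(face_step rot ^^ m) (u, v) | m. m < 3}"
    using assms by (intro orbit_altdef_bounded) (simp_all add: eval_nat_numeral)
  also have "{m :: nat. m < 3} = {0, 1, 2}" by auto
  then have "{(face_step rot ^^ m) (u, v) | m. m < 3} = (\<lambda>m. (face_step rot ^^ m) (u, v)) ` {0, 1, 2}" by blast
  also have "\<dots> = tri u v w" using assms by (simp add: tri_def eval_nat_numeral)
  finally show ?thesis .
qed

text \<open>Each packed triangle prescribes one value of the rotation at each of its corners. The
  cyclic extensions violate at most a fraction \<open>1 / L\<close> of the degree at each vertex,
  and a violated corner destroys one triangle, hence three covered arcs.\<close>

lemma embedding_of_packing:
  fixes G :: "'a pair_pre_digraph" and f :: "'a \<times> 'a \<Rightarrow> nat"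
  assumes G: "pair_graph G" and L: "L > 0" and f: "\<forall>a\<in>pverts G. \<forall>b\<in>pverts G. f (a, b) < L"
    and M: "\<And>T. T \<in> M \<Longrightarrow> \<exists>u v w. T = tri u v w \<and> distinct [u, v, w] \<and> tri u v w \<subseteq> parcs G \<and> ascending L f u v w"
    and disj: "disjoint M"
  shows "\<exists>rot. rotation_system G rot \<and> real (card {e \<in> uedges G. \<not> in_two_triangular_faces G rot e})
    \<le> real (card (parcs G)) - 3 * real (card M) + 3 * real (card (parcs G)) / real L"
proof -
  interpret pair_graph G by (rule G)
  define E where "E = parcs G"
  define nb where "nb v = E `` {v}" for v
  have E: "finite E" "\<And>u v. (u, v) \<in> E \<Longrightarrow> (v, u) \<in> E" "\<And>u v. (u, v) \<in> E \<Longrightarrow> u \<in> pverts G \<and> v \<in> pverts G"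
    using pair_finite_arcs pair_sym_arcs in_arcsD1 in_arcsD2
    by (auto simp: E_def symmetric_def sym_def)
  have finV: "finite (pverts G)" by (rule pair_finite_verts)
  have M_arc: "\<exists>w. T = tri u v w \<and> distinct [u, v, w] \<and> tri u v w \<subseteq> E \<and> ascending L f u v w"
    if T: "T \<in> M" "(u, v) \<in> T" for T u v
  proof -
    obtain a b c where abc: "T = tri a b c" "distinct [a, b, c]" "tri a b c \<subseteq> E" "ascending L f a b c"
      using M[OF T(1)] unfolding E_def by blast
    have "(u, v) \<in> tri a b c" using T(2) abc(1) by simp
    then obtain w where w: "tri a b c = tri u v w"
      "(u, v, w) = (a, b, c) \<or> (u, v, w) = (b, c, a) \<or> (u, v, w) = (c, a, b)"
      by (rule tri_through_arc)
    have "ascending L f u v w" "distinct [u, v, w]"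
      using w(2) abc(2,4) ascending_rotate[of L f a b c] ascending_rotate[of L f b c a] by auto
    then show ?thesis using w(1) abc(1,3) by auto
  qed
  have M_uniq: "T = T'" if "T \<in> M" "T' \<in> M" "e \<in> T" "e \<in> T'" for T T' e
    using disjointD[OF disj that(1,2)] that(3,4) by auto
  have third: "w = w'" if "distinct [u, v, w]" "tri u v w \<in> M" "distinct [u, v, w']" "tri u v w' \<in> M" for u v w w'
  proof -
    have "tri u v w = tri u v w'" using that by (intro M_uniq[of _ _ "(u, v)"]) (auto simp: tri_def)
    then show ?thesis by (rule tri_third_eq[OF that(1,3)])
  qed
  \<comment> \<open>Corners are indexed by the arc entering v, in accordance with face tracing:
    after the arc from u to v the face continues to \<open>nx v u\<close>.\<close>
  define Dm where "Dm v = {u. \<exists>w. distinct [u, v, w] \<and> tri u v w \<in> M}" for v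
  define nx where "nx v u = (SOME w. distinct [u, v, w] \<and> tri u v w \<in> M)" for v u
  have nx: "distinct [u, v, nx v u] \<and> tri u v (nx v u) \<in> M" if "u \<in> Dm v" for u v
    unfolding nx_def by (rule someI_ex) (use that in \<open>simp add: Dm_def\<close>)
  have nx_E: "tri u v (nx v u) \<subseteq> E" "ascending L f u v (nx v u)" if u: "u \<in> Dm v" for u v
  proof -
    obtain w where w: "tri u v (nx v u) = tri u v w" "distinct [u, v, w]" "tri u v w \<subseteq> E" "ascending L f u v w"
      using M_arc[of "tri u v (nx v u)" u v] nx[OF u] unfolding tri_def[of u v "nx v u"] by blast
    have "nx v u = w" using tri_third_eq[OF _ w(2,1)] nx[OF u] by blast
    then show "tri u v (nx v u) \<subseteq> E" "ascending L f u v (nx v u)" using w by auto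
  qed
  have "\<exists>g. nb v \<noteq> {} \<longrightarrow> cyclic_on g (nb v) \<and> L * card {u \<in> Dm v. g u \<noteq> nx v u} \<le> card (nb v)" for v
  proof (cases "nb v = {}")
    case False
    have "\<exists>g. cyclic_on g (nb v) \<and> L * card {u \<in> Dm v. g u \<noteq> nx v u} \<le> card (nb v)"
    proof (rule cyclic_extension[where lab = "\<lambda>u. f (v, u)"])
      show "finite (nb v)" using E(1) by (simp add: nb_def finite_Image)
      show "Dm v \<subseteq> nb v"
      proof
        fix u assume "u \<in> Dm v"
        then have "(u, v) \<in> E" using nx_E(1) by (auto simp: tri_def)
        then show "u \<in> nb v" using E(2) by (auto simp: nb_def)
      qed
      \<comment> \<open>The arc from v to the common successor lies in only one packed
        triangle.\<close>
      show "inj_on (nx v) (Dm v)"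
      proof (rule inj_onI)
        fix u u' assume u: "u \<in> Dm v" "u' \<in> Dm v" "nx v u = nx v u'"
        let ?w = "nx v u"
        have "distinct [v, ?w, u]" "tri v ?w u \<in> M" "distinct [v, ?w, u']" "tri v ?w u' \<in> M"
          using nx[OF u(1)] nx[OF u(2)] u(3) tri_rotate[of u v ?w] tri_rotate[of u' v ?w] by auto
        then show "u = u'" by (rule third)
      qed
      show "nx v ` Dm v \<subseteq> nb v" using nx_E(1) by (auto simp: tri_def nb_def)
      show "f (v, nx v u) = (f (v, u) + 1) mod L" if "u \<in> Dm v" for u
        using nx_E(2)[OF that] by (simp add: ascending_def)
      show "f (v, u) < L" if "u \<in> nb v" for u using that f E(3) by (auto simp: nb_def)
    qed (use False L in auto)
    then show ?thesis by auto
  qed simp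
  then have "\<forall>v. \<exists>g. nb v \<noteq> {} \<longrightarrow> cyclic_on g (nb v) \<and> L * card {u \<in> Dm v. g u \<noteq> nx v u} \<le> card (nb v)" by blast
  from choice[OF this] obtain rot where
    rot': "\<forall>v. nb v \<noteq> {} \<longrightarrow> cyclic_on (rot v) (nb v) \<and> L * card {u \<in> Dm v. rot v u \<noteq> nx v u} \<le> card (nb v)" ..
  have rot: "cyclic_on (rot v) (nb v)" "L * card {u \<in> Dm v. rot v u \<noteq> nx v u} \<le> card (nb v)"
    if "nb v \<noteq> {}" for v
    using rot' that by blast+
  have "rotation_system G rot"
    using rot(1) by (auto simp: rotation_system_def nb_def E_def)
  define Bk where "Bk = {(u, v). u \<in> Dm v \<and> rot v u \<noteq> nx v u}"
  have Dm_E: "(u, v) \<in> E" if "u \<in> Dm v" for u v using nx_E(1)[OF that] by (auto simp: tri_def)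
  have "Bk \<subseteq> E" using Dm_E by (auto simp: Bk_def)
  then have finBk: "finite Bk" using E(1) finite_subset by blast
  have card_Bk: "L * card Bk \<le> card E"
  proof -
    let ?S = "\<lambda>v. {u \<in> Dm v. rot v u \<noteq> nx v u}"
    have Dm_fin: "finite (Dm v)" for v
    proof (rule finite_subset)
      show "Dm v \<subseteq> fst ` E" using Dm_E by force
    qed (use E(1) in simp)
    have "Bk = (\<Union>v\<in>pverts G. (\<lambda>u. (u, v)) ` ?S v)"
    proof
      show "Bk \<subseteq> (\<Union>v\<in>pverts G. (\<lambda>u. (u, v)) ` ?S v)" using \<open>Bk \<subseteq> E\<close> E(3) by (auto simp: Bk_def)
      show "(\<Union>v\<in>pverts G. (\<lambda>u. (u, v)) ` ?S v) \<subseteq> Bk" by (auto simp: Bk_def)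
    qed
    then have "card Bk \<le> (\<Sum>v\<in>pverts G. card ((\<lambda>u. (u, v)) ` ?S v))" using card_UN_le[OF finV] by simp
    also have "\<dots> \<le> (\<Sum>v\<in>pverts G. card (?S v))" using Dm_fin by (intro sum_mono card_image_le) auto
    finally have "L * card Bk \<le> (\<Sum>v\<in>pverts G. L * card (?S v))"
      by (simp add: sum_distrib_left[symmetric])
    also have "\<dots> \<le> (\<Sum>v\<in>pverts G. card (nb v))"
    proof (rule sum_mono)
      fix v
      show "L * card (?S v) \<le> card (nb v)"
      proof (cases "nb v = {}")
        case True
        then have "Dm v = {}" using Dm_E E(2) by (force simp: nb_def)
        then show ?thesis by simp
      qed (rule rot(2))
    qed
    also have "\<dots> = card (SIGMA v:pverts G. nb v)"
      using E(1) finV by (subst card_SigmaI) (auto simp: nb_def finite_Image)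
    also have "(SIGMA v:pverts G. nb v) = E" using E(3) by (auto simp: nb_def)
    finally show ?thesis .
  qed
  define M0 where "M0 = {T \<in> M. T \<inter> Bk = {}}"
  have M_sub: "T \<subseteq> E" "card T = 3" if T: "T \<in> M" for T
  proof -
    obtain u v w where "T = tri u v w" "distinct [u, v, w]" "tri u v w \<subseteq> E" using M[OF T] unfolding E_def by blast
    then show "T \<subseteq> E" "card T = 3" using card_tri[of u v w] by auto
  qed
  have finM: "finite M" using M_sub(1) E(1) by (meson PowI finite_Pow_iff finite_subset subsetI)
  have intact: "T \<in> faces G rot" "triangular_face T" if T: "T \<in> M0" for T
  proof -
    obtain u v w where uvw: "T = tri u v w" "distinct [u, v, w]" "tri u v w \<subseteq> E"
      using M[of T] T by (auto simp: M0_def E_def)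
    have step: "rot b a = c" if abc: "tri a b c = T" "distinct [a, b, c]" for a b c
    proof -
      have TM: "tri a b c \<in> M" using T abc by (simp add: M0_def)
      then have a: "a \<in> Dm b" using abc(2) by (auto simp: Dm_def)
      then have "nx b a = c" using third[of a b "nx b a" c] nx[OF a] TM abc(2) by blast
      moreover have "(a, b) \<in> T" using abc(1) by (auto simp: tri_def)
      then have "(a, b) \<notin> Bk" using T by (auto simp: M0_def)
      ultimately show ?thesis using a by (auto simp: Bk_def)
    qed
    have "rot v u = w" "rot w v = u" "rot u w = v"
      using uvw tri_rotate[of u v w] tri_rotate[of v w u] by (auto intro!: step)
    then have "orbit (face_step rot) (u, v) = T" using triangle_orbit uvw(1) by metis
    moreover have "(u, v) \<in> parcs G" using uvw by (auto simp: tri_def E_def)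
    ultimately show "T \<in> faces G rot" unfolding faces_def by blast
    show "triangular_face T" unfolding triangular_face_def using uvw by (auto simp: tri_def)
  qed
  define Cov where "Cov = \<Union>M0"
  have card_unc: "real (card (E - Cov)) \<le> real (card E) - 3 * real (card M) + 3 * real (card Bk)"
  proof -
    have M0: "M0 \<subseteq> M" "finite M0" using finM by (auto simp: M0_def)
    have "card Cov = (\<Sum>T\<in>M0. card T)"
      unfolding Cov_def
    proof (rule card_Union_disjoint)
      show "pairwise disjnt M0" using disj M0(1) by (rule pairwise_subset)
      show "finite T" if "T \<in> M0" for T using that M0(1) M_sub(1) E(1) finite_subset by blast
    qed
    also have "\<dots> = (\<Sum>T\<in>M0. 3)" using M_sub(2) M0(1) by (intro sum.cong) auto
    finally have cCov: "card Cov = 3 * card M0" by simp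
    have Cov_E: "Cov \<subseteq> E" using M_sub(1) M0(1) by (auto simp: Cov_def)
    have "card (M - M0) \<le> card Bk"
    proof -
      define c where "c T = (SOME e. e \<in> T \<inter> Bk)" for T
      have c: "c T \<in> T \<inter> Bk" if "T \<in> M - M0" for T
      proof -
        have "\<exists>e. e \<in> T \<inter> Bk" using that by (auto simp: M0_def)
        then show ?thesis unfolding c_def by (rule someI_ex)
      qed
      have "inj_on c (M - M0)"
      proof (rule inj_onI)
        fix T T' assume T: "T \<in> M - M0" "T' \<in> M - M0" "c T = c T'"
        then have "c T \<in> T" "c T \<in> T'" using c[of T] c[of T'] by auto
        then show "T = T'" using T M_uniq[of T T' "c T"] by auto
      qed
      moreover have "c ` (M - M0) \<subseteq> Bk" using c by auto
      ultimately show ?thesis using finBk by (rule card_inj_on_le)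
    qed
    moreover have "card (M - M0) = card M - card M0" using M0 by (intro card_Diff_subset)
    moreover have "card M0 \<le> card M" using M0 finM by (intro card_mono)
    moreover have "card (E - Cov) = card E - card Cov"
      using Cov_E E(1) finite_subset by (intro card_Diff_subset) auto
    moreover have "card Cov \<le> card E" using Cov_E E(1) by (intro card_mono)
    ultimately show ?thesis using cCov by linarith
  qed
  have "{e \<in> uedges G. \<not> in_two_triangular_faces G rot e} \<subseteq> (\<lambda>(u, v). {u, v}) ` (E - Cov)"
  proof
    fix e assume "e \<in> {e \<in> uedges G. \<not> in_two_triangular_faces G rot e}"
    then obtain u v where e: "e = {u, v}" "(u, v) \<in> E" and bad: "\<not> in_two_triangular_faces G rot e"
      by (auto simp: uedges_def E_def)
    have "(u, v) \<notin> Cov \<or> (v, u) \<notin> Cov"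
    proof (rule ccontr)
      assume "\<not> ((u, v) \<notin> Cov \<or> (v, u) \<notin> Cov)"
      then obtain T T' where T: "T \<in> M0" "(u, v) \<in> T" "T' \<in> M0" "(v, u) \<in> T'" by (auto simp: Cov_def)
      \<comment> \<open>A triangle on distinct vertices never contains both arcs of an edge, so the
        two faces are different.\<close>
      have "(v, u) \<notin> T" using M_arc[of T u v] T by (auto simp: M0_def tri_def)
      then have "T \<noteq> T'" using T by auto
      moreover have "edge_on_face e T" "edge_on_face e T'"
        unfolding edge_on_face_def e(1) using T by (blast, metis insert_commute)
      ultimately have "in_two_triangular_faces G rot e"
        unfolding in_two_triangular_faces_def using T intact by blast
      then show False using bad by simp
    qed
    then show "e \<in> (\<lambda>(u, v). {u, v}) ` (E - Cov)"
    proof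
      assume "(u, v) \<notin> Cov"
      then show ?thesis using e by force
    next
      assume "(v, u) \<notin> Cov"
      then have "(v, u) \<in> E - Cov" using e(2) E(2) by simp
      moreover have "e = (case (v, u) of (u, v) \<Rightarrow> {u, v})" using e(1) by auto
      ultimately show ?thesis by (rule rev_image_eqI)
    qed
  qed
  then have "card {e \<in> uedges G. \<not> in_two_triangular_faces G rot e} \<le> card (E - Cov)"
    using E(1) by (intro order_trans[OF card_mono card_image_le]) auto
  moreover have "real (card Bk) \<le> real (card E) / real L"
  proof -
    have "real L * real (card Bk) \<le> real (card E)" using card_Bk by (metis of_nat_le_iff of_nat_mult)
    then show ?thesis using L by (simp add: field_simps)
  qed
  ultimately have "real (card {e \<in> uedges G. \<not> in_two_triangular_faces G rot e})
    \<le> real (card E) - 3 * real (card M) + 3 * real (card E) / real L" using card_unc by linarith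
  then show ?thesis using \<open>rotation_system G rot\<close> unfolding E_def by blast
qed

section \<open>From cut distance to a bilinear form\<close>

text \<open>A pair inside the intersection comes from two ordered pairs but is counted once by
  \<open>cut_weight\<close>; the second summand restores the difference.\<close>

lemma ordered_cut_sum:
  assumes "finite U" "finite W"
  shows "(\<Sum>u\<in>U. \<Sum>v\<in>W. if u \<noteq> v then w {u, v} else 0) = cut_weight w U W + cut_weight w (U \<inter> W) (U \<inter> W)"
proof -
  define D where "D = {x \<in> U \<times> W. fst x \<noteq> snd x}"
  define g where "g x = {fst x, snd x}" for x :: "'a \<times> 'a"
  define P where "P = {{u, v} | u v. u \<in> U \<and> v \<in> W \<and> u \<noteq> v}"
  define P' where "P' = {{u, v} | u v. u \<in> U \<inter> W \<and> v \<in> U \<inter> W \<and> u \<noteq> v}"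
  have D: "finite D" using assms by (simp add: D_def)
  have gD: "g ` D = P"
  proof
    show "g ` D \<subseteq> P" unfolding g_def D_def P_def by (auto, blast)
    show "P \<subseteq> g ` D"
    proof
      fix e assume "e \<in> P"
      then obtain u v where "e = {u, v}" "u \<in> U" "v \<in> W" "u \<noteq> v" by (auto simp: P_def)
      then show "e \<in> g ` D" by (intro image_eqI[of _ _ "(u, v)"]) (auto simp: g_def D_def)
    qed
  qed
  have P: "finite P" using D unfolding gD[symmetric] by simp
  have P': "P' \<subseteq> P" by (auto simp: P_def P'_def)
  have fib: "card {x \<in> D. g x = e} = 1 + of_bool (e \<in> P')" if "e \<in> P" for e
  proof -
    from that obtain u v where uv: "e = {u, v}" "u \<in> U" "v \<in> W" "u \<noteq> v" by (auto simp: P_def)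
    show ?thesis
    proof (cases "v \<in> U \<and> u \<in> W")
      case True
      then have "{x \<in> D. g x = e} = {(u, v), (v, u)}"
        using uv by (auto simp: D_def g_def doubleton_eq_iff)
      moreover have "e \<in> P'" using True uv by (auto simp: P'_def)
      ultimately show ?thesis using uv(4) by simp
    next
      case False
      then have "{x \<in> D. g x = e} = {(u, v)}"
        using uv by (auto simp: D_def g_def doubleton_eq_iff)
      moreover have "e \<notin> P'" using False uv by (auto simp: P'_def doubleton_eq_iff)
      ultimately show ?thesis by simp
    qed
  qed
  have "(\<Sum>u\<in>U. \<Sum>v\<in>W. if u \<noteq> v then w {u, v} else 0) = (\<Sum>x\<in>U \<times> W. if fst x \<noteq> snd x then w (g x) else 0)"
    unfolding g_def by (simp add: sum.cartesian_product case_prod_beta)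
  also have "\<dots> = (\<Sum>x\<in>D. w (g x))" unfolding D_def using assms by (intro sum.inter_filter[symmetric]) auto
  also have "\<dots> = (\<Sum>e\<in>P. of_nat (card {x \<in> D. g x = e}) * w e)"
    using D P gD by (intro sum_fun_comp) auto
  also have "\<dots> = (\<Sum>e\<in>P. w e + (if e \<in> P' then w e else 0))"
    using fib by (intro sum.cong refl) auto
  also have "\<dots> = (\<Sum>e\<in>P. w e) + (\<Sum>e\<in>P'. w e)"
    by (simp add: sum.distrib sum_if_subset[OF P P'])
  finally show ?thesis by (simp add: cut_weight_def P_def P'_def)
qed

text \<open>Sign vectors are extremal for a bilinear form, so f and then g are replaced by signs.
  These cut the matrix into four blocks of constant sign, one factor C for each.\<close>

lemma bilinear_le_of_sets:
  fixes R :: "'a \<Rightarrow> 'a \<Rightarrow> real"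
  assumes "finite V" and C: "\<And>U W. U \<subseteq> V \<Longrightarrow> W \<subseteq> V \<Longrightarrow> \<bar>\<Sum>u\<in>U. \<Sum>v\<in>W. R u v\<bar> \<le> C"
    and f: "\<And>u. \<bar>f u\<bar> \<le> 1" and g: "\<And>v. \<bar>g v\<bar> \<le> 1"
  shows "\<bar>\<Sum>u\<in>V. \<Sum>v\<in>V. R u v * f u * g v\<bar> \<le> 4 * C"
proof -
  define s where "s u = (if (\<Sum>v\<in>V. R u v * g v) \<ge> 0 then 1 else - 1 :: real)" for u
  define t where "t v = (if (\<Sum>u\<in>V. R u v * s u) \<ge> 0 then 1 else - 1 :: real)" for v
  define S T where "S = {u \<in> V. s u = 1}" and "T = {v \<in> V. t v = 1}"
  have le: "\<bar>x * y\<bar> \<le> \<bar>y\<bar>" if "\<bar>x\<bar> \<le> 1" for x y :: real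
    using that mult_right_mono[of "\<bar>x\<bar>" 1 "\<bar>y\<bar>"] by (simp add: abs_mult)
  have "\<bar>\<Sum>u\<in>V. \<Sum>v\<in>V. R u v * f u * g v\<bar> = \<bar>\<Sum>u\<in>V. f u * (\<Sum>v\<in>V. R u v * g v)\<bar>"
    by (simp add: sum_distrib_left mult_ac)
  also have "\<dots> \<le> (\<Sum>u\<in>V. \<bar>\<Sum>v\<in>V. R u v * g v\<bar>)"
    by (rule order_trans[OF sum_abs sum_mono]) (rule le[OF f])
  also have "\<dots> = (\<Sum>u\<in>V. s u * (\<Sum>v\<in>V. R u v * g v))"
    by (intro sum.cong refl) (simp add: s_def)
  also have "\<dots> = (\<Sum>u\<in>V. \<Sum>v\<in>V. g v * (R u v * s u))" by (simp add: sum_distrib_left mult_ac)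
  also have "\<dots> = (\<Sum>v\<in>V. g v * (\<Sum>u\<in>V. R u v * s u))"
    by (subst sum.swap) (simp add: sum_distrib_left)
  also have "\<dots> \<le> (\<Sum>v\<in>V. \<bar>\<Sum>u\<in>V. R u v * s u\<bar>)"
    by (intro sum_mono order_trans[OF abs_ge_self le[OF g]])
  also have "\<dots> = (\<Sum>v\<in>V. t v * (\<Sum>u\<in>V. R u v * s u))"
    by (intro sum.cong refl) (simp add: t_def)
  also have "\<dots> = (\<Sum>v\<in>V. \<Sum>u\<in>V. R u v * s u * t v)" by (simp add: sum_distrib_left mult_ac)
  also have "\<dots> = (\<Sum>u\<in>V. \<Sum>v\<in>V. R u v * s u * t v)" by (rule sum.swap)
  also have "\<dots> = (\<Sum>u\<in>S. \<Sum>v\<in>T. R u v) - (\<Sum>u\<in>S. \<Sum>v\<in>V - T. R u v)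
      - (\<Sum>u\<in>V - S. \<Sum>v\<in>T. R u v) + (\<Sum>u\<in>V - S. \<Sum>v\<in>V - T. R u v)"
  proof -
    have ST: "S \<subseteq> V" "T \<subseteq> V" by (auto simp: S_def T_def)
    have inner: "(\<Sum>v\<in>V. R u v * s u * t v) = s u * ((\<Sum>v\<in>T. R u v) - (\<Sum>v\<in>V - T. R u v))" for u
    proof -
      have "(\<Sum>v\<in>V. R u v * s u * t v) = (\<Sum>v\<in>V - T. R u v * s u * t v) + (\<Sum>v\<in>T. R u v * s u * t v)"
        by (rule sum.subset_diff[OF ST(2) assms(1)])
      also have "(\<Sum>v\<in>V - T. R u v * s u * t v) = (\<Sum>v\<in>V - T. s u * - R u v)"
        by (intro sum.cong refl) (auto simp: T_def t_def split: if_splits)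
      also have "(\<Sum>v\<in>T. R u v * s u * t v) = (\<Sum>v\<in>T. s u * R u v)"
        by (intro sum.cong refl) (auto simp: T_def)
      finally show ?thesis by (simp add: sum_distrib_left[symmetric] sum_negf algebra_simps)
    qed
    have "(\<Sum>u\<in>V. \<Sum>v\<in>V. R u v * s u * t v) =
        (\<Sum>u\<in>V - S. s u * ((\<Sum>v\<in>T. R u v) - (\<Sum>v\<in>V - T. R u v))) +
        (\<Sum>u\<in>S. s u * ((\<Sum>v\<in>T. R u v) - (\<Sum>v\<in>V - T. R u v)))"
      unfolding inner by (rule sum.subset_diff[OF ST(1) assms(1)])
    also have "(\<Sum>u\<in>V - S. s u * ((\<Sum>v\<in>T. R u v) - (\<Sum>v\<in>V - T. R u v))) =
        (\<Sum>u\<in>V - S. (\<Sum>v\<in>V - T. R u v) - (\<Sum>v\<in>T. R u v))"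
      by (intro sum.cong refl) (auto simp: S_def s_def split: if_splits)
    also have "(\<Sum>u\<in>S. s u * ((\<Sum>v\<in>T. R u v) - (\<Sum>v\<in>V - T. R u v))) =
        (\<Sum>u\<in>S. (\<Sum>v\<in>T. R u v) - (\<Sum>v\<in>V - T. R u v))"
      by (intro sum.cong refl) (auto simp: S_def)
    finally show ?thesis by (simp add: sum_subtractf)
  qed
  also have "\<dots> \<le> 4 * C"
    using C[of S T] C[of S "V - T"] C[of "V - S" T] C[of "V - S" "V - T"]
    by (auto simp: S_def T_def)
  finally show ?thesis .
qed


text \<open>Every block sum consists of two cut weights and a diagonal part. The latter appears
  because the matrix has entries \<open>- p\<close> on the diagonal, where neither graph has edges.
  Four blocks give the constants 8 and 4.\<close>

lemma quasirandom_bilinear_le: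
  fixes G :: "'a pair_pre_digraph"
  assumes G: "G \<in> quasirandom_class n p \<epsilon>" and p: "0 \<le> p"
    and f: "\<And>u. \<bar>f u\<bar> \<le> 1" and g: "\<And>v. \<bar>g v\<bar> \<le> 1"
  shows "\<bar>\<Sum>u\<in>pverts G. \<Sum>v\<in>pverts G. (of_bool ((u, v) \<in> parcs G) - p) * f u * g v\<bar>
    \<le> 8 * \<epsilon> * (real n)\<^sup>2 + 4 * p * real n"
proof -
  from G obtain \<phi> where pg: "pair_graph G" and card: "card (pverts G) = n"
    and \<phi>: "bij_betw \<phi> (pverts G) {..<n}"
    and cut: "cut_dist (pverts G) (graph_weight G) (\<lambda>e. K_weight n p (\<phi> ` e)) < \<epsilon>"
    unfolding quasirandom_class_def by blast
  interpret pair_graph G by (rule pg)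
  define V where "V = pverts G"
  define R where "R u v = of_bool ((u, v) \<in> parcs G) - p" for u v
  define w where "w e = graph_weight G e - K_weight n p (\<phi> ` e)" for e
  have V: "finite V" using pair_finite_verts by (simp add: V_def)
  have sym: "(u, v) \<in> parcs G \<longleftrightarrow> (v, u) \<in> parcs G" for u v
    using pair_sym_arcs by (auto simp: symmetric_def sym_def)
  have cutw: "\<bar>cut_weight w U W\<bar> \<le> \<epsilon> * (real n)\<^sup>2" if UW: "U \<subseteq> V" "W \<subseteq> V" for U W
  proof (cases "n = 0")
    case True
    then have "V = {}" using card V by (simp add: V_def)
    then show ?thesis using UW True by (simp add: cut_weight_def)
  next
    case False
    let ?h = "\<lambda>(U, W). \<bar>cut_weight (graph_weight G) U W - cut_weight (\<lambda>e. K_weight n p (\<phi> ` e)) U W\<bar> / (real n)\<^sup>2"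
    have "?h (U, W) \<le> Max (?h ` (Pow V \<times> Pow V))"
      using V UW by (intro Max_ge imageI) auto
    also have "\<dots> < \<epsilon>" using cut unfolding cut_dist_def V_def card .
    finally have "\<bar>cut_weight (graph_weight G) U W - cut_weight (\<lambda>e. K_weight n p (\<phi> ` e)) U W\<bar> < \<epsilon> * (real n)\<^sup>2"
      using False by (simp add: divide_less_eq)
    then show ?thesis by (simp add: cut_weight_def w_def sum_subtractf)
  qed
  have w_edge: "w {u, v} = R u v" if uv: "u \<in> V" "v \<in> V" "u \<noteq> v" for u v
  proof -
    have "{u, v} \<in> uedges G \<longleftrightarrow> (u, v) \<in> parcs G"
      using sym by (auto simp: uedges_def doubleton_eq_iff)
    moreover have "\<phi> u \<noteq> \<phi> v" "\<phi> u < n" "\<phi> v < n"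
      using \<phi> uv by (auto simp: bij_betw_def inj_on_def V_def)
    ultimately show ?thesis by (simp add: w_def R_def graph_weight_def K_weight_def)
  qed
  have sets: "\<bar>\<Sum>u\<in>U. \<Sum>v\<in>W. R u v\<bar> \<le> 2 * \<epsilon> * (real n)\<^sup>2 + p * real n" if UW: "U \<subseteq> V" "W \<subseteq> V" for U W
  proof -
    have fin: "finite U" "finite W" using UW V finite_subset by auto
    have "(\<Sum>u\<in>U. \<Sum>v\<in>W. R u v) =
        (\<Sum>u\<in>U. \<Sum>v\<in>W. (if u \<noteq> v then w {u, v} else 0) + (if v = u then - p else 0))"
    proof (intro sum.cong refl)
      fix u v assume "u \<in> U" "v \<in> W"
      then have "u \<in> V" "v \<in> V" using UW by auto
      then show "R u v = (if u \<noteq> v then w {u, v} else 0) + (if v = u then - p else 0)"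
        using w_edge[of u v] pair_no_loops[of "(u, u)"] by (auto simp: R_def)
    qed
    also have "\<dots> = (cut_weight w U W + cut_weight w (U \<inter> W) (U \<inter> W)) + (\<Sum>u\<in>U. \<Sum>v\<in>W. if v = u then - p else 0)"
      unfolding sum.distrib ordered_cut_sum[OF fin] ..
    also have "(\<Sum>u\<in>U. \<Sum>v\<in>W. if v = u then - p else 0) = (\<Sum>u\<in>U. if u \<in> W then - p else 0)"
      using fin by simp
    finally have eq: "(\<Sum>u\<in>U. \<Sum>v\<in>W. R u v) =
        cut_weight w U W + cut_weight w (U \<inter> W) (U \<inter> W) + (\<Sum>u\<in>U. if u \<in> W then - p else 0)" .
    have "\<bar>\<Sum>u\<in>U. if u \<in> W then - p else 0\<bar> \<le> (\<Sum>u\<in>U. p)"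
      by (rule order_trans[OF sum_abs sum_mono]) (use p in auto)
    also have "\<dots> \<le> p * real n"
      using card_mono[OF V UW(1)] card p by (simp add: V_def mult.commute mult_left_mono)
    finally have diag: "\<bar>\<Sum>u\<in>U. if u \<in> W then - p else 0\<bar> \<le> p * real n" .
    have "\<bar>cut_weight w U W\<bar> \<le> \<epsilon> * (real n)\<^sup>2" "\<bar>cut_weight w (U \<inter> W) (U \<inter> W)\<bar> \<le> \<epsilon> * (real n)\<^sup>2"
      using UW by (auto intro!: cutw)
    then show ?thesis unfolding eq using diag by linarith
  qed
  have "\<bar>\<Sum>u\<in>V. \<Sum>v\<in>V. R u v * f u * g v\<bar> \<le> 4 * (2 * \<epsilon> * (real n)\<^sup>2 + p * real n)"
    by (rule bilinear_le_of_sets[OF V sets f g])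
  then show ?thesis by (simp add: V_def R_def)
qed

section \<open>Choice of the constants and assembly\<close>

theorem theorem3p4:
  fixes p \<epsilon> :: real
  assumes "0 < p" and "p \<le> 1"
    and "0 < \<epsilon>" and "\<epsilon> < (p / 4) ^ 12"
  shows "\<exists>n\<^sub>0::nat. \<forall>n\<ge>n\<^sub>0. \<forall>G \<in> (quasirandom_class n p \<epsilon> :: 'a pair_pre_digraph set).
           \<exists>rot. rotation_system G rot \<and> near_triangular (9 * \<epsilon>) G rot"
proof -
  \<comment> \<open>The error \<eta> is incurred four times: twice for the labels, as
    \<open>cover_cost\<close> has Lipschitz constant 2, once for the matching and once for the cut
    cycles. Hence \<open>8 + 4 / 100 = 201 / 25\<close> in the end.\<close>
  define \<eta> where "\<eta> = \<epsilon> * p / 100"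
  have \<eta>: "\<eta> > 0" using assms by (simp add: \<eta>_def)
  obtain L0 :: nat where "3 / \<eta> \<le> real L0" using real_arch_simple by blast
  define L where "L = Suc L0"
  have L: "L > 0" "3 / \<eta> \<le> real L" using \<open>3 / \<eta> \<le> real L0\<close> by (auto simp: L_def)
  obtain \<delta> :: real where \<delta>: "\<delta> > 0" and packing:
    "\<And>V (E :: ('a \<times> 'a) set) Y. finite V \<Longrightarrow> E \<subseteq> V \<times> V \<Longrightarrow> (\<And>u v w. 0 \<le> Y u v w \<and> Y u v w \<le> \<delta>) \<Longrightarrow>
      (\<And>u v w. Y u v w = Y v w u) \<Longrightarrow> (\<And>u v w. Y u v w \<noteq> 0 \<Longrightarrow> distinct [u, v, w] \<and> tri u v w \<subseteq> E) \<Longrightarrow>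
      \<exists>M. (\<forall>T\<in>M. \<exists>u v w. T = tri u v w \<and> Y u v w \<noteq> 0) \<and> disjoint M \<and>
        real (card E) - 3 * real (card M) \<le> (\<Sum>(u, v)\<in>E. cover_cost (\<Sum>w\<in>V. Y u v w)) + \<eta> * real (card E)"
    using \<eta> by (rule triangle_packing) blast
  \<comment> \<open>The entries ensure in turn that there is a vertex, that the diagonal is absorbed
    by \<open>\<epsilon> / 2\<close>, that weights stay below \<delta> and that the labels
    concentrate. Restricting to ascending triangles multiplies weights by \<open>L ^ 3\<close>, so n
    is chosen after L and \<delta>.\<close>
  define bounds where "bounds = {1, 8 * p / \<epsilon>, real L ^ 3 * 20 / (p ^ 3 * \<delta>), real L ^ 3 * 400 / (p ^ 6 * \<eta>\<^sup>2)}"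
  obtain n0 :: nat where n0: "Max bounds \<le> real n0" using real_arch_simple by blast
  show ?thesis
  proof (intro exI[of _ n0] allI impI ballI)
    fix n :: nat and G :: "'a pair_pre_digraph"
    assume "n0 \<le> n" and G: "G \<in> quasirandom_class n p \<epsilon>"
    have large: "b \<le> real n" if "b \<in> bounds" for b
    proof -
      have "b \<le> Max bounds" using that by (intro Max_ge) (auto simp: bounds_def)
      then show ?thesis using n0 \<open>n0 \<le> n\<close> by linarith
    qed
    have n: "1 \<le> real n" "8 * p / \<epsilon> \<le> real n" "real L ^ 3 * 20 / (p ^ 3 * \<delta>) \<le> real n"
      "real L ^ 3 * 400 / (p ^ 6 * \<eta>\<^sup>2) \<le> real n"
      by (rule large, simp add: bounds_def)+
    have pg: "pair_graph G" and card: "card (pverts G) = n" using G by (auto simp: quasirandom_class_def)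
    interpret pair_graph G by (rule pg)
    define V where "V = pverts G"
    define E where "E = parcs G"
    define A where "A u v = (of_bool ((u, v) \<in> E) :: real)" for u v
    have V: "finite V" "real (card V) = real n" "V \<noteq> {}"
      using pair_finite_verts card n(1) by (auto simp: V_def)
    have E: "E \<subseteq> V \<times> V" "finite E" using in_arcsD1 in_arcsD2 pair_finite_arcs by (auto simp: E_def V_def)
    have A01: "A u v = 0 \<or> A u v = 1" for u v by (auto simp: A_def)
    have A_sym: "A u v = A v u" for u v
      using pair_sym_arcs by (auto simp: A_def E_def symmetric_def sym_def)
    have A_irrefl: "A u u = 0" for u using pair_no_loops[of "(u, u)"] by (auto simp: A_def E_def)
    have bil: "\<bar>\<Sum>u\<in>V. \<Sum>v\<in>V. (A u v - p) * f u * g v\<bar> \<le> 17 / 2 * \<epsilon> * (real (card V))\<^sup>2"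
      if "\<And>u. \<bar>f u\<bar> \<le> 1" "\<And>v. \<bar>g v\<bar> \<le> 1" for f g
    proof -
      have "\<bar>\<Sum>u\<in>V. \<Sum>v\<in>V. (A u v - p) * f u * g v\<bar> \<le> 8 * \<epsilon> * (real n)\<^sup>2 + 4 * p * real n"
        using quasirandom_bilinear_le[OF G _ that] assms(1) by (simp add: A_def E_def V_def)
      also have "4 * p * real n \<le> \<epsilon> / 2 * real n * real n"
      proof -
        have "8 * p \<le> \<epsilon> * real n" using n(2) assms(3) by (simp add: field_simps)
        then have "(8 * p) * real n \<le> (\<epsilon> * real n) * real n" by (intro mult_right_mono) auto
        then show ?thesis by simp
      qed
      finally show ?thesis unfolding V(2) by (simp add: power2_eq_square)
    qed
    obtain X where X: "\<And>u v w. 0 \<le> X u v w \<and> X u v w \<le> 20 / (p ^ 3 * real n)"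
      and X_cyc: "\<And>u v w. X u v w = X v w u"
      and X_supp: "\<And>u v w. X u v w \<noteq> 0 \<Longrightarrow> u \<in> V \<and> v \<in> V \<and> w \<in> V \<and> A u v = 1 \<and> A v w = 1 \<and> A w u = 1"
      and X_cost: "(\<Sum>u\<in>V. \<Sum>v\<in>V. A u v * cover_cost (\<Sum>w\<in>V. X u v w)) \<le> 8 * \<epsilon> * p * (real n)\<^sup>2"
      using fractional_triangle_cover[OF V(1,3) A01 A_sym assms bil] unfolding V(2) by blast
    have X_distinct: "distinct [u, v, w]" if "X u v w \<noteq> 0" for u v w
      using X_supp[OF that] A_irrefl by auto
    have labels_bound: "real L ^ 3 * (20 / (p ^ 3 * real n)) * (\<Sum>w\<in>V. X u v w) \<le> \<eta>\<^sup>2" for u v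
    proof -
      have "(\<Sum>w\<in>V. X u v w) \<le> (\<Sum>w\<in>V. 20 / (p ^ 3 * real n))" using X by (intro sum_mono) auto
      also have "\<dots> = 20 / p ^ 3" using V(2) n(1) by simp
      finally have "real L ^ 3 * (20 / (p ^ 3 * real n)) * (\<Sum>w\<in>V. X u v w)
          \<le> real L ^ 3 * (20 / (p ^ 3 * real n)) * (20 / p ^ 3)"
        using assms(1) by (intro mult_left_mono) auto
      also have "\<dots> = real L ^ 3 * 400 / (p ^ 6 * real n)" by (simp add: eval_nat_numeral mult_ac)
      also have "\<dots> \<le> \<eta>\<^sup>2" using n(1,4) \<eta> assms(1) by (simp add: field_simps)
      finally show ?thesis .
    qed
    have "\<exists>f. (\<forall>a\<in>V. \<forall>b\<in>V. f (a, b) < L) \<and>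
      (\<Sum>u\<in>V. \<Sum>v\<in>V. \<bar>(\<Sum>w\<in>V. real L ^ 3 * X u v w * of_bool (ascending L f u v w)) - (\<Sum>w\<in>V. X u v w)\<bar>)
        \<le> \<eta> * (real (card V))\<^sup>2"
      by (rule random_labels[OF V(1) L(1) _ _ _ labels_bound \<eta>]) (use X X_distinct in blast)+
    then obtain f where f: "\<forall>a\<in>V. \<forall>b\<in>V. f (a, b) < L" and f_dev:
      "(\<Sum>u\<in>V. \<Sum>v\<in>V. \<bar>(\<Sum>w\<in>V. real L ^ 3 * X u v w * of_bool (ascending L f u v w)) - (\<Sum>w\<in>V. X u v w)\<bar>)
        \<le> \<eta> * (real n)\<^sup>2"
      unfolding V(2) by blast
    define Y where "Y u v w = real L ^ 3 * X u v w * of_bool (ascending L f u v w)" for u v w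
    have Y_supp: "X u v w \<noteq> 0 \<and> ascending L f u v w" if "Y u v w \<noteq> 0" for u v w
      using that by (auto simp: Y_def)
    have tri_E: "tri u v w \<subseteq> E" if "X u v w \<noteq> 0" for u v w
      using X_supp[OF that] by (auto simp: tri_def A_def)
    have "\<exists>M. (\<forall>T\<in>M. \<exists>u v w. T = tri u v w \<and> Y u v w \<noteq> 0) \<and> disjoint M \<and>
        real (card E) - 3 * real (card M) \<le> (\<Sum>(u, v)\<in>E. cover_cost (\<Sum>w\<in>V. Y u v w)) + \<eta> * real (card E)"
    proof (rule packing[OF V(1) E(1)])
      fix u v w
      have "real L ^ 3 * X u v w * of_bool (ascending L f u v w) \<le> real L ^ 3 * X u v w"
        using X by (simp add: of_bool_def)
      also have "\<dots> \<le> real L ^ 3 * (20 / (p ^ 3 * real n))" using X by (intro mult_left_mono) auto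
      also have "\<dots> \<le> \<delta>" using n(1,3) \<delta> assms(1) by (simp add: field_simps)
      finally show "0 \<le> Y u v w \<and> Y u v w \<le> \<delta>" using X by (simp add: Y_def)
      show "Y u v w = Y v w u" using X_cyc[of u v w] ascending_rotate[of L f u v w] by (simp add: Y_def)
      show "distinct [u, v, w] \<and> tri u v w \<subseteq> E" if "Y u v w \<noteq> 0"
        using X_distinct tri_E Y_supp[OF that] by blast
    qed
    then obtain M where M: "\<forall>T\<in>M. \<exists>u v w. T = tri u v w \<and> Y u v w \<noteq> 0" "disjoint M"
      "real (card E) - 3 * real (card M) \<le> (\<Sum>(u, v)\<in>E. cover_cost (\<Sum>w\<in>V. Y u v w)) + \<eta> * real (card E)"
      by blast
    have "\<exists>rot. rotation_system G rot \<and> real (card {e \<in> uedges G. \<not> in_two_triangular_faces G rot e})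
      \<le> real (card (parcs G)) - 3 * real (card M) + 3 * real (card (parcs G)) / real L"
    proof (rule embedding_of_packing[OF pg L(1) _ _ M(2)])
      show "\<forall>a\<in>pverts G. \<forall>b\<in>pverts G. f (a, b) < L" using f by (simp add: V_def)
      fix T assume "T \<in> M"
      then obtain u v w where "T = tri u v w" "Y u v w \<noteq> 0" using M(1) by blast
      then show "\<exists>u v w. T = tri u v w \<and> distinct [u, v, w] \<and> tri u v w \<subseteq> parcs G \<and> ascending L f u v w"
        using Y_supp X_distinct tri_E unfolding E_def by blast
    qed
    then obtain rot where rot: "rotation_system G rot" "real (card {e \<in> uedges G. \<not> in_two_triangular_faces G rot e})
      \<le> real (card E) - 3 * real (card M) + 3 * real (card E) / real L"
      unfolding E_def by blast
    have arcs_sum: "(\<Sum>(u, v)\<in>E. h u v) = (\<Sum>u\<in>V. \<Sum>v\<in>V. A u v * h u v)" for h :: "'a \<Rightarrow> 'a \<Rightarrow> real"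
    proof -
      have "(\<Sum>(u, v)\<in>E. h u v) = (\<Sum>x\<in>V \<times> V. if x \<in> E then (case x of (u, v) \<Rightarrow> h u v) else 0)"
        using V(1) by (intro sum_if_subset[symmetric] E(1)) auto
      also have "\<dots> = (\<Sum>(u, v)\<in>V \<times> V. A u v * h u v)"
        by (intro sum.cong refl) (auto simp: A_def)
      finally show ?thesis by (simp add: sum.cartesian_product)
    qed
    have cost: "(\<Sum>(u, v)\<in>E. cover_cost (\<Sum>w\<in>V. Y u v w)) \<le> 8 * \<epsilon> * p * (real n)\<^sup>2 + 2 * (\<eta> * (real n)\<^sup>2)"
    proof -
      have "A u v * cover_cost (\<Sum>w\<in>V. Y u v w) \<le> A u v * cover_cost (\<Sum>w\<in>V. X u v w)
          + 2 * \<bar>(\<Sum>w\<in>V. Y u v w) - (\<Sum>w\<in>V. X u v w)\<bar>" for u v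
        using cover_cost_lipschitz[of "\<Sum>w\<in>V. Y u v w" "\<Sum>w\<in>V. X u v w"] A01[of u v] by auto
      then have "(\<Sum>u\<in>V. \<Sum>v\<in>V. A u v * cover_cost (\<Sum>w\<in>V. Y u v w)) \<le>
          (\<Sum>u\<in>V. \<Sum>v\<in>V. A u v * cover_cost (\<Sum>w\<in>V. X u v w)
          + 2 * \<bar>(\<Sum>w\<in>V. Y u v w) - (\<Sum>w\<in>V. X u v w)\<bar>)"
        by (intro sum_mono)
      also have "\<dots> = (\<Sum>u\<in>V. \<Sum>v\<in>V. A u v * cover_cost (\<Sum>w\<in>V. X u v w))
          + 2 * (\<Sum>u\<in>V. \<Sum>v\<in>V. \<bar>(\<Sum>w\<in>V. Y u v w) - (\<Sum>w\<in>V. X u v w)\<bar>)"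
        by (simp only: sum.distrib sum_distrib_left)
      finally show ?thesis unfolding arcs_sum using X_cost f_dev unfolding Y_def by linarith
    qed
    have card_E: "real (card E) \<le> (real n)\<^sup>2" "(p - 17 / 2 * \<epsilon>) * (real n)\<^sup>2 \<le> real (card E)"
    proof -
      have "card E \<le> card (V \<times> V)" using E(1) V(1) by (intro card_mono) auto
      then have "card E \<le> n * n" using V(2) by (simp add: card_cartesian_product)
      then show "real (card E) \<le> (real n)\<^sup>2"
        by (metis of_nat_le_iff of_nat_mult power2_eq_square)
      have "real (card E) = (\<Sum>u\<in>V. \<Sum>v\<in>V. A u v)" using arcs_sum[of "\<lambda>_ _. 1"] by simp
      also have "\<dots> = (\<Sum>u\<in>V. \<Sum>v\<in>V. (A u v - p) * 1 * 1) + p * (real n)\<^sup>2"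
        by (simp add: sum_subtractf V(2) power2_eq_square)
      finally show "(p - 17 / 2 * \<epsilon>) * (real n)\<^sup>2 \<le> real (card E)"
        using bil[of "\<lambda>_. 1" "\<lambda>_. 1"] unfolding V(2) by (simp add: left_diff_distrib)
    qed
    have "3 * real (card E) / real L \<le> \<eta> * real (card E)"
    proof -
      have "3 / real L \<le> \<eta>" using L \<eta> by (simp add: field_simps)
      then have "3 / real L * real (card E) \<le> \<eta> * real (card E)" by (intro mult_right_mono) auto
      then show ?thesis by simp
    qed
    moreover have "\<eta> * real (card E) \<le> \<eta> * (real n)\<^sup>2" using card_E(1) \<eta> by (intro mult_left_mono) auto
    ultimately have "real (card {e \<in> uedges G. \<not> in_two_triangular_faces G rot e})
      \<le> 8 * \<epsilon> * p * (real n)\<^sup>2 + 4 * (\<eta> * (real n)\<^sup>2)"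
      using rot(2) M(3) cost by linarith
    also have "\<dots> = 201 / 25 * (\<epsilon> * p * (real n)\<^sup>2)" by (simp add: \<eta>_def)
    \<comment> \<open>Since \<epsilon> is below \<open>p / 1000\<close>, the gap between
      \<open>201 / 25\<close> and 9 covers the arcs that may be missing from
      \<open>p * n\<^sup>2\<close>.\<close>
    also have "\<dots> \<le> 9 * (\<epsilon> * ((p - 17 / 2 * \<epsilon>) * (real n)\<^sup>2))"
    proof -
      have "\<epsilon> \<le> p / 1000"
      proof -
        have "\<epsilon> \<le> p ^ 12 / 16777216" using assms(4) by (simp add: power_divide)
        moreover have "p ^ 12 \<le> p" using assms(1,2) power_decreasing[of 1 12 p] by simp
        ultimately show ?thesis using assms(1) by simp
      qed
      then have "201 / 25 * p \<le> 9 * (p - 17 / 2 * \<epsilon>)" using assms(1) by simp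
      then have "(201 / 25 * p) * (\<epsilon> * (real n)\<^sup>2) \<le> (9 * (p - 17 / 2 * \<epsilon>)) * (\<epsilon> * (real n)\<^sup>2)"
        using assms(3) by (intro mult_right_mono) auto
      then show ?thesis by (simp only: mult_ac)
    qed
    also have "\<dots> \<le> 9 * (\<epsilon> * real (card E))" using card_E(2) assms(3) by (intro mult_left_mono) auto
    also have "\<dots> \<le> 2 * (9 * \<epsilon>) * real (card (uedges G))"
    proof -
      have "uedges G \<subseteq> Pow V" using E(1) by (auto simp: uedges_def E_def)
      then have "finite (uedges G)" using V(1) finite_subset by blast
      then have "real (card E) \<le> 2 * real (card (uedges G))" using card_arcs_le[of G] by (simp add: E_def)
      then have "9 * \<epsilon> * real (card E) \<le> 9 * \<epsilon> * (2 * real (card (uedges G)))"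
        using assms(3) by (intro mult_left_mono) auto
      then show ?thesis by simp
    qed
    finally show "\<exists>rot. rotation_system G rot \<and> near_triangular (9 * \<epsilon>) G rot"
      using rot(1) unfolding near_triangular_def by blast
  qed
qed

end
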